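(* Let $H$ and $G$ be analytic functions in $\mathbb{D}$ such that $F=H+\overline{G}\in K_H$, i.e. $F$ is a convex harmonic mapping in $\mathbb{D}$. If $f(z)=H(z)+|z|^2\,\overline{G(z)}$ is locally univalent in $\mathbb{D}$, then $f$ is a univalent fully close-to-convex biharmonic mapping in $\mathbb{D}$.
   Context: $\mathbb{D}=\{z\in\mathbb{C}:|z|<1\}$ and $\mathbb{D}_r=\{|z|<r\}$. Univalent means injective; locally univalent means locally injective. A harmonic mapping $F=H+\overline{G}$ ($H,G$ analytic) is sense-preserving if its Jacobian $J_F=|H'|^2-|G'|^2$ is positive in $\mathbb{D}$. $S_H$ is the class of univalent sense-preserving harmonic mappings $F$ in $\mathbb{D}$ with $F(0)=0$ and $F_z(0)=1$; $K_H$ is the subclass of those $F\in S_H$ for which $F(\mathbb{D})$ is convex. A biharmonic mapping is a complex-valued function $f$ with $\Delta^2f=\Delta(\Delta f)=0$, where $\Delta=4\frac{\partial^2}{\partial z\,\partial\overline z}$. A domain is close-to-convex if its complement can be expressed as a union of closed half-lines such that the corresponding open half-lines are disjoint. A mapping $f$ of $\mathbb{D}$ is a close-to-convex mapping if it is univalent and $f(\mathbb{D})$ is a close-to-convex domain; it is fully close-to-convex if, in addition, $f(\mathbb{D}_r)$ is a close-to-convex domain for every $0<r<1$. *)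

theory Defs
  imports "HOL-Complex_Analysis.Complex_Analysis" "HOL-Library.Disjoint_Sets"
begin

text \<open>
  Functions on the unit disk are rendered as total functions on \<^typ>\<open>complex\<close>; the notions
  below depend only on their values on the relevant open set. The Frechet derivative is the
  real one: \<^term>\<open>1\<close> is the direction of x and \<^term>\<open>\<i>\<close> the direction of y.
\<close>

definition wirtinger_z :: "(complex \<Rightarrow> complex) \<Rightarrow> complex \<Rightarrow> complex" where
  "wirtinger_z f z =
     (frechet_derivative f (at z) 1 - \<i> * frechet_derivative f (at z) \<i>) / 2"

definition wirtinger_zbar :: "(complex \<Rightarrow> complex) \<Rightarrow> complex \<Rightarrow> complex" where
  "wirtinger_zbar f z =
     (frechet_derivative f (at z) 1 + \<i> * frechet_derivative f (at z) \<i>) / 2"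

definition laplacian :: "(complex \<Rightarrow> complex) \<Rightarrow> complex \<Rightarrow> complex" where
  "laplacian f z = 4 * wirtinger_z (wirtinger_zbar f) z"

text \<open>
  Real differentiability of class \<open>C\<^sup>k\<close> on an open set. Since \<^const>\<open>frechet_derivative\<close> is
  arbitrary where the derivative does not exist, the equation in \<open>biharmonic_on\<close>
  is meaningful only together with this regularity.
\<close>

primrec continuously_differentiable_on ::
  "nat \<Rightarrow> (complex \<Rightarrow> complex) \<Rightarrow> complex set \<Rightarrow> bool" where
  "continuously_differentiable_on 0 f S \<longleftrightarrow> continuous_on S f"
| "continuously_differentiable_on (Suc k) f S \<longleftrightarrow>
     f differentiable_on S \<and>
     (\<forall>v. continuously_differentiable_on k (\<lambda>z. frechet_derivative f (at z) v) S)"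

definition biharmonic_on :: "(complex \<Rightarrow> complex) \<Rightarrow> complex set \<Rightarrow> bool" where
  "biharmonic_on f S \<longleftrightarrow>
     open S \<and> continuously_differentiable_on 4 f S \<and>
     (\<forall>z\<in>S. laplacian (laplacian f) z = 0)"

definition locally_univalent_on :: "(complex \<Rightarrow> complex) \<Rightarrow> complex set \<Rightarrow> bool" where
  "locally_univalent_on f S \<longleftrightarrow>
     (\<forall>z\<in>S. \<exists>U. open U \<and> z \<in> U \<and> U \<subseteq> S \<and> inj_on f U)"

text \<open>
  The analytic parts of a harmonic mapping are unique up to additive constants, so the
  Jacobian below does not depend on the decomposition.
\<close>

definition sense_preserving_harmonic :: "(complex \<Rightarrow> complex) \<Rightarrow> bool" where
  "sense_preserving_harmonic F \<longleftrightarrow>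
     (\<exists>H G. H holomorphic_on ball 0 1 \<and> G holomorphic_on ball 0 1 \<and>
        (\<forall>z\<in>ball 0 1. F z = H z + cnj (G z)) \<and>
        (\<forall>z\<in>ball 0 1. (norm (deriv H z))\<^sup>2 - (norm (deriv G z))\<^sup>2 > 0))"

definition S_H :: "(complex \<Rightarrow> complex) set" where
  "S_H = {F. sense_preserving_harmonic F \<and> inj_on F (ball 0 1) \<and>
             F 0 = 0 \<and> wirtinger_z F 0 = 1}"

definition K_H :: "(complex \<Rightarrow> complex) set" where
  "K_H = {F \<in> S_H. convex (F ` ball 0 1)}"

definition closed_half_line :: "complex \<Rightarrow> complex \<Rightarrow> complex set" where
  "closed_half_line a u = {a + of_real t * u | t. t \<ge> 0}"

definition open_half_line :: "complex \<Rightarrow> complex \<Rightarrow> complex set" where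
  "open_half_line a u = {a + of_real t * u | t. t > 0}"

text \<open>
  A half-line is encoded by its origin and a direction of norm 1, so that distinct pairs are
  distinct half-lines. The whole plane is covered by the empty family.
\<close>

definition close_to_convex_domain :: "complex set \<Rightarrow> bool" where
  "close_to_convex_domain D \<longleftrightarrow>
     open D \<and> connected D \<and> D \<noteq> {} \<and>
     (\<exists>L \<subseteq> UNIV \<times> sphere 0 1.
        - D = (\<Union>(a, u)\<in>L. closed_half_line a u) \<and>
        disjoint_family_on (\<lambda>(a, u). open_half_line a u) L)"

definition close_to_convex_mapping :: "(complex \<Rightarrow> complex) \<Rightarrow> bool" where
  "close_to_convex_mapping f \<longleftrightarrow>
     inj_on f (ball 0 1) \<and> close_to_convex_domain (f ` ball 0 1)"

definition fully_close_to_convex_mapping :: "(complex \<Rightarrow> complex) \<Rightarrow> bool" where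
  "fully_close_to_convex_mapping f \<longleftrightarrow>
     close_to_convex_mapping f \<and>
     (\<forall>r. 0 < r \<and> r < 1 \<longrightarrow> close_to_convex_domain (f ` ball 0 r))"

end

theory Submission imports Defs begin

text \<open>
  On the circle of radius \<open>r\<close> the mapping \<open>f\<close> agrees with the harmonic mapping
  \<open>F\<^sub>\<epsilon> = H + \<epsilon> cnj G\<close>, \<open>\<epsilon> = r\<^sup>2\<close>. Convexity of the image of \<open>F = H + cnj G\<close> gives
  \<open>\<bar>G z\<^sub>2 - G z\<^sub>1\<bar> < \<bar>H z\<^sub>2 - H z\<^sub>1\<bar>\<close>, so that \<open>F\<^sub>\<epsilon>\<close> and the shears \<open>H - \<omega> G\<close>, \<open>\<bar>\<omega>\<bar> = 1\<close>, are
  univalent. Hence \<open>f\<close> is injective on every circle, and being locally univalent it is injective on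
  the disk. By the Jordan curve theorem \<open>f\<close> and \<open>F\<^sub>\<epsilon>\<close> map the disk of radius \<open>r\<close> onto the same domain.

  The shear \<open>H - \<omega> G\<close> is convex in one direction, and therefore
  \<open>Re (c (H' - \<omega> G') (1 - cnj p z) (1 - cnj q z)) \<ge> 0\<close> for suitable \<open>c\<close> and \<open>p\<close>, \<open>q\<close> on the unit
  circle. No boundary regularity is available for this, so the sheared domain is approximated by
  domains periodic under a vertical translation; there \<open>p\<close> and \<open>q\<close> are the fixed points of the
  automorphism of the disk induced by the translation. It follows that the tangent of
  \<open>F\<^sub>\<epsilon>\<close> on a circle never turns back by \<open>\<pi>\<close>. So the boundary curve admits outward half-lines whose
  directions turn monotonically, and these fill the complement without crossing. The unit disk itself
  is handled by a compactness argument on the directions.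
\<close>

section \<open>Univalence\<close>

text \<open>On a circle the tangent of \<open>F\<^sub>\<epsilon>\<close> contains the conjugate of
  \<open>z * G'\<close>, so it is not the boundary value of a holomorphic function. If its angle
  dropped by exactly pi between two points, both tangents would be parallel to one line; relative to
  this line the conjugation can be undone at both points, and the term becomes
  \<open>\<mu> * G'\<close> with one common constant of modulus at most one. For fixed points the
  difference of angles is harmonic in \<open>\<mu>\<close>, so the lower bound spreads from the
  circle \<open>\<bar>\<mu>\<bar> = 1\<close> to the disk. This is why the shears for all unimodular
  \<open>\<omega>\<close> are needed although \<open>F\<^sub>\<epsilon>\<close> is a single mapping.
  The two linear factors fit this count: each has an argument that grows more slowly than half of
  that of \<open>z\<close>, and the half-plane condition leaves an oscillation of at most pi. The
  drop is strictly smaller than pi and, by periodicity, has a margin; this margin lets a monotone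
  direction stay strictly within a right angle of the outer normal, so the half-lines leave the
  curve transversally.\<close>

lemma has_derivative_harmonic:
  assumes "H holomorphic_on S" "G holomorphic_on S" "open S" "z \<in> S"
  shows "((\<lambda>z. H z + c * cnj (G z)) has_derivative (\<lambda>h. deriv H z * h + c * cnj (deriv G z * h))) (at z)"
proof -
  have 1: "(H has_derivative (\<lambda>h. deriv H z * h)) (at z)"
    using assms holomorphic_derivI[of H S z] has_field_derivative_imp_has_derivative by blast
  have 2: "(G has_derivative (\<lambda>h. deriv G z * h)) (at z)"
    using assms holomorphic_derivI[of G S z] has_field_derivative_imp_has_derivative by blast
  show ?thesis
    by (intro derivative_intros has_derivative_cnj 1 2)
qed

text \<open>The segment from \<open>F z1\<close> to \<open>F z2\<close>, with direction
  \<open>e\<close>, lies in the image and can be pulled back by \<open>F\<close>. Along it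
  \<open>Re (cnj e * (H - cnj G))\<close> has derivative \<open>norm h ^ 2\<close> times the
  Jacobian, hence increases. With increments \<open>A\<close> of \<open>H\<close> and
  \<open>B\<close> of \<open>G\<close> one has \<open>e = A + cnj B\<close>, and the total increase
  is \<open>norm A ^ 2 - norm B ^ 2\<close>.\<close>

lemma norm_diff_less_of_convex_harmonic:
  assumes H: "H holomorphic_on ball 0 1" and G: "G holomorphic_on ball 0 1"
    and J: "\<And>z. z \<in> ball 0 1 \<Longrightarrow> norm (deriv G z) < norm (deriv H z)"
    and inj: "inj_on (\<lambda>z. H z + cnj (G z)) (ball 0 1)"
    and conv: "convex ((\<lambda>z. H z + cnj (G z)) ` ball 0 1)"
    and z: "z1 \<in> ball 0 1" "z2 \<in> ball 0 1" "z1 \<noteq> z2"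
  shows "norm (G z2 - G z1) < norm (H z2 - H z1)"
proof -
  define F where "F = (\<lambda>z. H z + cnj (G z))"
  define Z where "Z = inv_into (ball 0 1) F"
  have ZF: "Z (F z) = z" if "z \<in> ball 0 1" for z
    unfolding Z_def F_def by (rule inv_into_f_f[OF inj that])
  have contF: "continuous_on (ball 0 1) F"
    unfolding F_def by (intro continuous_intros holomorphic_on_imp_continuous_on H G)
  define e where "e = F z2 - F z1"
  have e0: "e \<noteq> 0" using inj z unfolding e_def F_def by (auto simp: inj_on_def)
  define w where "w = (\<lambda>t::real. F z1 + of_real t * e)"
  have w_in: "w t \<in> F ` ball 0 1" if "0 \<le> t" "t \<le> 1" for t
  proof -
    have "(1 - t) *\<^sub>R F z1 + t *\<^sub>R F z2 \<in> F ` ball 0 1"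
      using conv z that unfolding F_def by (intro convexD_alt) auto
    moreover have "(1 - t) *\<^sub>R F z1 + t *\<^sub>R F z2 = w t"
      by (simp add: w_def e_def algebra_simps scaleR_conv_of_real)
    ultimately show ?thesis by simp
  qed
  define \<eta> where "\<eta> = (\<lambda>t. Re (cnj e * (H (Z (w t)) - cnj (G (Z (w t))))))"
  have der: "\<exists>d. DERIV \<eta> t :> d \<and> 0 < d" if "0 \<le> t" "t \<le> 1" for t
  proof -
    from w_in[OF that] obtain z where zb: "z \<in> ball 0 1" and wz: "w t = F z" by auto
    define a where "a = deriv H z"
    define b where "b = deriv G z"
    have ab: "norm b < norm a" using J[OF zb] by (simp add: a_def b_def)
    define D where "D = (norm a)\<^sup>2 - (norm b)\<^sup>2"
    have D: "D > 0" using ab by (simp add: D_def power_strict_mono)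
    have D': "complex_of_real D = a * cnj a - b * cnj b"
      by (simp add: D_def complex_norm_square flip: of_real_power)
    \<comment> \<open>The inverse of the real-linear derivative of \<open>F\<close> at
      \<open>z\<close>, whose determinant is the Jacobian \<open>D\<close>.\<close>
    define g where "g = (\<lambda>w. (cnj a * w - cnj b * cnj w) / of_real D)"
    have derF: "(F has_derivative (\<lambda>h. a * h + cnj (b * h))) (at z)"
      using has_derivative_harmonic[OF H G open_ball zb, of 1] by (simp add: F_def a_def b_def)
    have idg: "a * g v + cnj (b * g v) = v" for v
    proof -
      have "a * g v + cnj (b * g v) = ((a * cnj a - b * cnj b) * v) / of_real D"
        using D by (simp add: g_def field_simps)
      then show ?thesis using D by (simp flip: D')
    qed
    have derZ: "(Z has_derivative g) (at (F z))"
      by (rule has_derivative_inverse_strong[OF open_ball zb contF ZF derF])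
         (auto simp: fun_eq_iff idg simp del: complex_cnj_mult)
    define h where "h = g e"
    have h: "a * h + cnj (b * h) = e" unfolding h_def by (rule idg)
    have dw: "(w has_vector_derivative e) (at t)"
      unfolding w_def by (auto intro!: derivative_eq_intros simp: has_vector_derivative_def scaleR_conv_of_real fun_eq_iff)
    have dZ: "((Z \<circ> w) has_vector_derivative h) (at t)"
      unfolding h_def using vector_derivative_diff_chain_within[OF dw, of Z g] derZ wz
      by (simp add: has_derivative_at_withinI)
    have Zw: "(Z \<circ> w) t = z" using ZF[OF zb] by (simp add: wz)
    have dH: "((H \<circ> (Z \<circ> w)) has_vector_derivative (h * a)) (at t)"
      unfolding a_def using H zb Zw by (intro field_vector_diff_chain_at dZ) (auto intro: holomorphic_derivI)
    have dG: "((G \<circ> (Z \<circ> w)) has_vector_derivative (h * b)) (at t)"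
      unfolding b_def using G zb Zw by (intro field_vector_diff_chain_at dZ) (auto intro: holomorphic_derivI)
    have "((\<lambda>t. H (Z (w t)) - cnj (G (Z (w t)))) has_vector_derivative (h * a - cnj (h * b))) (at t)"
      using dH dG unfolding o_def by (intro has_vector_derivative_diff has_vector_derivative_cnj)
    then have "((\<lambda>t. cnj e * (H (Z (w t)) - cnj (G (Z (w t))))) has_vector_derivative (cnj e * (h * a - cnj (h * b)))) (at t)"
      by (rule has_vector_derivative_mult_right)
    then have "(\<eta> has_vector_derivative Re (cnj e * (h * a - cnj (h * b)))) (at t)"
      unfolding \<eta>_def by (rule bounded_linear.has_vector_derivative[OF bounded_linear_Re])
    then have "DERIV \<eta> t :> Re (cnj e * (h * a - cnj (h * b)))"
      by (simp add: has_real_derivative_iff_has_vector_derivative)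
    moreover have "Re (cnj e * (h * a - cnj (h * b))) = (norm h)\<^sup>2 * D"
      unfolding h[symmetric] D_def cmod_power2 by (simp add: algebra_simps power2_eq_square)
    moreover have "h \<noteq> 0" using h e0 by auto
    ultimately show ?thesis using D by (intro exI[of _ "(norm h)\<^sup>2 * D"]) auto
  qed
  have "\<eta> 0 < \<eta> 1"
    by (rule DERIV_pos_imp_increasing[of 0 1 \<eta>]) (use der in auto)
  then have "0 < Re (cnj e * ((H z2 - H z1) - cnj (G z2 - G z1)))"
    using z by (simp add: \<eta>_def w_def ZF e_def algebra_simps)
  also have "\<dots> = (norm (H z2 - H z1))\<^sup>2 - (norm (G z2 - G z1))\<^sup>2"
    unfolding e_def F_def cmod_power2 by (simp add: algebra_simps power2_eq_square)
  finally show ?thesis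
    by (smt (verit, best) norm_ge_zero power_mono)
qed

text \<open>Beyond the largest radius \<open>s\<close> of injectivity there are colliding pairs of
  points. If \<open>s < 1\<close>, a limit of such pairs lies in the closed disk of radius
  \<open>s\<close>, on which \<open>f\<close> is still injective: two distinct points are excluded
  there, and a double point contradicts local injectivity. Interior and boundary points cannot
  collide by invariance of domain.\<close>

lemma inj_on_ball_of_circles:
  fixes f :: "complex \<Rightarrow> complex"
  assumes cont: "continuous_on (ball 0 1) f"
    and loc: "\<And>z. z \<in> ball 0 1 \<Longrightarrow> \<exists>U. open U \<and> z \<in> U \<and> U \<subseteq> ball 0 1 \<and> inj_on f U"
    and circ: "\<And>r. \<lbrakk>0 < r; r < 1\<rbrakk> \<Longrightarrow> inj_on f (sphere 0 r)"
  shows "inj_on f (ball 0 1)"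
proof -
  define A where "A = {r. 0 < r \<and> r \<le> 1 \<and> inj_on f (ball 0 r)}"
  obtain U where U: "open U" "0 \<in> U" "U \<subseteq> ball 0 1" "inj_on f U"
    using loc[of 0] by auto
  obtain r0 where r0: "r0 > 0" "ball 0 r0 \<subseteq> U" using U openE by blast
  have "ball 0 (min r0 1) \<subseteq> U" using r0(2) by (auto simp: subset_iff)
  then have "inj_on f (ball 0 (min r0 1))" by (rule inj_on_subset[OF U(4)])
  then have "min r0 1 \<in> A" unfolding A_def using r0 by simp
  then have Ane: "A \<noteq> {}" by auto
  have bdd: "bdd_above A" unfolding A_def by (rule bdd_aboveI[of _ 1]) auto
  define s where "s = Sup A"
  have s1: "s \<le> 1" unfolding s_def by (rule cSup_least[OF Ane]) (auto simp: A_def)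
  have s0: "s > 0" using \<open>min r0 1 \<in> A\<close> cSup_upper[OF _ bdd, of "min r0 1"] r0 by (auto simp: s_def)
  have inj_s: "inj_on f (ball 0 s)"
  proof (rule inj_onI)
    fix x y assume xy: "x \<in> ball 0 s" "y \<in> ball 0 s" "f x = f y"
    then have "max (norm x) (norm y) < Sup A" by (auto simp: s_def)
    then obtain r where "r \<in> A" "max (norm x) (norm y) < r"
      using less_cSup_iff[OF Ane bdd] by blast
    then show "x = y" using xy(3) by (auto simp: A_def inj_on_def)
  qed
  have "\<not> s < 1"
  proof
    assume s_lt: "s < 1"
    have mixed: False if x: "x \<in> ball 0 s" and y: "norm y = s" and eq: "f x = f y" for x y
    proof -
      \<comment> \<open>Half the gap between \<open>x\<close> and the circle:
        \<open>ball x e\<close> keeps distance \<open>e\<close> from the circle on which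
        \<open>y\<close> lies.\<close>
      define e where "e = (s - norm x) / 2"
      have e: "e > 0" using x by (simp add: e_def)
      have sub: "ball x e \<subseteq> ball 0 (s - e)"
      proof
        fix v assume "v \<in> ball x e"
        then have "norm (v - x) < e" by (simp add: dist_norm norm_minus_commute)
        then have "norm v < norm x + e" using norm_triangle_sub[of v x] by linarith
        then show "v \<in> ball 0 (s - e)" using e by (simp add: e_def field_simps)
      qed
      have sub': "ball x e \<subseteq> ball 0 s" using sub e by auto
      have "open (f ` ball x e)"
        using sub' s1 by (intro invariance_of_domain continuous_on_subset[OF cont] open_ball inj_on_subset[OF inj_s]) auto
      moreover have "f y \<in> f ` ball x e" using eq e by (metis centre_in_ball imageI)
      ultimately obtain d where d: "d > 0" "ball (f y) d \<subseteq> f ` ball x e"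
        using openE by blast
      have "y \<in> ball 0 1" using y s_lt by simp
      then have "isCont f y" using cont continuous_on_eq_continuous_at open_ball by blast
      then obtain d' where d': "d' > 0" "\<And>v. dist v y < d' \<Longrightarrow> dist (f v) (f y) < d"
        using d(1) unfolding continuous_at_eps_delta by blast
      define m where "m = min (d' / 2) (e / 2)"
      have m: "0 < m" "m < d'" "m < e" using d' e by (auto simp: m_def)
      have "2 * e \<le> s" using norm_ge_zero[of x] unfolding e_def by simp
      then have ms: "m < s" using m(1,3) by simp
      \<comment> \<open>\<open>v\<close> is \<open>y\<close> moved inwards by \<open>m\<close>.
        Since \<open>m < e\<close> it misses \<open>ball x e\<close>, and since
        \<open>m < d'\<close> its value is also taken in that ball.\<close>
      define v where "v = (1 - of_real (m / s)) * y"
      have "norm v = s - m"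
      proof -
        have "norm v = norm (of_real (1 - m / s) :: complex) * s"
          using y by (simp add: v_def norm_mult)
        also have "\<dots> = (1 - m / s) * s" using ms s0 by (simp only: norm_of_real) (simp add: field_simps)
        also have "\<dots> = s - m" using s0 by (simp add: left_diff_distrib)
        finally show ?thesis .
      qed
      moreover have "dist v y = m"
      proof -
        have "v - y = - of_real (m / s) * y" by (simp add: v_def algebra_simps)
        then have "dist v y = norm (of_real (m / s) :: complex) * s" using y by (simp only: dist_norm norm_mult norm_minus_cancel)
        then show ?thesis using m s0 by (simp only: norm_of_real) (simp add: field_simps)
      qed
      ultimately have v: "v \<in> ball 0 s" "v \<notin> ball x e" "f v \<in> ball (f y) d"
        using m subsetD[OF sub, of v] d'(2)[of v] by (auto simp: dist_commute)
      then obtain v' where "v' \<in> ball x e" "f v' = f v" using d(2) by (metis imageE subsetD)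
      then show False using inj_s v sub' by (metis inj_onD subsetD)
    qed
    have inj_cs: "inj_on f (cball 0 s)"
    proof (rule inj_onI)
      fix x y assume xy: "x \<in> cball 0 s" "y \<in> cball 0 s" "f x = f y"
      consider "norm x < s" "norm y < s" | "norm x < s" "norm y = s" | "norm x = s" "norm y < s"
        | "norm x = s" "norm y = s" using xy by fastforce
      then show "x = y"
      proof cases
        case 1 then show ?thesis using inj_s xy(3) by (auto simp: inj_on_def)
      next
        case 2 then show ?thesis using mixed[of x y] xy(3) by auto
      next
        case 3 then show ?thesis using mixed[of y x] xy(3) by auto
      next
        case 4 then show ?thesis using circ[OF s0 s_lt] xy(3) by (auto simp: inj_on_def)
      qed
    qed
    define \<rho> where "\<rho> = (\<lambda>n. s + (1 - s) / of_nat (Suc n))"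
    have \<rho>: "s < \<rho> n" "\<rho> n \<le> 1" for n
    proof -
      have "(1 - s) / of_nat (Suc n) \<le> (1 - s) / 1"
        using s_lt by (intro divide_left_mono) auto
      then show "\<rho> n \<le> 1" by (simp add: \<rho>_def)
      show "s < \<rho> n" using s_lt by (simp add: \<rho>_def)
    qed
    have "\<rho> n \<notin> A" for n
      using cSup_upper[OF _ bdd, of "\<rho> n"] \<rho>[of n] by (auto simp: s_def)
    then have "\<not> inj_on f (ball 0 (\<rho> n))" for n
      using \<rho>[of n] s0 by (auto simp: A_def)
    then have "\<forall>n. \<exists>x y. x \<in> ball 0 (\<rho> n) \<and> y \<in> ball 0 (\<rho> n) \<and> f x = f y \<and> x \<noteq> y"
      unfolding inj_on_def by blast
    then obtain X Y where XY: "\<And>n. X n \<in> ball 0 (\<rho> n)" "\<And>n. Y n \<in> ball 0 (\<rho> n)"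
      "\<And>n. f (X n) = f (Y n)" "\<And>n. X n \<noteq> Y n" by metis
    have "compact (cball 0 1 \<times> cball 0 1 :: (complex \<times> complex) set)"
      by (intro compact_Times compact_cball)
    moreover have "(X n, Y n) \<in> cball 0 1 \<times> cball 0 1" for n
      using XY(1,2)[of n] \<rho>(2)[of n] by auto
    ultimately obtain l r where l: "strict_mono r" "((\<lambda>n. (X n, Y n)) \<circ> r) \<longlonglongrightarrow> l"
      unfolding compact_def by meson
    have lX: "(X \<circ> r) \<longlonglongrightarrow> fst l" and lY: "(Y \<circ> r) \<longlonglongrightarrow> snd l"
      using tendsto_fst[OF l(2)] tendsto_snd[OF l(2)] by (auto simp: o_def)
    have "(\<lambda>n. s + (1 - s) * inverse (of_nat (Suc n))) \<longlonglongrightarrow> s + (1 - s) * 0"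
      by (intro tendsto_intros LIMSEQ_inverse_real_of_nat)
    then have "\<rho> \<longlonglongrightarrow> s" by (simp add: \<rho>_def divide_inverse)
    then have \<rho>r: "(\<rho> \<circ> r) \<longlonglongrightarrow> s" using l(1) LIMSEQ_subseq_LIMSEQ by blast
    have nX: "norm (fst l) \<le> s"
      by (rule LIMSEQ_le[OF tendsto_norm[OF lX] \<rho>r]) (use XY(1) in \<open>auto intro!: exI[of _ 0] less_imp_le\<close>)
    have nY: "norm (snd l) \<le> s"
      by (rule LIMSEQ_le[OF tendsto_norm[OF lY] \<rho>r]) (use XY(2) in \<open>auto intro!: exI[of _ 0] less_imp_le\<close>)
    have cf: "isCont f v" if "norm v \<le> s" for v
      using cont that s_lt by (intro continuous_on_interior[OF cont]) auto
    have "(\<lambda>n. f (X (r n))) \<longlonglongrightarrow> f (fst l)" "(\<lambda>n. f (Y (r n))) \<longlonglongrightarrow> f (snd l)"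
      using isCont_tendsto_compose[OF cf[OF nX]] isCont_tendsto_compose[OF cf[OF nY]] lX lY by (auto simp: o_def)
    then have "f (fst l) = f (snd l)" using XY(3) LIMSEQ_unique by auto
    then have eq: "fst l = snd l" using inj_cs nX nY by (auto simp: inj_on_def)
    obtain U where U: "open U" "fst l \<in> U" "inj_on f U"
      using loc[of "fst l"] nX s_lt by auto
    have "eventually (\<lambda>n. (X \<circ> r) n \<in> U) sequentially" "eventually (\<lambda>n. (Y \<circ> r) n \<in> U) sequentially"
      using lX lY U eq topological_tendstoD by metis+
    then have "eventually (\<lambda>n. (X \<circ> r) n \<in> U \<and> (Y \<circ> r) n \<in> U) sequentially"
      by (rule eventually_conj)
    then obtain n where "X (r n) \<in> U" "Y (r n) \<in> U" by (auto simp: eventually_sequentially)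
    then show False using U(3) XY(3,4)[of "r n"] by (auto simp: inj_on_def)
  qed
  then show ?thesis using s1 inj_s by auto
qed

section \<open>Distortion and automorphisms of the disk\<close>

lemma holomorphic_log_ball:
  assumes "f holomorphic_on ball a r" "\<And>z. z \<in> ball a r \<Longrightarrow> f z \<noteq> 0"
  obtains g where "g holomorphic_on ball a r" "\<And>z. z \<in> ball a r \<Longrightarrow> f z = exp (g z)"
proof -
  have "simply_connected (ball a r)" by (simp add: convex_imp_simply_connected)
  then have "\<forall>f. f holomorphic_on ball a r \<and> (\<forall>z\<in>ball a r. f z \<noteq> 0) \<longrightarrow>
      (\<exists>g. g holomorphic_on ball a r \<and> (\<forall>z\<in>ball a r. f z = exp (g z)))"
    using simply_connected_eq_holomorphic_log[OF open_ball] by (rule iffD1[THEN conjunct2, rotated])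
  then show ?thesis using assms that by blast
qed

lemma constant_of_exp_constant:
  assumes f: "f holomorphic_on ball a r" and e: "\<And>z. z \<in> ball a r \<Longrightarrow> exp (f z) = c"
  obtains C where "\<And>z. z \<in> ball a r \<Longrightarrow> f z = C"
proof -
  have "(f has_field_derivative 0) (at z within ball a r)" if z: "z \<in> ball a r" for z
  proof -
    have d: "(f has_field_derivative deriv f z) (at z)" by (rule holomorphic_derivI[OF f open_ball z])
    then have "((\<lambda>z. exp (f z)) has_field_derivative exp (f z) * deriv f z) (at z)"
      by (auto intro!: derivative_eq_intros)
    moreover have "((\<lambda>z. exp (f z)) has_field_derivative 0) (at z)"
      by (rule has_field_derivative_transform_within_open[OF DERIV_const open_ball z]) (simp only: e)
    ultimately have "exp (f z) * deriv f z = 0" by (rule DERIV_unique)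
    then show ?thesis using d has_field_derivative_at_within by fastforce
  qed
  then show ?thesis using has_field_derivative_zero_constant[OF convex_ball, of a r f] that by metis
qed

text \<open>Two points of the image of \<open>L\<close> that differ by 2 pi i give the same value of
  \<open>j\<close>, so the image contains no disk of radius greater than pi. \<open>Bloch\<close>
  provides a disk of radius \<open>R * norm (deriv L z) / 12\<close>, whence the factor 12.\<close>

lemma log_deriv_bound_of_inj:
  assumes j: "j holomorphic_on ball 0 1" and inj: "inj_on j (ball 0 1)"
    and L: "L holomorphic_on ball 0 1" and expL: "\<And>z. z \<in> ball 0 1 \<Longrightarrow> exp (L z) = j z - p"
    and z: "z \<in> ball 0 1"
  shows "norm (deriv L z) \<le> 12 * pi / (1 - norm z)"
proof (rule ccontr)
  define R where "R = 1 - norm z"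
  have R: "R > 0" using z by (simp add: R_def)
  assume "\<not> ?thesis"
  then have big: "R * norm (deriv L z) / 12 > pi" using R by (simp add: R_def field_simps)
  have sub: "ball z R \<subseteq> ball 0 1"
    unfolding R_def by (simp add: ball_subset_ball_iff)
  obtain b where b: "ball b (R * norm (deriv L z) / 12) \<subseteq> L ` ball z R"
    by (rule Bloch[OF holomorphic_on_subset[OF L sub] R order_refl])
  have "b + \<i> * pi \<in> ball b (R * norm (deriv L z) / 12)" "b - \<i> * pi \<in> ball b (R * norm (deriv L z) / 12)"
    using big by (simp_all add: dist_norm norm_mult)
  then have "b + \<i> * pi \<in> L ` ball z R" "b - \<i> * pi \<in> L ` ball z R" using b by auto
  then obtain x y where x: "x \<in> ball z R" "L x = b + \<i> * pi" and y: "y \<in> ball z R" "L y = b - \<i> * pi"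
    by (auto simp del: mem_ball)
  have "exp (L x) = exp (L y)"
    unfolding x y exp_add exp_diff by (simp add: exp_eq_polar)
  then have "j x = j y" using expL sub x(1) y(1) by (metis diff_add_cancel subsetD)
  then have "x = y" using inj sub x(1) y(1) by (meson inj_onD subsetD)
  then show False using x(2) y(2) by simp
qed

text \<open>A weak form of Koebe's distortion theorem: Bloch's theorem bounds the derivative of
  \<open>log (j - p)\<close>, whose image contains no disk of radius larger than \<open>\<pi>\<close>.\<close>

lemma inj_dist_omitted_lower_bound:
  assumes j: "j holomorphic_on ball 0 1" and inj: "inj_on j (ball 0 1)"
    and p: "p \<notin> j ` ball 0 1" and z: "norm z < 1"
  shows "norm (j 0 - p) * (1 - norm z) powr (12 * pi) \<le> norm (j z - p)"
proof -
  have "(\<lambda>z. j z - p) holomorphic_on ball 0 1" by (intro holomorphic_intros j)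
  moreover have "j z - p \<noteq> 0" if "z \<in> ball 0 1" for z using p that by auto
  ultimately obtain L where L: "L holomorphic_on ball 0 1" "\<And>z. z \<in> ball 0 1 \<Longrightarrow> j z - p = exp (L z)"
    using holomorphic_log_ball[of "\<lambda>z. j z - p" 0 1] by blast
  \<comment> \<open>The second term integrates the bound on \<open>deriv L\<close> along the radius
    to \<open>z\<close>, so \<open>h\<close> is nondecreasing.\<close>
  define h where "h = (\<lambda>t. Re (L (of_real t * z)) - 12 * pi * ln (1 - t * norm z))"
  have "h 0 \<le> h 1"
  proof (rule DERIV_nonneg_imp_nondecreasing[of 0 1 h])
    fix t :: real assume t: "0 \<le> t" "t \<le> 1"
    have tz: "t * norm z < 1" using t z by (meson le_less_trans mult_left_le_one_le norm_ge_zero)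
    then have tzb: "of_real t * z \<in> ball 0 1" using t by (simp add: norm_mult)
    have "((\<lambda>t. of_real t * z) has_vector_derivative z) (at t)"
      by (auto intro!: derivative_eq_intros simp: has_vector_derivative_def scaleR_conv_of_real fun_eq_iff)
    then have "((L \<circ> (\<lambda>t. of_real t * z)) has_vector_derivative (z * deriv L (of_real t * z))) (at t)"
      using L(1) tzb by (intro field_vector_diff_chain_at) (auto intro: holomorphic_derivI)
    then have "((\<lambda>t. Re (L (of_real t * z))) has_vector_derivative Re (z * deriv L (of_real t * z))) (at t)"
      unfolding o_def by (rule bounded_linear.has_vector_derivative[OF bounded_linear_Re])
    then have 1: "((\<lambda>t. Re (L (of_real t * z))) has_real_derivative Re (z * deriv L (of_real t * z))) (at t)"
      by (simp add: has_real_derivative_iff_has_vector_derivative)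
    have 2: "((\<lambda>t. 12 * pi * ln (1 - t * norm z)) has_real_derivative - (norm z * (12 * pi / (1 - t * norm z)))) (at t)"
      using tz by (auto intro!: derivative_eq_intros)
    have "\<bar>Re (z * deriv L (of_real t * z))\<bar> \<le> norm z * norm (deriv L (of_real t * z))"
      by (metis abs_Re_le_cmod norm_mult)
    also have "\<dots> \<le> norm z * (12 * pi / (1 - norm (of_real t * z)))"
      using L(2)[symmetric] by (intro mult_left_mono log_deriv_bound_of_inj[OF j inj L(1) _ tzb]) auto
    also have "norm (of_real t * z) = t * norm z" using t by (simp add: norm_mult)
    finally have "0 \<le> Re (z * deriv L (of_real t * z)) - (- (norm z * (12 * pi / (1 - t * norm z))))" by linarith
    then show "\<exists>y. (h has_real_derivative y) (at t) \<and> 0 \<le> y"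
      unfolding h_def using DERIV_diff[OF 1 2] by blast
  qed simp
  then have "Re (L 0) + 12 * pi * ln (1 - norm z) \<le> Re (L z)" by (simp add: h_def)
  then have "exp (Re (L 0)) * exp (12 * pi * ln (1 - norm z)) \<le> exp (Re (L z))" by (simp flip: exp_add)
  moreover have "exp (12 * pi * ln (1 - norm z)) = (1 - norm z) powr (12 * pi)" using z by (simp add: powr_def)
  moreover have "norm (j 0 - p) = exp (Re (L 0))" "norm (j z - p) = exp (Re (L z))" using L z by auto
  ultimately show ?thesis by simp
qed

section \<open>The disk as a strip, and the automorphisms of the disk\<close>

lemma unimodular_denominator:
  fixes q z :: complex
  assumes "norm q = 1" "norm z < 1"
  shows "1 - cnj q * z \<noteq> 0" "Re (1 - cnj q * z) > 0"
proof -
  have "norm (cnj q * z) < 1" using assms by (simp add: norm_mult)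
  then show "Re (1 - cnj q * z) > 0" using complex_Re_le_cmod[of "cnj q * z"] by simp
  then show "1 - cnj q * z \<noteq> 0" by force
qed

text \<open>\<open>\<phi>\<close> is the logarithm of a Moebius map with zero \<open>p\<close> and
  pole \<open>q\<close>. The factor \<open>n = 1 - cnj q * p\<close> turns its half-plane into the
  right one, so that the principal branch has values in the strip; \<open>Xi\<close> is the explicit
  inverse.\<close>

lemma strip_map:
  fixes p q :: complex
  assumes p: "norm p = 1" and q: "norm q = 1" and pq: "p \<noteq> q"
  obtains \<phi> Xi where
    "\<And>z. z \<in> ball 0 1 \<Longrightarrow>
       (\<phi> has_field_derivative (cnj q - cnj p) / ((1 - cnj p * z) * (1 - cnj q * z))) (at z)"
    "\<And>z. z \<in> ball 0 1 \<Longrightarrow> \<bar>Im (\<phi> z)\<bar> < pi / 2"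
    "\<And>z. z \<in> ball 0 1 \<Longrightarrow> Xi (\<phi> z) = z"
    "\<And>\<zeta>. \<bar>Im \<zeta>\<bar> < pi / 2 \<Longrightarrow> Xi \<zeta> \<in> ball 0 1 \<and> \<phi> (Xi \<zeta>) = \<zeta>"
    "continuous_on {\<zeta>. \<bar>Im \<zeta>\<bar> < pi / 2} Xi"
    "\<And>z. z \<in> ball 0 1 \<Longrightarrow> exp (\<phi> z) = (1 - cnj q * p) * ((1 - cnj p * z) / (1 - cnj q * z))"
proof -
  define n where "n = 1 - cnj q * p"
  define M where "M = (\<lambda>z. (1 - cnj p * z) / (1 - cnj q * z))"
  define \<phi> where "\<phi> = (\<lambda>z. Ln (n * M z))"
  define Xi where "Xi = (\<lambda>\<zeta>. (1 - exp \<zeta> / n) / (cnj p - exp \<zeta> / n * cnj q))"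
  have pp: "p * cnj p = 1" "q * cnj q = 1"
    using complex_norm_square[of p] complex_norm_square[of q] p q by simp_all
  have n0: "n \<noteq> 0"
  proof
    assume "n = 0"
    then have "q * (1 - cnj q * p) = 0" by (simp add: n_def)
    then have "q - (q * cnj q) * p = 0" by (simp add: algebra_simps)
    then show False using pp pq by simp
  qed
  \<comment> \<open>For \<open>\<mu> = M z\<close> one has
    \<open>1 - \<mu> = z * (cnj p - \<mu> * cnj q)\<close>; the identity therefore translates
    \<open>norm z < 1\<close> into \<open>Re (n * \<mu>) > 0\<close>, in both directions.\<close>
  have key: "(norm (cnj p - \<mu> * cnj q))\<^sup>2 - (norm (1 - \<mu>))\<^sup>2 = 2 * Re (n * \<mu>)" for \<mu>
  proof -
    have "complex_of_real ((norm (cnj p - \<mu> * cnj q))\<^sup>2 - (norm (1 - \<mu>))\<^sup>2) = (cnj p - \<mu> * cnj q) * (p - cnj \<mu> * q) - (1 - \<mu>) * (1 - cnj \<mu>)"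
      unfolding of_real_diff complex_norm_square by simp
    also have "\<dots> = p * cnj p + (\<mu> * cnj \<mu>) * (q * cnj q) - 1 - \<mu> * cnj \<mu> + (\<mu> * n + cnj (\<mu> * n))"
      by (simp add: n_def algebra_simps)
    also have "\<dots> = complex_of_real (2 * Re (n * \<mu>))"
      unfolding complex_add_cnj by (simp add: pp mult.commute)
    finally show ?thesis using of_real_eq_iff by blast
  qed
  have d: "1 - cnj p * z \<noteq> 0" "1 - cnj q * z \<noteq> 0" if "z \<in> ball 0 1" for z
    using that unimodular_denominator p q by auto
  have M1: "1 - M z = z * (cnj p - cnj q) / (1 - cnj q * z)"
    and M2: "cnj p - M z * cnj q = (cnj p - cnj q) / (1 - cnj q * z)" if "z \<in> ball 0 1" for z
    using d[OF that] by (simp_all add: M_def field_simps)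
  have cpq: "cnj p - cnj q \<noteq> 0" using pq by simp
  have pos: "Re (n * M z) > 0" if z: "z \<in> ball 0 1" for z
  proof -
    have "1 - M z = z * (cnj p - M z * cnj q)" using M1[OF z] M2[OF z] by simp
    then have "norm (1 - M z) = norm z * norm (cnj p - M z * cnj q)" by (metis norm_mult)
    also have "\<dots> < norm (cnj p - M z * cnj q)" using z M2[OF z] cpq d[OF z] by simp
    finally have "(norm (1 - M z))\<^sup>2 < (norm (cnj p - M z * cnj q))\<^sup>2" by (simp add: power_strict_mono)
    then show ?thesis using key[of "M z"] by simp
  qed
  have npos: "n * M z \<notin> \<real>\<^sub>\<le>\<^sub>0" "n * M z \<noteq> 0" if "z \<in> ball 0 1" for z
    using pos[OF that] by (auto simp: complex_nonpos_Reals_iff)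
  have expphi: "exp (\<phi> z) = n * M z" if "z \<in> ball 0 1" for z
    using npos[OF that] by (simp add: \<phi>_def)
  have "(\<phi> has_field_derivative (cnj q - cnj p) / ((1 - cnj p * z) * (1 - cnj q * z))) (at z)"
    if z: "z \<in> ball 0 1" for z
  proof -
    have "((\<lambda>z. n * M z) has_field_derivative n * ((- cnj p * (1 - cnj q * z) - (1 - cnj p * z) * (- cnj q)) / ((1 - cnj q * z) * (1 - cnj q * z)))) (at z)"
      unfolding M_def using d[OF z] by (auto intro!: derivative_eq_intros simp: algebra_simps)
    then have "(\<phi> has_field_derivative inverse (n * M z) * (n * ((- cnj p * (1 - cnj q * z) - (1 - cnj p * z) * (- cnj q)) / ((1 - cnj q * z) * (1 - cnj q * z))))) (at z)"
      unfolding \<phi>_def by (rule DERIV_chain2[where f = Ln and g = "\<lambda>z. n * M z" and x = z, OF has_field_derivative_Ln[OF npos(1)[OF z]]])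
    moreover have "inverse (n * M z) * (n * ((- cnj p * (1 - cnj q * z) - (1 - cnj p * z) * (- cnj q)) / ((1 - cnj q * z) * (1 - cnj q * z))))
        = (cnj q - cnj p) / ((1 - cnj p * z) * (1 - cnj q * z))"
    proof -
      have "- cnj p * (1 - cnj q * z) - (1 - cnj p * z) * (- cnj q) = cnj q - cnj p"
        by (simp add: algebra_simps)
      then show ?thesis using d[OF z] n0 unfolding M_def by simp
    qed
    ultimately show ?thesis by simp
  qed
  moreover have "\<bar>Im (\<phi> z)\<bar> < pi / 2" if "z \<in> ball 0 1" for z
    unfolding \<phi>_def using pos[OF that] Re_Ln_pos_lt[OF npos(2)[OF that]] by simp
  moreover have "Xi (\<phi> z) = z" if z: "z \<in> ball 0 1" for z
  proof -
    have "exp (\<phi> z) / n = M z" using expphi[OF z] n0 by simp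
    then have "Xi (\<phi> z) = (1 - M z) / (cnj p - M z * cnj q)" by (simp only: Xi_def)
    then show ?thesis unfolding M1[OF z] M2[OF z] using d[OF z] cpq by simp
  qed
  moreover have Xi: "Xi \<zeta> \<in> ball 0 1 \<and> \<phi> (Xi \<zeta>) = \<zeta>" 
    and Xid: "cnj p - exp \<zeta> / n * cnj q \<noteq> 0" if \<zeta>: "\<bar>Im \<zeta>\<bar> < pi / 2" for \<zeta>
  proof -
    define \<mu> where "\<mu> = exp \<zeta> / n"
    have mu0: "\<mu> \<noteq> 0" using n0 by (simp add: \<mu>_def)
    have nmu: "n * \<mu> = exp \<zeta>" using n0 by (simp add: \<mu>_def)
    have "Re (exp \<zeta>) > 0" using \<zeta> by (simp add: Re_exp cos_gt_zero_pi)
    then have "(norm (cnj p - \<mu> * cnj q))\<^sup>2 > (norm (1 - \<mu>))\<^sup>2" using key[of \<mu>] nmu by simp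
    then have lt: "norm (1 - \<mu>) < norm (cnj p - \<mu> * cnj q)" by (simp add: power2_less_imp_less)
    then have D0: "cnj p - \<mu> * cnj q \<noteq> 0" by force
    then show "cnj p - exp \<zeta> / n * cnj q \<noteq> 0" by (simp add: \<mu>_def)
    have Xi_mu: "Xi \<zeta> = (1 - \<mu>) / (cnj p - \<mu> * cnj q)" by (simp add: Xi_def \<mu>_def)
    have inb: "Xi \<zeta> \<in> ball 0 1" using lt D0 by (simp add: Xi_mu norm_divide)
    have "1 - cnj q * Xi \<zeta> = (cnj p - cnj q) / (cnj p - \<mu> * cnj q)"
      using D0 by (simp add: Xi_mu field_simps)
    moreover have "1 - cnj p * Xi \<zeta> = \<mu> * (cnj p - cnj q) / (cnj p - \<mu> * cnj q)"
      using D0 by (simp add: Xi_mu field_simps)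
    ultimately have "M (Xi \<zeta>) = \<mu>" unfolding M_def using D0 cpq by simp
    then have "\<phi> (Xi \<zeta>) = Ln (exp \<zeta>)" by (simp add: \<phi>_def nmu)
    also have "\<dots> = \<zeta>" using \<zeta> pi_gt_zero by (intro Ln_exp) linarith+
    finally show "Xi \<zeta> \<in> ball 0 1 \<and> \<phi> (Xi \<zeta>) = \<zeta>" using inb by simp
  qed
  moreover have "continuous_on {\<zeta>. \<bar>Im \<zeta>\<bar> < pi / 2} Xi"
    unfolding Xi_def using Xid n0 by (intro continuous_intros) auto
  ultimately show ?thesis using that[of \<phi> Xi] expphi by (auto simp: n_def M_def)
qed

text \<open>Composing \<open>s\<close> with the Moebius map that carries 0 to \<open>a = t 0\<close>
  gives a self-map of the disk that fixes 0 and has a right inverse of the same kind. Applied to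
  both, the Schwarz lemma forces a rotation.\<close>

lemma ball_automorphism_form:
  assumes s: "s holomorphic_on ball 0 1" "s ` ball 0 1 \<subseteq> ball 0 1"
    and t: "t holomorphic_on ball 0 1" "t ` ball 0 1 \<subseteq> ball 0 1"
    and st: "\<And>z. z \<in> ball 0 1 \<Longrightarrow> s (t z) = z" and ts: "\<And>z. z \<in> ball 0 1 \<Longrightarrow> t (s z) = z"
  obtains a c where "norm a < 1" "norm c = 1" "\<And>z. z \<in> ball 0 1 \<Longrightarrow> s z = c * (z - a) / (1 - cnj a * z)"
proof -
  define a where "a = t 0"
  have "t 0 \<in> ball 0 1" using t(2) by (simp add: image_subset_iff)
  then have a: "norm a < 1" by (simp add: a_def)
  define m where "m = Moebius_function 0 (-a)"
  define m' where "m' = Moebius_function 0 a"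
  have mh: "m holomorphic_on ball 0 1" "m' holomorphic_on ball 0 1"
    unfolding m_def m'_def using a by (auto intro: Moebius_function_holomorphic)
  have mb: "m z \<in> ball 0 1" "m' z \<in> ball 0 1" if "z \<in> ball 0 1" for z
    using that a Moebius_function_norm_lt_1[of "-a" z 0] Moebius_function_norm_lt_1[of a z 0]
    by (auto simp: m_def m'_def)
  have mm: "m (m' z) = z" "m' (m z) = z" if "z \<in> ball 0 1" for z
    using that a Moebius_function_compose[of "-a" a z] Moebius_function_compose[of a "-a" z]
    by (auto simp: m_def m'_def)
  have m0: "m 0 = a" "m' a = 0" by (simp_all add: m_def m'_def Moebius_function_of_zero Moebius_function_eq_zero)
  define f where "f = s \<circ> m"
  define g where "g = m' \<circ> t"
  have fh: "f holomorphic_on ball 0 1" unfolding f_def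
    using mb by (intro holomorphic_on_compose_gen[OF mh(1) s(1)]) auto
  have gh: "g holomorphic_on ball 0 1" unfolding g_def
    by (rule holomorphic_on_compose_gen[OF t(1) mh(2) t(2)])
  have f0: "f 0 = 0" using st[of 0] by (simp add: f_def m0 a_def)
  have g0: "g 0 = 0" by (simp add: g_def m0 flip: a_def)
  have fb: "norm (f z) < 1" if "norm z < 1" for z
    using mb(1)[of z] s(2) that by (force simp: f_def)
  have gb: "norm (g z) < 1" if "norm z < 1" for z
    using mb(2)[of "t z"] t(2) that by (force simp: g_def)
  have fg: "f (g z) = z" if "norm z < 1" for z
    using that t(2) mm(1)[of "t z"] st[of z] by (force simp: f_def g_def)
  have 1: "norm (f z) \<le> norm z" if "norm z < 1" for z
    by (rule Schwarz_Lemma(1)[OF fh f0 fb that])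
  have 2: "norm (g z) \<le> norm z" if "norm z < 1" for z
    by (rule Schwarz_Lemma(1)[OF gh g0 gb that])
  \<comment> \<open>Any nonzero point serves: the two Schwarz estimates pinch \<open>norm z1\<close>
    to \<open>1 / 2\<close>, which is the case of equality.\<close>
  define z1 :: complex where "z1 = g (1/2)"
  have z1: "norm z1 < 1" unfolding z1_def by (rule gb) simp
  have fz1: "f z1 = 1/2" unfolding z1_def by (rule fg) simp
  have "norm z1 \<le> 1/2" using 2[of "1/2"] by (simp add: z1_def norm_divide)
  moreover have "1/2 \<le> norm z1" using 1[OF z1] fz1 by (simp add: norm_divide)
  ultimately have "norm z1 = 1 / 2" by simp
  then have "norm (f z1) = norm z1" "z1 \<noteq> 0" unfolding fz1 by (auto simp: norm_divide)
  then obtain c where c: "\<And>z. norm z < 1 \<Longrightarrow> f z = c * z" "norm c = 1"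
    using Schwarz_Lemma(3)[OF fh f0 fb z1] z1 by blast
  have "s z = c * (z - a) / (1 - cnj a * z)" if z: "z \<in> ball 0 1" for z
  proof -
    have "s z = f (m' z)" using mm(1)[OF z] by (simp add: f_def)
    also have "\<dots> = c * m' z" using c(1) mb(2)[OF z] by simp
    finally show ?thesis by (simp add: m'_def Moebius_function_simple)
  qed
  then show ?thesis using that a c(2) by blast
qed

text \<open>The fixed points of a Moebius automorphism solve a quadratic equation whose roots have a
  product of modulus one.\<close>

lemma ball_automorphism_fixed_points:
  fixes a c :: complex
  assumes a: "norm a < 1" and c: "norm c = 1"
    and s: "\<And>z. z \<in> ball 0 1 \<Longrightarrow> s z = c * (z - a) / (1 - cnj a * z)"
    and nofix: "\<And>z. z \<in> ball 0 1 \<Longrightarrow> s z \<noteq> z"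
  obtains p q where "norm p = 1" "norm q = 1" "c + p * cnj a \<noteq> 0" "c + q * cnj a \<noteq> 0"
    "\<And>z. z \<in> ball 0 1 \<Longrightarrow> p - s z = (c + p * cnj a) * (p - z) / (1 - cnj a * z)"
    "\<And>z. z \<in> ball 0 1 \<Longrightarrow> q - s z = (c + q * cnj a) * (q - z) / (1 - cnj a * z)"
    "cnj a * (p + q) = 1 - c"
proof -
  have a0: "a \<noteq> 0"
  proof
    assume "a = 0"
    then have "s 0 = 0" using s[of 0] by simp
    then show False using nofix[of 0] by simp
  qed
  have den: "1 - cnj a * z \<noteq> 0" if "z \<in> ball 0 1" for z
  proof -
    have "norm (cnj a * z) < 1" using that a norm_mult_less[of "cnj a" 1 z 1] by simp
    then show ?thesis by force
  qed
  define D where "D = csqrt ((c - 1)\<^sup>2 + 4 * cnj a * c * a)"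
  define p where "p = (1 - c + D) / (2 * cnj a)"
  define q where "q = (1 - c - D) / (2 * cnj a)"
  have sum: "cnj a * (p + q) = 1 - c" using a0 by (simp add: p_def q_def field_simps)
  have D2: "D\<^sup>2 = (c - 1)\<^sup>2 + 4 * cnj a * c * a" by (simp add: D_def)
  have "4 * (cnj a)\<^sup>2 * (p * q) = (1 - c)\<^sup>2 - D\<^sup>2" using a0 by (simp add: p_def q_def field_simps power2_eq_square)
  also have "\<dots> = 4 * (cnj a)\<^sup>2 * (- c * a / cnj a)" using a0 unfolding D2 by (simp add: field_simps power2_eq_square)
  finally have "(4 * (cnj a)\<^sup>2) * (p * q) = (4 * (cnj a)\<^sup>2) * (- c * a / cnj a)" .
  moreover have "4 * (cnj a)\<^sup>2 \<noteq> 0" using a0 by simp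
  ultimately have prod: "p * q = - c * a / cnj a" by (rule mult_left_cancel[THEN iffD1, rotated])
  have rootp: "cnj a * p\<^sup>2 + (c - 1) * p - c * a = 0"
  proof -
    have "cnj a * p\<^sup>2 + (c - 1) * p - c * a = p * (cnj a * (p + q) - (1 - c)) - cnj a * (p * q) - c * a"
      by (simp add: algebra_simps power2_eq_square)
    then show ?thesis using sum prod a0 by simp
  qed
  have rootq: "cnj a * q\<^sup>2 + (c - 1) * q - c * a = 0"
  proof -
    have "cnj a * q\<^sup>2 + (c - 1) * q - c * a = q * (cnj a * (p + q) - (1 - c)) - cnj a * (p * q) - c * a"
      by (simp add: algebra_simps power2_eq_square)
    then show ?thesis using sum prod a0 by simp
  qed
  \<comment> \<open>A root inside the disk would be a fixed point of \<open>s\<close>.\<close>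
  have notin: "1 \<le> norm x" if root: "cnj a * x\<^sup>2 + (c - 1) * x - c * a = 0" for x
  proof (rule ccontr)
    assume "\<not> 1 \<le> norm x"
    then have x: "x \<in> ball 0 1" by simp
    have "c * (x - a) = x * (1 - cnj a * x)" using root by (simp add: algebra_simps power2_eq_square)
    then have "s x = x" using s[OF x] den[OF x] by simp
    then show False using nofix[OF x] by simp
  qed
  have "norm (p * q) = 1" unfolding prod using c a0 by (simp add: norm_mult norm_divide)
  then have "norm p * norm q = 1" by (simp add: norm_mult)
  moreover note np = notin[OF rootp] and nq = notin[OF rootq]
  ultimately have n1: "norm p = 1" "norm q = 1"
    by (smt (verit) mult_le_cancel_left2 mult_le_cancel_right2)+
  have fact: "x - s z = (c + x * cnj a) * (x - z) / (1 - cnj a * z)"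
    if root: "cnj a * x\<^sup>2 + (c - 1) * x - c * a = 0" and z: "z \<in> ball 0 1" for x z
  proof -
    have "x * (1 - cnj a * z) - c * (z - a) = (c + x * cnj a) * (x - z) - (cnj a * x\<^sup>2 + (c - 1) * x - c * a)"
      by (simp add: algebra_simps power2_eq_square)
    then have "x * (1 - cnj a * z) - c * (z - a) = (c + x * cnj a) * (x - z)" by (simp only: root) simp
    moreover have "x - s z = (x * (1 - cnj a * z) - c * (z - a)) / (1 - cnj a * z)"
      unfolding s[OF z] using den[OF z] by (simp add: diff_divide_distrib)
    ultimately show ?thesis by simp
  qed
  have nz: "c + x * cnj a \<noteq> 0" if "norm x = 1" for x
  proof
    assume "c + x * cnj a = 0"
    then have "norm c = norm (x * cnj a)" by (metis add_eq_0_iff norm_minus_cancel)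
    then show False using c that a by (simp add: norm_mult)
  qed
  show ?thesis
    by (rule that[OF n1 nz[OF n1(1)] nz[OF n1(2)] fact[OF rootp] fact[OF rootq] sum])
qed

lemma tendsto_of_between_inverse_Suc:
  fixes c :: real
  assumes "\<And>n. c \<le> x n" "\<And>n. x n < c + 1 / of_nat (Suc n)"
  shows "x \<longlonglongrightarrow> c"
proof -
  have lim: "(\<lambda>n. c + inverse (real (Suc n))) \<longlonglongrightarrow> c" by (rule LIMSEQ_inverse_real_of_nat_add)
  show ?thesis
  proof (rule tendsto_sandwich[OF _ _ tendsto_const lim])
    show "eventually (\<lambda>n. c \<le> x n) sequentially" using assms(1) by simp
    show "eventually (\<lambda>n. x n \<le> c + inverse (real (Suc n))) sequentially"
      using assms(2) by (simp add: inverse_eq_divide less_imp_le)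
  qed
qed

section \<open>Conformal maps of periodic domains\<close>

text \<open>The region \<open>V\<close> between two periodic graphs over the imaginary axis stands
  in for an image domain with unknown boundary. Continuity of the graphs controls limits at the
  boundary, and the translation by \<open>\<i> * T\<close> is an automorphism whose fixed points on
  the circle will be \<open>p\<close> and \<open>q\<close>.\<close>

locale periodic_domain =
  fixes l r :: "real \<Rightarrow> real" and T :: real
  assumes contl: "continuous_on UNIV l" and contr: "continuous_on UNIV r"
    and lr: "l y < r y" and T: "T > 0"
    and perl: "l (y + T) = l y" and perr: "r (y + T) = r y"
begin

definition V :: "complex set" where
  "V = {w. l (Im w) < Re w \<and> Re w < r (Im w)}"

lemma periodic_int:
  fixes g :: "real \<Rightarrow> real"
  assumes "\<And>y. g (y + T) = g y"
  shows "g (y + of_int m * T) = g y"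
proof -
  have nat: "g (y + of_nat n * T) = g y" for n y
  proof (induction n)
    case (Suc n)
    have "g (y + of_nat (Suc n) * T) = g ((y + of_nat n * T) + T)" by (simp add: algebra_simps)
    then show ?case using Suc assms by simp
  qed simp
  show ?thesis
  proof (cases m)
    case (nonneg n) then show ?thesis using nat by simp
  next
    case (neg n)
    have "g (y + of_int m * T) = g ((y + of_int m * T) + of_nat (Suc n) * T)" using nat by metis
    also have "(y + of_int m * T) + of_nat (Suc n) * T = y" by (simp add: neg algebra_simps)
    finally show ?thesis .
  qed
qed

lemmas l_int = periodic_int[of l, OF perl] and r_int = periodic_int[of r, OF perr]

lemma V_shift: "w + \<i> * of_real (of_int m * T) \<in> V \<longleftrightarrow> w \<in> V"
  using l_int[of "Im w" m] r_int[of "Im w" m] by (simp add: V_def)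

lemma period_representative:
  obtains m :: int where "y + of_int m * T \<in> {0..T}"
proof
  define m where "m = - \<lfloor>y / T\<rfloor>"
  have "of_int \<lfloor>y / T\<rfloor> * T \<le> y"
    by (subst pos_le_divide_eq[OF T, symmetric]) linarith
  moreover have "y \<le> (of_int \<lfloor>y / T\<rfloor> + 1) * T"
    by (subst pos_divide_le_eq[OF T, symmetric]) linarith
  ultimately show "y + of_int m * T \<in> {0..T}" by (simp add: m_def algebra_simps)
qed

lemma periodic_bounded:
  fixes g :: "real \<Rightarrow> real"
  assumes per: "\<And>y. g (y + T) = g y" and cont: "continuous_on UNIV g"
  shows "\<exists>B. \<forall>y. \<bar>g y\<bar> \<le> B"
proof -
  have "compact (g ` {0..T})" by (intro compact_continuous_image continuous_on_subset[OF cont]) auto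
  then obtain B where B: "\<And>y. y \<in> {0..T} \<Longrightarrow> \<bar>g y\<bar> \<le> B"
    using compact_imp_bounded bounded_iff by (metis imageI real_norm_def)
  have "\<bar>g y\<bar> \<le> B" for y
  proof -
    obtain m where "y + of_int m * T \<in> {0..T}" by (rule period_representative)
    then show ?thesis using B periodic_int[of g, OF per] by metis
  qed
  then show ?thesis by blast
qed

lemma Re_bounded: obtains B where "\<And>w. w \<in> V \<Longrightarrow> \<bar>Re w\<bar> \<le> B"
proof -
  obtain B1 B2 where B: "\<And>y. \<bar>l y\<bar> \<le> B1" "\<And>y. \<bar>r y\<bar> \<le> B2"
    using periodic_bounded[OF perl contl] periodic_bounded[OF perr contr] by blast
  have "\<bar>Re w\<bar> \<le> max B1 B2" if "w \<in> V" for w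
    using B(1)[of "Im w"] B(2)[of "Im w"] that by (auto simp: V_def)
  then show ?thesis using that by blast
qed

lemma cont_lr [continuous_intros]:
  "continuous_on S g \<Longrightarrow> continuous_on S (\<lambda>x. l (g x))"
  "continuous_on S g \<Longrightarrow> continuous_on S (\<lambda>x. r (g x))"
  using continuous_on_compose2[OF contl] continuous_on_compose2[OF contr] by blast+

lemma open_V: "open V"
  unfolding V_def by (intro open_Collect_conj open_Collect_less continuous_intros)

text \<open>Rescaling every horizontal slice to the unit interval maps \<open>V\<close>
  homeomorphically onto a vertical strip.\<close>

lemma simply_connected_V: "simply_connected V"
proof -
  define S where "S = {w. 0 < Re w \<and> Re w < 1}"
  have pos: "0 < r y - l y" for y using lr[of y] by simp
  have "convex S"
    unfolding S_def using convex_Int[OF convex_halfspace_Re_gt convex_halfspace_Re_lt, of 0 1]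
    by (simp add: Collect_conj_eq)
  moreover have "homeomorphism S V (\<lambda>w. Complex (l (Im w) + Re w * (r (Im w) - l (Im w))) (Im w))
      (\<lambda>w. Complex ((Re w - l (Im w)) / (r (Im w) - l (Im w))) (Im w))"
  proof (rule homeomorphismI)
    have "r (Im x) - l (Im x) \<noteq> 0" for x using pos[of "Im x"] by simp
    then show "continuous_on V (\<lambda>w. Complex ((Re w - l (Im w)) / (r (Im w) - l (Im w))) (Im w))"
      by (intro continuous_on_Complex continuous_intros) auto
    show "continuous_on S (\<lambda>w. Complex (l (Im w) + Re w * (r (Im w) - l (Im w))) (Im w))"
      by (intro continuous_on_Complex continuous_intros)
    show "(\<lambda>w. Complex (l (Im w) + Re w * (r (Im w) - l (Im w))) (Im w)) ` S \<subseteq> V"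
    proof clarsimp
      fix w assume w: "w \<in> S"
      have "Re w * (r (Im w) - l (Im w)) < 1 * (r (Im w) - l (Im w))"
        using w pos[of "Im w"] by (intro mult_strict_right_mono) (auto simp: S_def)
      moreover have "0 < Re w * (r (Im w) - l (Im w))"
        using w pos[of "Im w"] by (simp add: S_def)
      ultimately show "Complex (l (Im w) + Re w * (r (Im w) - l (Im w))) (Im w) \<in> V"
        by (simp add: V_def)
    qed
    show "(\<lambda>w. Complex ((Re w - l (Im w)) / (r (Im w) - l (Im w))) (Im w)) ` V \<subseteq> S"
      using pos by (auto simp: S_def V_def)
    show "\<And>x. x \<in> S \<Longrightarrow> Complex ((Re (Complex (l (Im x) + Re x * (r (Im x) - l (Im x))) (Im x)) - l (Im (Complex (l (Im x) + Re x * (r (Im x) - l (Im x))) (Im x)))) / (r (Im (Complex (l (Im x) + Re x * (r (Im x) - l (Im x))) (Im x))) - l (Im (Complex (l (Im x) + Re x * (r (Im x) - l (Im x))) (Im x))))) (Im (Complex (l (Im x) + Re x * (r (Im x) - l (Im x))) (Im x))) = x"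
      using pos by (simp add: complex_eq_iff less_imp_neq[symmetric])
    show "\<And>y. y \<in> V \<Longrightarrow> Complex (l (Im (Complex ((Re y - l (Im y)) / (r (Im y) - l (Im y))) (Im y))) + Re (Complex ((Re y - l (Im y)) / (r (Im y) - l (Im y))) (Im y)) * (r (Im (Complex ((Re y - l (Im y)) / (r (Im y) - l (Im y))) (Im y))) - l (Im (Complex ((Re y - l (Im y)) / (r (Im y) - l (Im y))) (Im y))))) (Im (Complex ((Re y - l (Im y)) / (r (Im y) - l (Im y))) (Im y))) = y"
      using pos by (simp add: complex_eq_iff less_imp_neq[symmetric])
  qed
  ultimately show ?thesis
    using homeomorphic_simply_connected[of S V] convex_imp_simply_connected homeomorphic_def by blast
qed

lemma Riemann_map:
  assumes "w0 \<in> V"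
  obtains j f where "j holomorphic_on ball 0 1" "f holomorphic_on V"
    "\<And>z. z \<in> ball 0 1 \<Longrightarrow> j z \<in> V \<and> f (j z) = z"
    "\<And>w. w \<in> V \<Longrightarrow> f w \<in> ball 0 1 \<and> j (f w) = w"
    "j 0 = w0"
proof -
  have "Complex (l 0) 0 \<notin> V" by (simp add: V_def)
  then have "V \<noteq> {}" "V \<noteq> UNIV" using assms by auto
  then obtain f0 j0 where f0: "f0 holomorphic_on V" "j0 holomorphic_on ball 0 1"
    "\<And>z. z \<in> V \<Longrightarrow> f0 z \<in> ball 0 1 \<and> j0 (f0 z) = z" "\<And>z. z \<in> ball 0 1 \<Longrightarrow> j0 z \<in> V \<and> f0 (j0 z) = z"
    using Riemann_mapping_theorem[of V] open_V simply_connected_V by blast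
  have "f0 w0 \<in> ball 0 1" using f0(3) assms by blast
  then obtain m m' where m: "m (f0 w0) = 0" "m holomorphic_on ball 0 1" "m ` ball 0 1 \<subseteq> ball 0 1"
    "m' holomorphic_on ball 0 1" "m' ` ball 0 1 \<subseteq> ball 0 1"
    "\<And>z. z \<in> ball 0 1 \<Longrightarrow> m (m' z) = z" "\<And>z. z \<in> ball 0 1 \<Longrightarrow> m' (m z) = z"
    using ball_biholomorphism_exists by blast
  have fV: "f0 ` V \<subseteq> ball 0 1" using f0(3) by blast
  show ?thesis
  proof (rule that)
    show "(j0 \<circ> m') holomorphic_on ball 0 1" by (rule holomorphic_on_compose_gen[OF m(4) f0(2) m(5)])
    show "(m \<circ> f0) holomorphic_on V" by (rule holomorphic_on_compose_gen[OF f0(1) m(2) fV])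
    show "(j0 \<circ> m') z \<in> V \<and> (m \<circ> f0) ((j0 \<circ> m') z) = z" if "z \<in> ball 0 1" for z
    proof -
      have "m' z \<in> ball 0 1" using that m(5) by (simp add: image_subset_iff)
      then show ?thesis using that m(6) f0(4)[of "m' z"] by simp
    qed
    show "(m \<circ> f0) w \<in> ball 0 1 \<and> (j0 \<circ> m') ((m \<circ> f0) w) = w" if "w \<in> V" for w
    proof -
      have "f0 w \<in> ball 0 1" using f0(3)[OF that] by blast
      moreover from this have "m (f0 w) \<in> ball 0 1" using m(3) by (simp add: image_subset_iff)
      ultimately show ?thesis using m(7) f0(3)[OF that] by simp
    qed
    show "(j0 \<circ> m') 0 = w0" using m(1,7) f0(3)[OF assms] by (metis o_apply)
  qed
qed

end

text \<open>A conformal map \<open>\<psi>\<close> onto a strip in which the vertical period of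
  \<open>V\<close> becomes the horizontal translation by \<open>\<tau>\<close>. Modulo these
  translations every smaller closed strip is compact, and compactness replaces regularity at the
  boundary.\<close>

locale periodic_strip_map = periodic_domain +
  fixes \<psi> \<xi> :: "complex \<Rightarrow> complex" and \<tau> :: real
  assumes hol: "\<psi> holomorphic_on V"
    and strip: "w \<in> V \<Longrightarrow> \<bar>Im (\<psi> w)\<bar> < pi / 2"
    and \<xi>\<psi>: "w \<in> V \<Longrightarrow> \<xi> (\<psi> w) = w"
    and \<psi>\<xi>: "\<bar>Im \<zeta>\<bar> < pi / 2 \<Longrightarrow> \<xi> \<zeta> \<in> V \<and> \<psi> (\<xi> \<zeta>) = \<zeta>"
    and cont\<xi>: "continuous_on {\<zeta>. \<bar>Im \<zeta>\<bar> < pi / 2} \<xi>"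
    and shift: "w \<in> V \<Longrightarrow> \<psi> (w + \<i> * T) = \<psi> w + of_real \<tau>"
    and \<tau>: "\<tau> \<noteq> 0"
begin

section \<open>Conformal maps of the periodic domain onto a strip\<close>

lemma shift_int:
  assumes "w \<in> V"
  shows "\<psi> (w + \<i> * of_real (of_int m * T)) = \<psi> w + of_int m * of_real \<tau>"
proof -
  have nat: "\<psi> (w + \<i> * of_real (of_nat n * T)) = \<psi> w + of_nat n * of_real \<tau>" if "w \<in> V" for n w
  proof (induction n)
    case (Suc n)
    have "w + \<i> * of_real (of_nat n * T) \<in> V" using V_shift[of w "int n"] that by simp
    from shift[OF this] Suc show ?case by (simp add: algebra_simps)
  qed simp
  show ?thesis
  proof (cases m)
    case (nonneg n) then show ?thesis using nat[OF assms] by simp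
  next
    case (neg n)
    define w' where "w' = w + \<i> * of_real (of_int m * T)"
    have "w' \<in> V" using V_shift assms by (simp add: w'_def)
    from nat[OF this, of "Suc n"] have "\<psi> (w' + \<i> * of_real (of_nat (Suc n) * T)) = \<psi> w' + of_nat (Suc n) * of_real \<tau>" .
    moreover have "w' + \<i> * of_real (of_nat (Suc n) * T) = w"
      by (simp add: w'_def neg algebra_simps)
    ultimately show ?thesis by (simp add: w'_def neg algebra_simps)
  qed
qed

lemma Im_shift_int: "w \<in> V \<Longrightarrow> Im (\<psi> (w + \<i> * of_real (of_int m * T))) = Im (\<psi> w)"
  using shift_int[of w m] by simp

lemma cont_\<psi>: "continuous_on V \<psi>"
  using hol by (rule holomorphic_on_imp_continuous_on)

text \<open>If the values kept away from the edges of the strip along a subsequence, their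
  translates by multiples of \<open>\<tau>\<close> would accumulate inside the strip. The matching
  translates of \<open>X n\<close> then accumulate at a point of \<open>V\<close>, close to a
  translate of \<open>w\<close>, although \<open>V\<close> is invariant and \<open>w\<close> is
  outside.\<close>

lemma tendsto_boundary:
  assumes X: "\<And>n. X n \<in> V" "X \<longlonglongrightarrow> w" and w: "w \<notin> V"
  shows "(\<lambda>n. \<bar>Im (\<psi> (X n))\<bar>) \<longlonglongrightarrow> pi / 2"
proof (rule ccontr)
  assume "\<not> ?thesis"
  then obtain e where e: "e > 0" "\<not> eventually (\<lambda>n. dist \<bar>Im (\<psi> (X n))\<bar> (pi/2) < e) sequentially"
    unfolding tendsto_iff by blast
  then obtain \<rho> :: "nat \<Rightarrow> nat" where \<rho>: "strict_mono \<rho>" "\<And>n. \<not> dist \<bar>Im (\<psi> (X (\<rho> n)))\<bar> (pi/2) < e"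
    using not_eventually_sequentiallyD[OF e(2)] by blast
  have le: "\<bar>Im (\<psi> (X (\<rho> n)))\<bar> \<le> pi / 2 - e" for n
    using \<rho>(2)[of n] strip[OF X(1)[of "\<rho> n"]] by (simp add: dist_real_def)
  \<comment> \<open>This multiple of \<open>\<tau>\<close> brings the real part of the value into a
    bounded interval.\<close>
  define m where "m = (\<lambda>n. - \<lfloor>Re (\<psi> (X (\<rho> n))) / \<tau>\<rfloor>)"
  define \<zeta> where "\<zeta> = (\<lambda>n. \<psi> (X (\<rho> n)) + of_int (m n) * of_real \<tau>)"
  define K where "K = cbox (Complex (-\<bar>\<tau>\<bar>) (- (pi / 2 - e))) (Complex \<bar>\<tau>\<bar> (pi / 2 - e))"
  have "\<zeta> n \<in> K" for n
  proof -
    define x where "x = Re (\<psi> (X (\<rho> n)))"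
    have "\<bar>x / \<tau> - of_int \<lfloor>x / \<tau>\<rfloor>\<bar> \<le> 1" by linarith
    then have "\<bar>x / \<tau> - of_int \<lfloor>x / \<tau>\<rfloor>\<bar> * \<bar>\<tau>\<bar> \<le> 1 * \<bar>\<tau>\<bar>" by (intro mult_right_mono) auto
    moreover have "(x / \<tau> - of_int \<lfloor>x / \<tau>\<rfloor>) * \<tau> = x - of_int \<lfloor>x / \<tau>\<rfloor> * \<tau>"
      using \<tau> by (simp add: left_diff_distrib)
    ultimately have "\<bar>x - of_int \<lfloor>x / \<tau>\<rfloor> * \<tau>\<bar> \<le> \<bar>\<tau>\<bar>" by (metis abs_mult mult_1)
    then have "\<bar>Re (\<zeta> n)\<bar> \<le> \<bar>\<tau>\<bar>" by (simp add: \<zeta>_def m_def x_def)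
    moreover have "\<bar>Im (\<zeta> n)\<bar> \<le> pi / 2 - e" using le[of n] by (simp add: \<zeta>_def)
    ultimately show ?thesis by (simp add: K_def in_cbox_complex_iff abs_le_iff)
  qed
  moreover have "compact K" by (simp add: K_def)
  ultimately obtain \<zeta>0 r' where z0: "\<zeta>0 \<in> K" "strict_mono r'" "(\<zeta> \<circ> r') \<longlonglongrightarrow> \<zeta>0"
    unfolding compact_def by metis
  have im0: "\<bar>Im \<zeta>0\<bar> < pi / 2" using z0(1) e(1) by (auto simp: K_def in_cbox_complex_iff)
  have "open {\<zeta>. \<bar>Im \<zeta>\<bar> < pi / 2}" by (intro open_Collect_less continuous_intros)
  then have "isCont \<xi> \<zeta>0" using cont\<xi> im0 continuous_on_eq_continuous_at by blast
  then have lim1: "(\<lambda>n. \<xi> (\<zeta> (r' n))) \<longlonglongrightarrow> \<xi> \<zeta>0"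
    using isCont_tendsto_compose z0(3) unfolding o_def by blast
  have \<xi>\<zeta>: "\<xi> (\<zeta> n) = X (\<rho> n) + \<i> * of_real (of_int (m n) * T)" for n
    using \<xi>\<psi>[of "X (\<rho> n) + \<i> * of_real (of_int (m n) * T)"] V_shift X(1) shift_int[OF X(1)]
    by (simp add: \<zeta>_def)
  obtain d where d: "d > 0" "ball (\<xi> \<zeta>0) d \<subseteq> V"
    using \<psi>\<xi>[OF im0] open_V openE by blast
  have "eventually (\<lambda>n. dist (\<xi> (\<zeta> (r' n))) (\<xi> \<zeta>0) < d / 2) sequentially"
    by (rule tendstoD[OF lim1 half_gt_zero[OF d(1)]])
  moreover have "(\<lambda>n. X (\<rho> (r' n))) \<longlonglongrightarrow> w"
    using LIMSEQ_subseq_LIMSEQ[OF LIMSEQ_subseq_LIMSEQ[OF X(2) \<rho>(1)] z0(2)] by (simp add: o_def)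
  then have "eventually (\<lambda>n. dist (X (\<rho> (r' n))) w < d / 2) sequentially"
    by (rule tendstoD[OF _ half_gt_zero[OF d(1)]])
  ultimately have "eventually (\<lambda>n. dist (\<xi> (\<zeta> (r' n))) (\<xi> \<zeta>0) < d / 2 \<and> dist (X (\<rho> (r' n))) w < d / 2) sequentially"
    by (rule eventually_conj)
  then obtain n where n: "dist (\<xi> (\<zeta> (r' n))) (\<xi> \<zeta>0) < d / 2" "dist (X (\<rho> (r' n))) w < d / 2"
    by (auto simp: eventually_sequentially)
  \<comment> \<open>\<open>v\<close> depends on the chosen index \<open>n\<close>, which is enough:
    only one translate of \<open>w\<close> has to enter \<open>V\<close>.\<close>
  define v where "v = \<i> * of_real (of_int (m (r' n)) * T)"
  have "dist (w + v) (\<xi> \<zeta>0) < d"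
  proof (rule dist_triangle_half_l)
    show "dist (w + v) (X (\<rho> (r' n)) + v) < d / 2" using n(2) by (simp add: dist_commute)
    show "dist (\<xi> \<zeta>0) (X (\<rho> (r' n)) + v) < d / 2" using n(1) unfolding \<xi>\<zeta> v_def by (simp add: dist_commute)
  qed
  then have "w + v \<in> V" using d(2) by (auto simp: dist_commute)
  then show False using w V_shift by (simp add: v_def)
qed

text \<open>By \<open>tendsto_boundary\<close> and periodicity \<open>\<bar>Im \<psi>\<bar>\<close>
  is uniformly large in a band along the graph \<open>b\<close>; the band is connected, so the sign
  is constant. Here \<open>b\<close> and \<open>b'\<close> are the two graphs in either order, which
  treats both boundary curves at once.\<close>

lemma boundary_sign:
  assumes cont: "continuous_on UNIV b" "continuous_on UNIV b'"
    and per: "\<And>y. b (y + T) = b y" "\<And>y. b' (y + T) = b' y"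
    and inV: "\<And>y t. \<lbrakk>0 < t; t < 1\<rbrakk> \<Longrightarrow> Complex (b y + t * (b' y - b y)) y \<in> V"
    and notV: "\<And>y. Complex (b y) y \<notin> V"
  obtains \<eta> s where "0 < \<eta>" "\<eta> < 1 / 2" "s = 1 \<or> s = (- 1 :: real)"
    "\<And>y t. \<lbrakk>0 < t; t < \<eta>\<rbrakk> \<Longrightarrow> pi / 4 < s * Im (\<psi> (Complex (b y + t * (b' y - b y)) y))"
proof -
  define W where "W = (\<lambda>(t, y). Complex (b y + t * (b' y - b y)) y)"
  note cb = continuous_on_compose2[OF cont(1) _ subset_UNIV] continuous_on_compose2[OF cont(2) _ subset_UNIV]
  have contW: "continuous_on UNIV W"
    unfolding W_def split_beta by (intro continuous_on_Complex continuous_intros cb)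
  have W_per: "W (t, y + of_int m * T) = W (t, y) + \<i> * of_real (of_int m * T)" for t y m
    using periodic_int[of b, OF per(1)] periodic_int[of b', OF per(2)] by (simp add: W_def complex_eq_iff)
  have WV: "W (t, y) \<in> V" if "0 < t" "t < 1" for t y using inV[OF that] by (simp add: W_def)
  have "\<exists>\<eta>>0. \<eta> < 1 / 2 \<and> (\<forall>y t. 0 < t \<and> t < \<eta> \<longrightarrow> pi / 4 < \<bar>Im (\<psi> (W (t, y)))\<bar>)"
  proof (rule ccontr)
    assume neg: "\<not> ?thesis"
    \<comment> \<open>With \<open>n + 3\<close> the width is below \<open>1 / 2\<close> and so an
      admissible candidate for \<open>\<eta>\<close>.\<close>
    have "\<exists>t y. 0 < t \<and> t < 1 / of_nat (n + 3) \<and> y \<in> {0..T} \<and> \<bar>Im (\<psi> (W (t, y)))\<bar> \<le> pi / 4" for n :: nat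
    proof -
      have "1 / real (n + 3) > 0" "1 / real (n + 3) < 1 / 2" by (simp_all add: field_simps)
      then obtain y t where ty: "0 < t" "t < 1 / real (n + 3)" "\<bar>Im (\<psi> (W (t, y)))\<bar> \<le> pi / 4"
        using neg by (meson not_le)
      obtain m where m: "y + of_int m * T \<in> {0..T}" by (rule period_representative)
      have "t < 1" using ty(2) \<open>1 / real (n + 3) < 1 / 2\<close> by linarith
      then have "Im (\<psi> (W (t, y + of_int m * T))) = Im (\<psi> (W (t, y)))"
        unfolding W_per using WV ty(1) by (intro Im_shift_int) auto
      then show ?thesis using ty m by (intro exI[of _ t] exI[of _ "y + of_int m * T"]) auto
    qed
    then obtain t y where ty: "\<And>n::nat. 0 < t n" "\<And>n. t n < 1 / of_nat (n + 3)" "\<And>n. y n \<in> {0..T}"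
      "\<And>n. \<bar>Im (\<psi> (W (t n, y n)))\<bar> \<le> pi / 4" by metis
    obtain y0 \<rho> where y0: "strict_mono (\<rho> :: nat \<Rightarrow> nat)" "(y \<circ> \<rho>) \<longlonglongrightarrow> y0"
      using compact_Icc[of 0 T] ty(3) unfolding compact_def by metis
    have "(\<lambda>n. 1 / real (n + 3)) \<longlonglongrightarrow> 0" using LIMSEQ_ignore_initial_segment[OF lim_1_over_n, of 3] by simp
    then have "t \<longlonglongrightarrow> 0"
      using ty(1,2) by (intro tendsto_sandwich[OF _ _ tendsto_const \<open>(\<lambda>n. 1 / real (n + 3)) \<longlonglongrightarrow> 0\<close>]) (auto intro!: always_eventually less_imp_le)
    then have "(t \<circ> \<rho>) \<longlonglongrightarrow> 0" using y0(1) LIMSEQ_subseq_LIMSEQ by blast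
    then have "(\<lambda>n. ((t \<circ> \<rho>) n, (y \<circ> \<rho>) n)) \<longlonglongrightarrow> (0, y0)" using y0(2) by (intro tendsto_Pair)
    then have lim: "(\<lambda>n. W ((t \<circ> \<rho>) n, (y \<circ> \<rho>) n)) \<longlonglongrightarrow> W (0, y0)"
      using contW by (intro isCont_tendsto_compose[of _ W]) (auto simp: continuous_on_eq_continuous_at)
    have "t n < 1" for n using ty(2)[of n] by (rule less_le_trans) (simp add: field_simps)
    then have "(\<lambda>n. \<bar>Im (\<psi> (W ((t \<circ> \<rho>) n, (y \<circ> \<rho>) n)))\<bar>) \<longlonglongrightarrow> pi / 2"
      using ty(1) WV notV lim by (intro tendsto_boundary[where w = "W (0, y0)"]) (auto simp: W_def)
    then have "pi / 2 \<le> pi / 4"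
      by (rule LIMSEQ_le_const2) (use ty(4) in auto)
    then show False by simp
  qed
  then obtain \<eta> where \<eta>: "0 < \<eta>" "\<eta> < 1 / 2"
    "\<And>y t. 0 < t \<Longrightarrow> t < \<eta> \<Longrightarrow> pi / 4 < \<bar>Im (\<psi> (W (t, y)))\<bar>" by blast
  define Q where "Q = {0<..<\<eta>} \<times> (UNIV :: real set)"
  define u where "u = (\<lambda>x. Im (\<psi> (W x)))"
  have "connected Q" unfolding Q_def by (intro connected_Times) auto
  moreover have "continuous_on Q u"
    unfolding u_def using WV \<eta>(2)
    by (intro continuous_intros continuous_on_compose2[OF cont_\<psi>] continuous_on_subset[OF contW]) (auto simp: Q_def)
  ultimately have conn: "connected (u ` Q)" by (rule connected_continuous_image[rotated])
  have abs: "pi / 4 < \<bar>u x\<bar>" if "x \<in> Q" for x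
    using \<eta>(3) that by (auto simp: Q_def u_def)
  have x0: "(\<eta> / 2, 0) \<in> Q" using \<eta>(1) by (simp add: Q_def)
  define s :: real where "s = (if u (\<eta> / 2, 0) > 0 then 1 else - 1)"
  have "pi / 4 < s * u x" if x: "x \<in> Q" for x
  proof (rule ccontr)
    assume "\<not> pi / 4 < s * u x"
    then have neg: "s * u x < 0" using abs[OF x] pi_gt_zero unfolding s_def by (auto split: if_splits)
    have "u (\<eta> / 2, 0) \<noteq> 0" using abs[OF x0] pi_gt_zero by auto
    then have pos: "s * u (\<eta> / 2, 0) > 0" unfolding s_def by auto
    have "0 \<in> u ` Q"
    proof (cases "s = 1")
      case True
      then show ?thesis using connectedD_interval[OF conn, of "u x" "u (\<eta> / 2, 0)" 0] neg pos x x0 by auto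
    next
      case False
      then have "s = -1" by (auto simp: s_def split: if_splits)
      then show ?thesis using connectedD_interval[OF conn, of "u (\<eta> / 2, 0)" "u x" 0] neg pos x x0 by auto
    qed
    then show False using abs by fastforce
  qed
  then have "pi / 4 < s * Im (\<psi> (Complex (b y + t * (b' y - b y)) y))" if "0 < t" "t < \<eta>" for y t
    using that by (auto simp: Q_def u_def W_def)
  moreover have "s = 1 \<or> s = - 1" by (auto simp: s_def)
  ultimately show ?thesis using that \<eta>(1,2) by blast
qed

text \<open>What matters is that the two graphs have opposite signs. With equal signs
  \<open>sL * Im \<psi>\<close> would be bounded below by some \<open>m > - pi / 2\<close>: by
  \<open>pi / 4\<close> near the graphs, and by compactness modulo the period in between. But
  \<open>\<psi>\<close> is onto the strip.\<close>

lemma boundary_limits: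
  obtains s :: real where "s = 1 \<or> s = - 1"
    "\<And>X w. \<lbrakk>\<And>n. X n \<in> V; X \<longlonglongrightarrow> w; Re w = l (Im w)\<rbrakk> \<Longrightarrow> (\<lambda>n. s * Im (\<psi> (X n))) \<longlonglongrightarrow> - pi / 2"
    "\<And>X w. \<lbrakk>\<And>n. X n \<in> V; X \<longlonglongrightarrow> w; Re w = r (Im w)\<rbrakk> \<Longrightarrow> (\<lambda>n. s * Im (\<psi> (X n))) \<longlonglongrightarrow> pi / 2"
proof -
  have pos: "0 < r y - l y" for y using lr[of y] by simp
  have mult: "0 < t * (r y - l y)" "t * (r y - l y) < r y - l y" if "0 < t" "t < 1" for t y
    using that pos[of y] by simp_all
  have "Complex (l y + t * (r y - l y)) y \<in> V" if "0 < t" "t < 1" for y t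
    using mult[OF that, of y] by (simp add: V_def)
  moreover have "Complex (l y) y \<notin> V" for y by (simp add: V_def)
  ultimately obtain \<eta>L sL where L: "0 < \<eta>L" "\<eta>L < 1 / 2" "sL = 1 \<or> sL = (- 1 :: real)"
    "\<And>y t. \<lbrakk>0 < t; t < \<eta>L\<rbrakk> \<Longrightarrow> pi / 4 < sL * Im (\<psi> (Complex (l y + t * (r y - l y)) y))"
    using boundary_sign[OF contl contr perl perr] by metis
  have "Complex (r y + t * (l y - r y)) y \<in> V" if "0 < t" "t < 1" for y t
    using mult[OF that, of y] by (simp add: V_def algebra_simps)
  moreover have "Complex (r y) y \<notin> V" for y by (simp add: V_def)
  ultimately obtain \<eta>R sR where R: "0 < \<eta>R" "\<eta>R < 1 / 2" "sR = 1 \<or> sR = (- 1 :: real)"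
    "\<And>y t. \<lbrakk>0 < t; t < \<eta>R\<rbrakk> \<Longrightarrow> pi / 4 < sR * Im (\<psi> (Complex (r y + t * (l y - r y)) y))"
    using boundary_sign[OF contr contl perr perl] by metis
  have tR: "Complex (l y + t * (r y - l y)) y = Complex (r y + (1 - t) * (l y - r y)) y" for y t
    by (simp add: algebra_simps)
  have coord: "w = Complex (l (Im w) + t * (r (Im w) - l (Im w))) (Im w)"
    if "t = (Re w - l (Im w)) / (r (Im w) - l (Im w))" for w t
    using pos[of "Im w"] that by (simp add: complex_eq_iff)
  have coord01: "0 < t" "t < 1" if "t = (Re w - l (Im w)) / (r (Im w) - l (Im w))" "w \<in> V" for w t
    using pos[of "Im w"] that by (simp_all add: V_def)
  have opp: "sL = - sR"
  proof (rule ccontr)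
    assume "sL \<noteq> - sR"
    then have eq: "sL = sR" using L(3) R(3) by auto
    define \<eta> where "\<eta> = min \<eta>L \<eta>R / 2"
    have \<eta>: "0 < \<eta>" "\<eta> < \<eta>L" "\<eta> < \<eta>R" "\<eta> < 1 / 2" using L(1,2) R(1,2) by (auto simp: \<eta>_def)
    define W where "W = (\<lambda>(t, y). Complex (l y + t * (r y - l y)) y)"
    define K where "K = W ` ({\<eta>..1 - \<eta>} \<times> {0..T})"
    have contW: "continuous_on UNIV W"
      unfolding W_def split_beta by (intro continuous_on_Complex continuous_intros)
    have "compact K" unfolding K_def
      by (intro compact_continuous_image continuous_on_subset[OF contW] compact_Times) auto
    moreover have "K \<noteq> {}" unfolding K_def using \<eta> T by auto
    moreover have KV: "K \<subseteq> V"
    proof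
      fix x assume "x \<in> K"
      then obtain t y where "x = W (t, y)" "0 < t" "t < 1" using \<eta>(1) unfolding K_def by force
      then show "x \<in> V" using mult[of t y] by (simp add: V_def W_def)
    qed
    moreover have "continuous_on K (\<lambda>w. sL * Im (\<psi> w))"
      using KV by (intro continuous_intros continuous_on_subset[OF cont_\<psi>])
    ultimately obtain x0 where x0: "x0 \<in> K" "\<And>x. x \<in> K \<Longrightarrow> sL * Im (\<psi> x0) \<le> sL * Im (\<psi> x)"
      using continuous_attains_inf[of K "\<lambda>w. sL * Im (\<psi> w)"] by blast
    define m where "m = min (sL * Im (\<psi> x0)) (pi / 4)"
    have m: "- (pi / 2) < m" using strip[of x0] x0(1) KV L(3) by (auto simp: m_def)
    have low: "m \<le> sL * Im (\<psi> w)" if w: "w \<in> V" for w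
    proof -
      obtain k where k: "Im w + of_int k * T \<in> {0..T}" by (rule period_representative)
      define w' where "w' = w + \<i> * of_real (of_int k * T)"
      have w'V: "w' \<in> V" using w V_shift by (simp add: w'_def)
      define t where "t = (Re w' - l (Im w')) / (r (Im w') - l (Im w'))"
      have t: "0 < t" "t < 1" using coord01[OF t_def w'V] by auto
      have w': "w' = Complex (l (Im w') + t * (r (Im w') - l (Im w'))) (Im w')" by (rule coord[OF t_def])
      have "m \<le> sL * Im (\<psi> w')"
      proof -
        consider "t < \<eta>L" | "1 - t < \<eta>R" | "t \<in> {\<eta>..1 - \<eta>}" using \<eta> by fastforce
        then show ?thesis
        proof cases
          case 1 then show ?thesis using L(4)[of t "Im w'"] t w' by (simp add: m_def)
        next
          case 2 then show ?thesis using R(4)[of "1 - t" "Im w'"] t w' tR[of "Im w'" t] eq by (simp add: m_def)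
        next
          case 3
          have "Im w' \<in> {0..T}" using k by (simp add: w'_def)
          then have "w' \<in> K" unfolding K_def W_def using 3 w' by force
          then show ?thesis using x0(2)[of w'] by (simp add: m_def)
        qed
      qed
      then show ?thesis using Im_shift_int[OF w, of k] by (simp add: w'_def)
    qed
    \<comment> \<open>A point of the strip midway between the edge and the level \<open>m\<close>,
      hence not a value of \<open>\<psi>\<close>.\<close>
    define \<zeta> where "\<zeta> = \<i> * of_real (sL * ((m - pi / 2) / 2))"
    have "m \<le> pi / 4" by (simp add: m_def)
    then have *: "- (pi / 2) < (m - pi / 2) / 2" "(m - pi / 2) / 2 < m" "(m - pi / 2) / 2 < pi / 2" using m pi_gt_zero by (simp_all add: field_simps)
    then have "\<bar>Im \<zeta>\<bar> < pi / 2" using L(3) by (auto simp: \<zeta>_def abs_less_iff)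
    then have "m \<le> sL * Im \<zeta>" using \<psi>\<xi> low by metis
    then show False using L(3) * by (auto simp: \<zeta>_def)
  qed
  have conv: "(\<lambda>n. (Re (X n) - l (Im (X n))) / (r (Im (X n)) - l (Im (X n)))) \<longlonglongrightarrow> (Re w - l (Im w)) / (r (Im w) - l (Im w))"
    if "X \<longlonglongrightarrow> w" for X w
  proof -
    have "r (Im x) - l (Im x) \<noteq> 0" for x using pos[of "Im x"] by simp
    then have "continuous_on UNIV (\<lambda>w. (Re w - l (Im w)) / (r (Im w) - l (Im w)))"
      by (intro continuous_intros) auto
    then have "isCont (\<lambda>w. (Re w - l (Im w)) / (r (Im w) - l (Im w))) w"
      by (simp add: continuous_on_eq_continuous_at)
    then show ?thesis using that by (rule isCont_tendsto_compose)
  qed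
  show ?thesis
  proof (rule that[of sR])
    show "sR = 1 \<or> sR = - 1" by (rule R(3))
  next
    fix X w assume X: "\<And>n. X n \<in> V" "X \<longlonglongrightarrow> w" and w: "Re w = l (Im w)"
    have "w \<notin> V" using w by (simp add: V_def)
    from tendsto_boundary[OF X this] have lim: "(\<lambda>n. \<bar>Im (\<psi> (X n))\<bar>) \<longlonglongrightarrow> pi / 2" .
    define t where "t = (\<lambda>n. (Re (X n) - l (Im (X n))) / (r (Im (X n)) - l (Im (X n))))"
    have "t \<longlonglongrightarrow> 0" using conv[OF X(2)] w by (simp add: t_def)
    then have "eventually (\<lambda>n. t n < \<eta>L) sequentially" using L(1) order_tendstoD(2) by blast
    then have "eventually (\<lambda>n. - \<bar>Im (\<psi> (X n))\<bar> = sR * Im (\<psi> (X n))) sequentially"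
    proof eventually_elim
      case (elim n)
      have "pi / 4 < sL * Im (\<psi> (X n))"
        using L(4)[OF coord01(1)[OF _ X(1)[of n]], of "t n" "Im (X n)"] elim coord[of "t n" "X n"] by (simp add: t_def)
      then have "0 < sL * Im (\<psi> (X n))" using pi_gt_zero by linarith
      then show ?case using R(3) opp by (auto simp: abs_if)
    qed
    moreover have "(\<lambda>n. - \<bar>Im (\<psi> (X n))\<bar>) \<longlonglongrightarrow> - pi / 2" using tendsto_minus[OF lim] by simp
    ultimately show "(\<lambda>n. sR * Im (\<psi> (X n))) \<longlonglongrightarrow> - pi / 2"
      by (rule Lim_transform_eventually[rotated])
  next
    fix X w assume X: "\<And>n. X n \<in> V" "X \<longlonglongrightarrow> w" and w: "Re w = r (Im w)"
    have "w \<notin> V" using w by (simp add: V_def)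
    from tendsto_boundary[OF X this] have lim: "(\<lambda>n. \<bar>Im (\<psi> (X n))\<bar>) \<longlonglongrightarrow> pi / 2" .
    define t where "t = (\<lambda>n. (Re (X n) - l (Im (X n))) / (r (Im (X n)) - l (Im (X n))))"
    have "t \<longlonglongrightarrow> 1" using conv[OF X(2)] w pos[of "Im w"] by (simp add: t_def)
    then have "eventually (\<lambda>n. 1 - \<eta>R < t n) sequentially" using R(1) order_tendstoD(1) by fastforce
    then have "eventually (\<lambda>n. \<bar>Im (\<psi> (X n))\<bar> = sR * Im (\<psi> (X n))) sequentially"
    proof eventually_elim
      case (elim n)
      have "t n < 1" using coord01(2)[OF _ X(1)[of n]] by (simp add: t_def)
      then have "pi / 4 < sR * Im (\<psi> (X n))"
        using R(4)[of "1 - t n" "Im (X n)"] elim coord[of "t n" "X n"] tR[of "Im (X n)" "t n"] by (simp add: t_def)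
      then have "0 < sR * Im (\<psi> (X n))" using pi_gt_zero by linarith
      then show ?case using R(3) by (auto simp: abs_if)
    qed
    then show "(\<lambda>n. sR * Im (\<psi> (X n))) \<longlonglongrightarrow> pi / 2" by (rule Lim_transform_eventually[OF lim])
  qed
qed

text \<open>The harmonic function \<open>v\<close> is the increment of \<open>s * Im \<psi>\<close>
  over a shift to the right by \<open>t\<close>. At the ends of a horizontal slice
  \<open>s * Im \<psi>\<close> tends to its extreme values, so \<open>v\<close> has no negative
  limits at the boundary of \<open>Wt\<close>. A negative infimum would therefore be attained, and
  the maximum principle, applied at a leftmost minimum, excludes that.\<close>

lemma Im_monotone:
  assumes s: "s = 1 \<or> s = (- 1 :: real)"
    and left: "\<And>X w. \<lbrakk>\<And>n. X n \<in> V; X \<longlonglongrightarrow> w; Re w = l (Im w)\<rbrakk> \<Longrightarrow> (\<lambda>n. s * Im (\<psi> (X n))) \<longlonglongrightarrow> - pi / 2"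
    and right: "\<And>X w. \<lbrakk>\<And>n. X n \<in> V; X \<longlonglongrightarrow> w; Re w = r (Im w)\<rbrakk> \<Longrightarrow> (\<lambda>n. s * Im (\<psi> (X n))) \<longlonglongrightarrow> pi / 2"
    and t: "t > 0" and w1: "w1 \<in> V" "w1 + of_real t \<in> V"
  shows "s * Im (\<psi> w1) \<le> s * Im (\<psi> (w1 + of_real t))"
proof (rule ccontr)
  assume neg1: "\<not> ?thesis"
  define Wt where "Wt = {w. w \<in> V \<and> w + of_real t \<in> V}"
  define v where "v = (\<lambda>w. s * (Im (\<psi> (w + of_real t)) - Im (\<psi> w)))"
  have WtI: "Wt = V \<inter> (\<lambda>w. w + of_real t) -` V" by (auto simp: Wt_def)
  have openW: "open Wt" unfolding WtI
    by (intro open_Int open_V continuous_open_vimage) (auto intro!: continuous_intros)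
  have contv: "continuous_on Wt v" unfolding v_def
    by (intro continuous_intros continuous_on_compose2[OF cont_\<psi>]) (auto simp: Wt_def)
  have sb: "\<bar>s * Im (\<psi> w)\<bar> < pi / 2" if "w \<in> V" for w using strip[OF that] s by auto
  have v_low: "- pi \<le> v w" if "w \<in> Wt" for w
    using sb[of w] sb[of "w + of_real t"] that by (auto simp: v_def Wt_def right_diff_distrib)
  have limW: "w \<in> Wt" if X: "\<And>n. X n \<in> Wt" "X \<longlonglongrightarrow> w" and lim: "(\<lambda>n. v (X n)) \<longlonglongrightarrow> m" and m: "m < 0" for X w m
  proof -
    have XV: "X n \<in> V" "X n + of_real t \<in> V" for n using X(1)[of n] by (auto simp: Wt_def)
    have Xt: "(\<lambda>n. X n + of_real t) \<longlonglongrightarrow> w + of_real t" by (intro tendsto_intros X(2))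
    have lim1: "(\<lambda>n. l (Im (X n))) \<longlonglongrightarrow> l (Im w)" "(\<lambda>n. r (Im (X n))) \<longlonglongrightarrow> r (Im w)"
      using contl contr X(2) by (auto intro!: isCont_tendsto_compose[of _ l] isCont_tendsto_compose[of _ r] tendsto_Im simp: continuous_on_eq_continuous_at)
    have "l (Im w) \<le> Re w" by (rule LIMSEQ_le[OF lim1(1) tendsto_Re[OF X(2)]]) (use XV(1) in \<open>auto simp: V_def less_imp_le\<close>)
    moreover have "Re w + t \<le> r (Im w)"
      using LIMSEQ_le[OF tendsto_Re[OF Xt] lim1(2)] XV(2) by (auto simp: V_def less_imp_le)
    moreover have "Re w \<noteq> l (Im w)"
    proof
      assume "Re w = l (Im w)"
      from left[OF XV(1) X(2) this] have "(\<lambda>n. - pi / 2 - s * Im (\<psi> (X n))) \<longlonglongrightarrow> - pi / 2 - (- pi / 2)" by (intro tendsto_intros)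
      moreover have "- pi / 2 - s * Im (\<psi> (X n)) \<le> v (X n)" for n
        using sb[OF XV(2)[of n]] by (simp add: v_def right_diff_distrib abs_less_iff)
      ultimately have "- pi / 2 - (- pi / 2) \<le> m" using lim by (intro LIMSEQ_le) auto
      then show False using m by simp
    qed
    moreover have "Re w + t \<noteq> r (Im w)"
    proof
      assume "Re w + t = r (Im w)"
      then have "Re (w + of_real t) = r (Im (w + of_real t))" by simp
      from right[OF XV(2) Xt this] have "(\<lambda>n. s * Im (\<psi> (X n + of_real t)) - pi / 2) \<longlonglongrightarrow> pi / 2 - pi / 2" by (intro tendsto_intros)
      moreover have "s * Im (\<psi> (X n + of_real t)) - pi / 2 \<le> v (X n)" for n
        using sb[OF XV(1)[of n]] by (simp add: v_def right_diff_distrib abs_less_iff)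
      ultimately have "pi / 2 - pi / 2 \<le> m" using lim by (intro LIMSEQ_le) auto
      then show False using m by simp
    qed
    ultimately show "w \<in> Wt" using t by (simp add: Wt_def V_def)
  qed
  have Wt_shift: "w + \<i> * of_real (of_int k * T) \<in> Wt" and v_shift: "v (w + \<i> * of_real (of_int k * T)) = v w"
    if "w \<in> Wt" for w k
  proof -
    have eq: "w + \<i> * of_real (of_int k * T) + of_real t = (w + of_real t) + \<i> * of_real (of_int k * T)"
      by (simp add: algebra_simps)
    show "w + \<i> * of_real (of_int k * T) \<in> Wt" using that V_shift[of w k] V_shift[of "w + of_real t" k] by (simp only: Wt_def mem_Collect_eq eq)
    show "v (w + \<i> * of_real (of_int k * T)) = v w"
      unfolding v_def eq using that Im_shift_int by (simp add: Wt_def)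
  qed
  obtain B where B: "\<And>w. w \<in> V \<Longrightarrow> \<bar>Re w\<bar> \<le> B" using Re_bounded by blast
  have limit: "\<exists>w X' \<rho>. strict_mono \<rho> \<and> X' \<longlonglongrightarrow> w \<and> (\<forall>n. X' n \<in> Wt \<and> v (X' n) = v (X (\<rho> n)) \<and> Re (X' n) = Re (X (\<rho> n)))"
    if X: "\<And>n. X n \<in> Wt" for X :: "nat \<Rightarrow> complex"
  proof -
    have "\<exists>k::int. Im (X n) + of_int k * T \<in> {0..T}" for n using period_representative by metis
    then obtain k :: "nat \<Rightarrow> int" where k: "\<And>n. Im (X n) + of_int (k n) * T \<in> {0..T}" by metis
    define Y where "Y = (\<lambda>n. X n + \<i> * of_real (of_int (k n) * T))"
    have Y: "Y n \<in> Wt" "v (Y n) = v (X n)" "Re (Y n) = Re (X n)" for n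
      using Wt_shift[OF X] v_shift[OF X] by (auto simp: Y_def)
    have "Y n \<in> cbox (Complex (-B) 0) (Complex B T)" for n
      using B[of "Y n"] Y(1)[of n] k[of n] by (auto simp: in_cbox_complex_iff Wt_def Y_def)
    then obtain w \<rho> where "strict_mono (\<rho> :: nat \<Rightarrow> nat)" "(Y \<circ> \<rho>) \<longlonglongrightarrow> w"
      using compact_cbox[of "Complex (-B) 0" "Complex B T"] unfolding compact_def by metis
    then show ?thesis using Y by (intro exI[of _ w] exI[of _ "Y \<circ> \<rho>"] exI[of _ \<rho>]) (auto simp: o_def)
  qed
  have w1W: "w1 \<in> Wt" "v w1 < 0" using w1 neg1 by (auto simp: Wt_def v_def right_diff_distrib)
  define m where "m = Inf (v ` Wt)"
  have bdd: "bdd_below (v ` Wt)" using v_low by (intro bdd_belowI[of _ "- pi"]) auto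
  have m_le: "m \<le> v w" if "w \<in> Wt" for w unfolding m_def using bdd that by (simp add: cINF_lower)
  have m0: "m < 0" using m_le[OF w1W(1)] w1W(2) by linarith
  have attained: "w \<in> Wt \<and> v w = c" if X: "\<And>n. X n \<in> Wt" "X \<longlonglongrightarrow> w" and lim: "(\<lambda>n. v (X n)) \<longlonglongrightarrow> c" and c: "c < 0" for X w c
  proof -
    have w: "w \<in> Wt" by (rule limW[OF X lim c])
    then have "isCont v w" using contv openW continuous_on_eq_continuous_at by blast
    then have "(\<lambda>n. v (X n)) \<longlonglongrightarrow> v w" using X(2) by (rule isCont_tendsto_compose)
    then show ?thesis using w lim LIMSEQ_unique by blast
  qed
  define Mset where "Mset = {w \<in> Wt. v w = m}"
  have "Mset \<noteq> {}"
  proof -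
    have "\<exists>w\<in>Wt. v w < m + 1 / of_nat (Suc n)" for n
    proof -
      have "Inf (v ` Wt) < m + 1 / of_nat (Suc n)" by (simp add: m_def)
      then show ?thesis using cInf_less_iff[OF _ bdd] w1W(1) by blast
    qed
    then obtain X where X: "\<And>n. X n \<in> Wt" "\<And>n. v (X n) < m + 1 / of_nat (Suc n)" by metis
    have limX: "(\<lambda>n. v (X n)) \<longlonglongrightarrow> m"
      using m_le[OF X(1)] X(2) by (rule tendsto_of_between_inverse_Suc)
    obtain w X' \<rho> where w: "strict_mono \<rho>" "X' \<longlonglongrightarrow> w" "\<And>n. X' n \<in> Wt" "\<And>n. v (X' n) = v (X (\<rho> n))"
      using limit[of X, OF X(1)] by blast
    have "(\<lambda>n. v (X' n)) \<longlonglongrightarrow> m" unfolding w(4) using LIMSEQ_subseq_LIMSEQ[OF limX w(1)] by (simp add: o_def)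
    then have "w \<in> Mset" using attained[OF w(3,2) _ m0] by (simp add: Mset_def)
    then show ?thesis by auto
  qed
  have bddR: "bdd_below (Re ` Mset)"
    using B by (intro bdd_belowI[of _ "- B"]) (fastforce simp: Mset_def Wt_def abs_le_iff)
  \<comment> \<open>\<open>Wt\<close> may be disconnected, so a leftmost minimum is chosen: the
    minimum spreads to a neighbourhood and hence further to the left.\<close>
  define \<rho>0 where "\<rho>0 = Inf (Re ` Mset)"
  have "\<exists>w\<in>Mset. Re w = \<rho>0"
  proof -
    have "\<exists>w\<in>Mset. Re w < \<rho>0 + 1 / of_nat (Suc n)" for n
    proof -
      have "Inf (Re ` Mset) < \<rho>0 + 1 / of_nat (Suc n)" by (simp add: \<rho>0_def)
      then show ?thesis using cInf_less_iff[OF _ bddR] \<open>Mset \<noteq> {}\<close> by blast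
    qed
    then obtain X where X: "\<And>n. X n \<in> Mset" "\<And>n. Re (X n) < \<rho>0 + 1 / of_nat (Suc n)" by metis
    have low: "\<rho>0 \<le> Re (X n)" for n unfolding \<rho>0_def using bddR X(1) by (simp add: cINF_lower)
    have limX: "(\<lambda>n. Re (X n)) \<longlonglongrightarrow> \<rho>0"
      using low X(2) by (rule tendsto_of_between_inverse_Suc)
    have XW: "X n \<in> Wt" for n using X(1)[of n] by (simp add: Mset_def)
    obtain w X' \<rho> where w: "strict_mono \<rho>" "X' \<longlonglongrightarrow> w" "\<And>n. X' n \<in> Wt" "\<And>n. v (X' n) = v (X (\<rho> n))" "\<And>n. Re (X' n) = Re (X (\<rho> n))"
      using limit[of X, OF XW] by blast
    have "(\<lambda>n. v (X' n)) \<longlonglongrightarrow> m" unfolding w(4) using X(1) by (simp add: Mset_def)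
    then have "w \<in> Mset" using attained[OF w(3,2) _ m0] by (simp add: Mset_def)
    moreover have "(\<lambda>n. Re (X' n)) \<longlonglongrightarrow> \<rho>0" unfolding w(5) using LIMSEQ_subseq_LIMSEQ[OF limX w(1)] by (simp add: o_def)
    then have "Re w = \<rho>0" using tendsto_Re[OF w(2)] LIMSEQ_unique by blast
    ultimately show ?thesis by blast
  qed
  then obtain w2 where w2: "w2 \<in> Wt" "v w2 = m" "Re w2 = \<rho>0" by (auto simp: Mset_def)
  obtain e where e: "e > 0" "ball w2 e \<subseteq> Wt" using w2(1) openW openE by blast
  define g where "g = (\<lambda>w. exp (\<i> * of_real s * (\<psi> (w + of_real t) - \<psi> w)))"
  have norm_g: "norm (g w) = exp (- v w)" for w by (simp add: g_def v_def)
  have holg: "g holomorphic_on ball w2 e" unfolding g_def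
  proof (intro holomorphic_intros)
    show "\<psi> holomorphic_on ball w2 e" using e(2) by (intro holomorphic_on_subset[OF hol]) (auto simp: Wt_def)
    have "(\<psi> \<circ> (\<lambda>w. w + of_real t)) holomorphic_on ball w2 e"
      using e(2) by (intro holomorphic_on_compose_gen[OF _ hol] holomorphic_intros) (auto simp: Wt_def)
    then show "(\<lambda>w. \<psi> (w + of_real t)) holomorphic_on ball w2 e" by (simp add: o_def)
  qed
  have "g constant_on ball w2 e"
    by (rule maximum_modulus_principle[OF holg open_ball connected_ball open_ball order_refl, of w2])
       (use e m_le w2 in \<open>auto simp: norm_g\<close>)
  then obtain c where c: "\<And>w. w \<in> ball w2 e \<Longrightarrow> g w = c" by (auto simp: constant_on_def)
  define w3 where "w3 = w2 - of_real (e / 2)"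
  have w3b: "w3 \<in> ball w2 e" using e(1) by (simp add: w3_def dist_norm)
  have "norm (g w3) = norm (g w2)" using c[OF w3b] c[of w2] e(1) by simp
  then have "v w3 = m" by (simp add: norm_g w2)
  then have "w3 \<in> Mset" using w3b e(2) by (auto simp: Mset_def)
  then have "\<rho>0 \<le> Re w3" unfolding \<rho>0_def using bddR by (simp add: cINF_lower)
  then show False using e(1) w2(3) by (simp add: w3_def)
qed

lemma Im_deriv_sign:
  obtains s :: real where "s = 1 \<or> s = - 1" "\<And>w. w \<in> V \<Longrightarrow> 0 \<le> s * Im (deriv \<psi> w)"
proof -
  obtain s :: real where s: "s = 1 \<or> s = - 1"
    "\<And>X w. \<lbrakk>\<And>n. X n \<in> V; X \<longlonglongrightarrow> w; Re w = l (Im w)\<rbrakk> \<Longrightarrow> (\<lambda>n. s * Im (\<psi> (X n))) \<longlonglongrightarrow> - pi / 2"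
    "\<And>X w. \<lbrakk>\<And>n. X n \<in> V; X \<longlonglongrightarrow> w; Re w = r (Im w)\<rbrakk> \<Longrightarrow> (\<lambda>n. s * Im (\<psi> (X n))) \<longlonglongrightarrow> pi / 2"
    using boundary_limits by blast
  have "0 \<le> s * Im (deriv \<psi> w)" if w: "w \<in> V" for w
  proof (rule ccontr)
    assume "\<not> ?thesis"
    then have neg: "s * Im (deriv \<psi> w) < 0" by simp
    define h where "h = (\<lambda>t. s * Im (\<psi> (w + of_real t)))"
    have "((\<lambda>t. w + of_real t) has_vector_derivative 1) (at 0)"
      by (auto intro!: derivative_eq_intros simp: has_vector_derivative_def scaleR_conv_of_real fun_eq_iff)
    then have "((\<psi> \<circ> (\<lambda>t. w + of_real t)) has_vector_derivative (1 * deriv \<psi> w)) (at 0)"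
      using hol w open_V by (intro field_vector_diff_chain_at) (auto intro: holomorphic_derivI)
    then have "((\<lambda>t. Im (\<psi> (w + of_real t))) has_vector_derivative Im (deriv \<psi> w)) (at 0)"
      unfolding o_def using bounded_linear.has_vector_derivative[OF bounded_linear_Im] by fastforce
    then have "DERIV (\<lambda>t. Im (\<psi> (w + of_real t))) 0 :> Im (deriv \<psi> w)"
      by (simp add: has_real_derivative_iff_has_vector_derivative)
    then have "DERIV h 0 :> s * Im (deriv \<psi> w)" unfolding h_def by (rule DERIV_cmult)
    from DERIV_neg_dec_right[OF this neg] obtain d where d: "d > 0" "\<And>t. \<lbrakk>0 < t; t < d\<rbrakk> \<Longrightarrow> h t < h 0" by auto
    obtain e where e: "e > 0" "ball w e \<subseteq> V" using w open_V openE by blast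
    define t where "t = min d e / 2"
    have t: "0 < t" "t < d" "t < e" using d e by (auto simp: t_def)
    have "w + of_real t \<in> V" using e(2) t by (auto simp: dist_norm)
    then have "h 0 \<le> h t" unfolding h_def using Im_monotone[OF s t(1) w] by simp
    then show False using d(2)[OF t(1,2)] by simp
  qed
  then show ?thesis using that s(1) by blast
qed

end

text \<open>A parabolic translation would have arbitrarily small displacement in the hyperbolic metric,
  which is impossible because the domain lies in a vertical strip.\<close>

lemma (in periodic_domain) not_parabolic:
  assumes j: "j holomorphic_on ball 0 1" and jV: "\<And>z. z \<in> ball 0 1 \<Longrightarrow> j z \<in> V"
    and s: "\<And>z. z \<in> ball 0 1 \<Longrightarrow> s z \<in> ball 0 1 \<and> j (s z) = j z + \<i> * T"
    and p: "norm p = 1"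
    and par: "\<And>z. z \<in> ball 0 1 \<Longrightarrow> p / (p - s z) = p / (p - z) + t"
  shows False
proof -
  obtain B where B: "\<And>w. w \<in> V \<Longrightarrow> \<bar>Re w\<bar> \<le> B" using Re_bounded by blast
  \<comment> \<open>With this \<open>k\<close> the translation by \<open>\<i> * T\<close> changes
    the sign of \<open>exp (k * j)\<close>.\<close>
  define k where "k = pi / T"
  have k0: "k > 0" using T by (simp add: k_def)
  have p0: "p \<noteq> 0" using p by auto
  \<comment> \<open>The inverse of \<open>z \<mapsto> p / (p - z)\<close>, which carries the disk to
    the half-plane \<open>Re \<zeta> > 1 / 2\<close> and \<open>s\<close> to the translation by
    \<open>t\<close>.\<close>
  define h where "h = (\<lambda>\<zeta>. p * (1 - 1 / \<zeta>))"
  define Y where "Y = (\<lambda>\<zeta>. exp (of_real k * j (h \<zeta>)))"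
  have h_in: "h \<zeta> \<in> ball 0 1" if "Re \<zeta> > 1/2" for \<zeta>
  proof -
    have z0: "\<zeta> \<noteq> 0" using that by auto
    have "(norm (\<zeta> - 1))\<^sup>2 < (norm \<zeta>)\<^sup>2"
      unfolding cmod_power2 using that by (simp add: power2_eq_square algebra_simps)
    then have "norm (\<zeta> - 1) < norm \<zeta>" by (simp add: power2_less_imp_less)
    moreover have "h \<zeta> = p * ((\<zeta> - 1) / \<zeta>)" using z0 by (simp add: h_def diff_divide_distrib)
    ultimately show ?thesis using p z0 by (simp add: norm_mult norm_divide)
  qed
  have ph: "p / (p - h \<zeta>) = \<zeta>" if "Re \<zeta> > 1/2" for \<zeta>
  proof -
    have z0: "\<zeta> \<noteq> 0" using that by auto
    have "p - h \<zeta> = p / \<zeta>" by (simp add: h_def algebra_simps)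
    then show ?thesis using p0 z0 by simp
  qed
  have hp: "h (p / (p - z)) = z" if "z \<in> ball 0 1" for z
  proof -
    have "p - z \<noteq> 0" using that p by auto
    then show ?thesis using p0 by (simp add: h_def field_simps)
  qed
  have Ystep: "Y (\<zeta> + t) = - Y \<zeta>" if "Re \<zeta> > 1/2" for \<zeta>
  proof -
    have "h (\<zeta> + t) = s (h \<zeta>)"
      using hp[of "s (h \<zeta>)"] par[OF h_in[OF that]] ph[OF that] s[OF h_in[OF that]] by simp
    then have "Y (\<zeta> + t) = exp (of_real k * j (h \<zeta>) + \<i> * of_real pi)"
      using s[OF h_in[OF that]] T by (simp add: Y_def k_def field_simps)
    then show ?thesis by (simp add: exp_add Y_def)
  qed
  have Yup: "norm (Y \<zeta>) \<le> exp (k * B)" and Ylow: "exp (- (k * B)) \<le> norm (Y \<zeta>)" if "Re \<zeta> > 1/2" for \<zeta>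
  proof -
    have "\<bar>Re (j (h \<zeta>))\<bar> \<le> B" using B jV h_in that by blast
    then have "k * Re (j (h \<zeta>)) \<le> k * B" "k * (- B) \<le> k * Re (j (h \<zeta>))"
      using k0 mult_left_mono[of "Re (j (h \<zeta>))" B k] mult_left_mono[of "- B" "Re (j (h \<zeta>))" k]
      by (auto simp: abs_le_iff)
    then show "norm (Y \<zeta>) \<le> exp (k * B)" "exp (- (k * B)) \<le> norm (Y \<zeta>)" by (simp_all add: Y_def)
  qed
  have Yhol: "Y holomorphic_on {\<zeta>. Re \<zeta> > 1/2}"
  proof -
    have "h holomorphic_on {\<zeta>. Re \<zeta> > 1/2}" unfolding h_def by (intro holomorphic_intros) auto
    then have "(j \<circ> h) holomorphic_on {\<zeta>. Re \<zeta> > 1/2}"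
      using h_in by (intro holomorphic_on_compose_gen[OF _ j]) auto
    then show ?thesis unfolding Y_def o_def by (intro holomorphic_intros)
  qed
  have openH: "open {\<zeta>. Re \<zeta> > 1/2}" by (rule open_halfspace_Re_gt)
  \<comment> \<open>Chosen for the final contradiction: \<open>Y\<close> is bounded from both sides
    and changes sign under the translation by \<open>t\<close>, while Cauchy's estimate makes its
    derivative at most of order \<open>1 / X\<close> on \<open>Re \<zeta> \<ge> X\<close>.\<close>
  define X where "X = 1 + 2 * (norm t * exp (2 * k * B))"
  have X1: "X \<ge> 1" by (simp add: X_def)
  have dY: "norm (deriv Y \<zeta>) \<le> exp (k * B) / (X / 4)" if \<zeta>: "Re \<zeta> \<ge> X" for \<zeta>
  proof -
    have sub: "cball \<zeta> (X / 4) \<subseteq> {\<zeta>. Re \<zeta> > 1/2}"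
    proof
      fix v assume "v \<in> cball \<zeta> (X / 4)"
      then have "norm (\<zeta> - v) \<le> X / 4" by (simp add: dist_norm)
      then have "Re \<zeta> - Re v \<le> X / 4" using complex_Re_le_cmod[of "\<zeta> - v"] by simp
      then show "v \<in> {\<zeta>. Re \<zeta> > 1/2}" using \<zeta> X1 by simp
    qed
    have "norm ((deriv ^^ 1) Y \<zeta>) \<le> fact 1 * exp (k * B) / (X / 4) ^ 1"
    proof (rule Cauchy_inequality)
      show "Y holomorphic_on ball \<zeta> (X / 4)" by (intro holomorphic_on_subset[OF Yhol] subset_trans[OF ball_subset_cball sub])
      show "continuous_on (cball \<zeta> (X / 4)) Y"
        using sub by (intro continuous_on_subset[OF holomorphic_on_imp_continuous_on[OF Yhol]])
      show "0 < X / 4" using X1 by simp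
      show "norm (Y x) \<le> exp (k * B)" if "norm (\<zeta> - x) = X / 4" for x
        using that sub by (intro Yup) (auto simp: dist_norm)
    qed
    then show ?thesis by simp
  qed
  define x where "x = complex_of_real (X + norm t)"
  have xr: "x \<in> {\<zeta>. Re \<zeta> \<ge> X}" "x + t \<in> {\<zeta>. Re \<zeta> \<ge> X}"
    using complex_Re_le_cmod[of "- t"] by (simp_all add: x_def)
  have xh: "Re x > 1/2" using X1 norm_ge_zero[of t] unfolding x_def Re_complex_of_real by linarith
  have "norm (Y (x + t) - Y x) \<le> exp (k * B) / (X / 4) * norm (x + t - x)"
  proof (rule field_differentiable_bound[of "{\<zeta>. Re \<zeta> \<ge> X}" Y "deriv Y"])
    show "convex {\<zeta>. Re \<zeta> \<ge> X}" by (rule convex_halfspace_Re_ge)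
    show "(Y has_field_derivative deriv Y z) (at z within {\<zeta>. Re \<zeta> \<ge> X})" if "z \<in> {\<zeta>. Re \<zeta> \<ge> X}" for z
    proof -
      have "z \<in> {\<zeta>. Re \<zeta> > 1/2}" using that X1 by simp
      from holomorphic_derivI[OF Yhol openH this] show ?thesis by (rule has_field_derivative_at_within)
    qed
  qed (use dY xr in auto)
  then have "2 * norm (Y x) \<le> exp (k * B) / (X / 4) * norm t"
    using Ystep[OF xh] by (simp flip: norm_mult)
  then have "2 * exp (- (k * B)) \<le> exp (k * B) / (X / 4) * norm t" using Ylow[OF xh] by linarith
  then have "2 * exp (- (k * B)) * X \<le> 4 * exp (k * B) * norm t" using X1 by (simp add: field_simps)
  then have "exp (k * B) * (2 * exp (- (k * B)) * X) \<le> exp (k * B) * (4 * exp (k * B) * norm t)"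
    by (rule mult_left_mono) simp
  then have "2 * X \<le> 4 * (norm t * exp (2 * k * B))"
    by (simp add: exp_minus exp_double mult_exp_exp algebra_simps flip: exp_add)
  then show False using X1 by (simp add: X_def)
qed

text \<open>Conjugating the vertical translation to the disk gives a hyperbolic automorphism with fixed
  points \<open>p\<close> and \<open>q\<close>; the logarithm of \<open>(1 - cnj p * z) / (1 - cnj q * z)\<close> maps the domain onto a
  horizontal strip. By the maximum principle its imaginary part is monotone along horizontal
  lines, and differentiating gives the inequality.\<close>

lemma (in periodic_domain) conformal_map_positivity:
  assumes w0: "w0 \<in> V"
  obtains j f p q c where "j holomorphic_on ball 0 1" "f holomorphic_on V"
    "\<And>z. z \<in> ball 0 1 \<Longrightarrow> j z \<in> V \<and> f (j z) = z"
    "\<And>w. w \<in> V \<Longrightarrow> f w \<in> ball 0 1 \<and> j (f w) = w"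
    "j 0 = w0" "norm p = 1" "norm q = 1" "norm c = 1"
    "\<And>z. z \<in> ball 0 1 \<Longrightarrow> 0 \<le> Im (c / (deriv j z * (1 - cnj p * z) * (1 - cnj q * z)))"
proof -
  obtain j f where jf: "j holomorphic_on ball 0 1" "f holomorphic_on V"
    "\<And>z. z \<in> ball 0 1 \<Longrightarrow> j z \<in> V \<and> f (j z) = z"
    "\<And>w. w \<in> V \<Longrightarrow> f w \<in> ball 0 1 \<and> j (f w) = w" "j 0 = w0"
    using Riemann_map[OF w0] by blast
  have VT: "w + \<i> * T \<in> V" "w - \<i> * T \<in> V" if "w \<in> V" for w
    using V_shift[of w 1] V_shift[of w "-1"] that by simp_all
  define s where "s = (\<lambda>z. f (j z + \<i> * T))"
  define t where "t = (\<lambda>z. f (j z - \<i> * T))"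
  have sb: "s z \<in> ball 0 1" "j (s z) = j z + \<i> * T" and tb: "t z \<in> ball 0 1" "j (t z) = j z - \<i> * T"
    if "z \<in> ball 0 1" for z
    using jf(3)[OF that] VT jf(4) unfolding s_def t_def by blast+
  have s_hol: "s holomorphic_on ball 0 1" and t_hol: "t holomorphic_on ball 0 1"
  proof -
    have "(\<lambda>z. j z + \<i> * T) ` ball 0 1 \<subseteq> V" "(\<lambda>z. j z - \<i> * T) ` ball 0 1 \<subseteq> V"
      using jf(3) VT by blast+
    then have "(f \<circ> (\<lambda>z. j z + \<i> * T)) holomorphic_on ball 0 1" "(f \<circ> (\<lambda>z. j z - \<i> * T)) holomorphic_on ball 0 1"
      by (auto intro!: holomorphic_on_compose_gen[OF _ jf(2)] holomorphic_intros jf(1))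
    then show "s holomorphic_on ball 0 1" "t holomorphic_on ball 0 1" by (simp_all add: s_def t_def o_def)
  qed
  have st: "s (t z) = z" "t (s z) = z" if "z \<in> ball 0 1" for z
    using sb(2)[OF tb(1)[OF that]] tb(2)[OF sb(1)[OF that]] tb(2)[OF that] sb(2)[OF that] jf(3)[OF that]
      jf(3)[OF sb(1)[OF tb(1)[OF that]]] jf(3)[OF tb(1)[OF sb(1)[OF that]]] by simp_all
  obtain a c where ac: "norm a < 1" "norm c = 1" "\<And>z. z \<in> ball 0 1 \<Longrightarrow> s z = c * (z - a) / (1 - cnj a * z)"
    using ball_automorphism_form[OF s_hol _ t_hol _ st] sb(1) tb(1) by (metis image_subsetI)
  have nofix: "s z \<noteq> z" if "z \<in> ball 0 1" for z using sb(2)[OF that] T by auto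
  obtain p q where pq: "norm p = 1" "norm q = 1" "c + p * cnj a \<noteq> 0" "c + q * cnj a \<noteq> 0"
    and ps: "\<And>z. z \<in> ball 0 1 \<Longrightarrow> p - s z = (c + p * cnj a) * (p - z) / (1 - cnj a * z)"
    and qs: "\<And>z. z \<in> ball 0 1 \<Longrightarrow> q - s z = (c + q * cnj a) * (q - z) / (1 - cnj a * z)"
    and sum: "cnj a * (p + q) = 1 - c"
    using ball_automorphism_fixed_points[OF ac nofix] by metis
  have pz: "p - z \<noteq> 0" "q - z \<noteq> 0" "1 - cnj a * z \<noteq> 0" if "z \<in> ball 0 1" for z
  proof -
    show "p - z \<noteq> 0" "q - z \<noteq> 0" using that pq(1,2) by auto
    have "norm (cnj a * z) < 1" using that ac(1) norm_mult_less[of "cnj a" 1 z 1] by simp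
    then show "1 - cnj a * z \<noteq> 0" by force
  qed
  \<comment> \<open>A double fixed point makes \<open>s\<close> a translation in the coordinate
    \<open>p / (p - z)\<close>, the parabolic case.\<close>
  have "p \<noteq> q"
  proof
    assume "p = q"
    then have c2: "c + p * cnj a = 1 - cnj a * p" using sum by (simp add: algebra_simps)
    have "p / (p - s z) = p / (p - z) + p * cnj a / (c + p * cnj a)" if z: "z \<in> ball 0 1" for z
    proof -
      have "(1 - cnj a * z) = (c + p * cnj a) + cnj a * (p - z)" unfolding c2 by (simp add: algebra_simps)
      moreover have "p * (\<kappa> + cnj a * x) / (\<kappa> * x) = p / x + p * cnj a / \<kappa>" if "\<kappa> \<noteq> 0" "x \<noteq> 0" for x \<kappa>
        using that by (simp add: field_simps)
      moreover have "p / (p - s z) = p * (1 - cnj a * z) / ((c + p * cnj a) * (p - z))"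
        unfolding ps[OF z] by simp
      ultimately show ?thesis using pz[OF z] pq(3) by metis
    qed
    then show False
      using not_parabolic[OF jf(1) _ _ pq(1), of s] jf(3) sb by metis
  qed
  from strip_map[OF pq(1,2) this] obtain \<phi> Xi where
    \<phi>': "\<And>z. z \<in> ball 0 1 \<Longrightarrow> (\<phi> has_field_derivative (cnj q - cnj p) / ((1 - cnj p * z) * (1 - cnj q * z))) (at z)"
    and \<phi>strip: "\<And>z. z \<in> ball 0 1 \<Longrightarrow> \<bar>Im (\<phi> z)\<bar> < pi / 2"
    and Xi\<phi>: "\<And>z. z \<in> ball 0 1 \<Longrightarrow> Xi (\<phi> z) = z"
    and \<phi>Xi: "\<And>\<zeta>. \<bar>Im \<zeta>\<bar> < pi / 2 \<Longrightarrow> Xi \<zeta> \<in> ball 0 1 \<and> \<phi> (Xi \<zeta>) = \<zeta>"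
    and contXi: "continuous_on {\<zeta>. \<bar>Im \<zeta>\<bar> < pi / 2} Xi"
    and exp\<phi>: "\<And>z. z \<in> ball 0 1 \<Longrightarrow> exp (\<phi> z) = (1 - cnj q * p) * ((1 - cnj p * z) / (1 - cnj q * z))"
    by blast
  have \<phi>hol: "\<phi> holomorphic_on ball 0 1" using \<phi>' holomorphic_on_open by blast
  have pp: "cnj p * p = 1" "cnj q * q = 1"
    using complex_norm_square[of p] complex_norm_square[of q] pq(1,2) by (simp_all add: mult.commute)
  \<comment> \<open>\<open>exp (\<phi> z)\<close> is a constant times
    \<open>(p - z) / (q - z)\<close>, and \<open>s\<close> multiplies this quotient by
    \<open>K\<close>.\<close>
  define K where "K = (c + p * cnj a) / (c + q * cnj a)"
  define \<delta> where "\<delta> = (\<lambda>z. \<phi> (s z) - \<phi> z)"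
  have exp\<delta>: "exp (\<delta> z) = K" if z: "z \<in> ball 0 1" for z
  proof -
    have e: "exp (\<phi> z) = (1 - cnj q * p) * (cnj p * (p - z) / (cnj q * (q - z)))" if "z \<in> ball 0 1" for z
      using exp\<phi>[OF that] pp by (simp add: right_diff_distrib)
    have "exp (\<phi> (s z)) = K * exp (\<phi> z)"
      unfolding e[OF z] e[OF sb(1)[OF z]] ps[OF z] qs[OF z] K_def using pz[OF z] pq by (simp add: mult_ac)
    then show ?thesis by (simp add: \<delta>_def exp_diff)
  qed
  have \<delta>hol: "\<delta> holomorphic_on ball 0 1"
  proof -
    have "s ` ball 0 1 \<subseteq> ball 0 1" using sb(1) by blast
    then have "(\<phi> \<circ> s) holomorphic_on ball 0 1" by (rule holomorphic_on_compose_gen[OF s_hol \<phi>hol])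
    then show ?thesis unfolding \<delta>_def o_def by (intro holomorphic_intros \<phi>hol)
  qed
  obtain \<tau> where \<tau>: "\<And>z. z \<in> ball 0 1 \<Longrightarrow> \<delta> z = \<tau>"
    using constant_of_exp_constant[OF \<delta>hol, of K] exp\<delta> by blast
  then have step: "\<phi> (s z) = \<phi> z + \<tau>" if "z \<in> ball 0 1" for z using that by (simp add: \<delta>_def diff_eq_eq)
  have iter: "(s ^^ n) 0 \<in> ball 0 1 \<and> \<phi> ((s ^^ n) 0) = \<phi> 0 + of_nat n * \<tau>" for n
    by (induction n) (use sb(1) step in \<open>auto simp: algebra_simps simp del: mem_ball\<close>)
  \<comment> \<open>Iterates of \<open>s\<close> shift \<open>\<phi>\<close> by multiples of
    \<open>\<tau>\<close>, and the strip has finite height.\<close>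
  have "Im \<tau> = 0"
  proof (rule ccontr)
    assume "Im \<tau> \<noteq> 0"
    then obtain n :: nat where n: "pi < of_nat n * \<bar>Im \<tau>\<bar>" using reals_Archimedean3[of "\<bar>Im \<tau>\<bar>"] by auto
    have "\<bar>Im (\<phi> 0) + of_nat n * Im \<tau>\<bar> < pi / 2" using iter[of n] \<phi>strip[of "(s ^^ n) 0"] by simp
    moreover have "\<bar>Im (\<phi> 0)\<bar> < pi / 2" using \<phi>strip[of 0] by simp
    ultimately have "\<bar>of_nat n * Im \<tau>\<bar> < pi" by linarith
    then show False using n by (simp add: abs_mult)
  qed
  then have \<tau>R: "\<tau> = of_real (Re \<tau>)" by (simp add: complex_eq_iff)
  have \<tau>0: "Re \<tau> \<noteq> 0"
  proof
    assume "Re \<tau> = 0"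
    then have "\<phi> (s 0) = \<phi> 0" using step[of 0] \<tau>R by simp
    then have "s 0 = 0" using Xi\<phi>[of 0] Xi\<phi>[OF sb(1), of 0] by simp
    then show False using nofix[of 0] by simp
  qed
  have fV: "f ` V \<subseteq> ball 0 1" using jf(4) by blast
  interpret periodic_strip_map l r T "\<phi> \<circ> f" "j \<circ> Xi" "Re \<tau>"
  proof
    show "(\<phi> \<circ> f) holomorphic_on V" by (rule holomorphic_on_compose_gen[OF jf(2) \<phi>hol fV])
    show "\<bar>Im ((\<phi> \<circ> f) w)\<bar> < pi / 2" "(j \<circ> Xi) ((\<phi> \<circ> f) w) = w" if "w \<in> V" for w
      using jf(4)[OF that] \<phi>strip Xi\<phi> by simp_all
    show "(j \<circ> Xi) \<zeta> \<in> V \<and> (\<phi> \<circ> f) ((j \<circ> Xi) \<zeta>) = \<zeta>" if "\<bar>Im \<zeta>\<bar> < pi / 2" for \<zeta>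
      using \<phi>Xi[OF that] jf(3) by simp
    have "Xi ` {\<zeta>. \<bar>Im \<zeta>\<bar> < pi / 2} \<subseteq> ball 0 1" using \<phi>Xi by blast
    then show "continuous_on {\<zeta>. \<bar>Im \<zeta>\<bar> < pi / 2} (j \<circ> Xi)"
      by (intro continuous_on_compose contXi continuous_on_subset[OF holomorphic_on_imp_continuous_on[OF jf(1)]])
    show "(\<phi> \<circ> f) (w + \<i> * T) = (\<phi> \<circ> f) w + of_real (Re \<tau>)" if "w \<in> V" for w
      using step[of "f w"] jf(4)[OF that] \<tau>R by (simp add: s_def)
    show "Re \<tau> \<noteq> 0" by (rule \<tau>0)
  qed
  obtain sg :: real where sg: "sg = 1 \<or> sg = - 1" "\<And>w. w \<in> V \<Longrightarrow> 0 \<le> sg * Im (deriv (\<phi> \<circ> f) w)"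
    using Im_deriv_sign by blast
  \<comment> \<open>The numerator of the derivative of \<open>\<phi>\<close>, normalised and
    carrying the sign \<open>sg\<close>.\<close>
  define e where "e = of_real sg * (cnj q - cnj p) / of_real (norm (q - p))"
  have nqp: "norm (q - p) > 0" using \<open>p \<noteq> q\<close> by simp
  have ne: "norm e = 1"
  proof -
    have "norm (cnj q - cnj p) = norm (q - p)" by (metis complex_cnj_diff complex_mod_cnj)
    then show ?thesis using sg(1) nqp by (auto simp: e_def norm_mult norm_divide)
  qed
  have pos: "0 \<le> Im (e / (deriv j z * (1 - cnj p * z) * (1 - cnj q * z)))" if z: "z \<in> ball 0 1" for z
  proof -
    have jz: "j z \<in> V" "f (j z) = z" using jf(3)[OF z] by auto
    have dj: "(j has_field_derivative deriv j z) (at z)" by (rule holomorphic_derivI[OF jf(1) open_ball z])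
    have df: "(f has_field_derivative deriv f (j z)) (at (j z))" by (rule holomorphic_derivI[OF jf(2) open_V jz(1)])
    have "((f \<circ> j) has_field_derivative deriv f (j z) * deriv j z) (at z)" by (rule DERIV_chain[OF df dj])
    moreover have "((f \<circ> j) has_field_derivative 1) (at z)"
      by (rule has_field_derivative_transform_within_open[OF DERIV_ident open_ball z]) (use jf(3) in auto)
    ultimately have one: "deriv f (j z) * deriv j z = 1" by (rule DERIV_unique)
    then have inv: "deriv f (j z) = 1 / deriv j z" by (metis mult_zero_right nonzero_eq_divide_eq zero_neq_one)
    have "((\<phi> \<circ> f) has_field_derivative ((cnj q - cnj p) / ((1 - cnj p * z) * (1 - cnj q * z))) * deriv f (j z)) (at (j z))"
      using \<phi>'[OF z] jz(2) by (intro DERIV_chain df) simp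
    then have "deriv (\<phi> \<circ> f) (j z) = ((cnj q - cnj p) / ((1 - cnj p * z) * (1 - cnj q * z))) * (1 / deriv j z)"
      using DERIV_imp_deriv inv by simp
    then have eq: "e / (deriv j z * (1 - cnj p * z) * (1 - cnj q * z)) = of_real (sg / norm (q - p)) * deriv (\<phi> \<circ> f) (j z)"
      by (simp add: e_def)
    have "Im (e / (deriv j z * (1 - cnj p * z) * (1 - cnj q * z))) = (sg * Im (deriv (\<phi> \<circ> f) (j z))) / norm (q - p)"
      unfolding eq by simp
    then show ?thesis using sg(2)[OF jz(1)] by simp
  qed
  show ?thesis by (rule that[OF jf pq(1,2) ne pos])
qed

section \<open>Shears of convex harmonic mappings\<close>

text \<open>Points that almost attain the infimum on two slices combine, by convexity of
  \<open>S\<close>, to a point on the slice between them. The lemma supplies continuity of the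
  boundary graphs, since convex functions on open intervals are continuous.\<close>

lemma convex_on_slice_inf:
  assumes S: "convex S" and I: "convex I"
    and ne: "\<And>y. y \<in> I \<Longrightarrow> \<exists>x. Complex x y \<in> S"
    and low: "\<And>x y. Complex x y \<in> S \<Longrightarrow> B \<le> x"
  shows "convex_on I (\<lambda>y. Inf {x. Complex x y \<in> S})"
proof (rule convex_onI)
  fix u y1 y2 :: real
  assume u: "0 < u" "u < 1" and y: "y1 \<in> I" "y2 \<in> I"
  define L where "L = (\<lambda>y. Inf {x. Complex x y \<in> S})"
  have bdd: "bdd_below {x. Complex x y \<in> S}" for y using low by (intro bdd_belowI[of _ B]) auto
  have "L ((1 - u) *\<^sub>R y1 + u *\<^sub>R y2) \<le> ((1 - u) * L y1 + u * L y2) + e" if e: "e > 0" for e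
  proof -
    have ex: "\<exists>x. Complex x y \<in> S \<and> x < L y + e" if "y \<in> I" for y
    proof -
      have "Inf {x. Complex x y \<in> S} < L y + e" using e by (simp add: L_def)
      then show ?thesis using cInf_less_iff[OF _ bdd, of y "L y + e"] ne[OF that] by blast
    qed
    obtain x1 x2 where x: "Complex x1 y1 \<in> S" "x1 < L y1 + e" "Complex x2 y2 \<in> S" "x2 < L y2 + e"
      using ex[OF y(1)] ex[OF y(2)] by blast
    have "(1 - u) *\<^sub>R Complex x1 y1 + u *\<^sub>R Complex x2 y2 \<in> S"
      using u x by (intro convexD_alt[OF S]) auto
    moreover have "(1 - u) *\<^sub>R Complex x1 y1 + u *\<^sub>R Complex x2 y2 = Complex ((1 - u) * x1 + u * x2) ((1 - u) *\<^sub>R y1 + u *\<^sub>R y2)"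
      by (simp add: complex_eq_iff)
    ultimately have "L ((1 - u) *\<^sub>R y1 + u *\<^sub>R y2) \<le> (1 - u) * x1 + u * x2"
      unfolding L_def by (intro cInf_lower bdd) simp
    also have "\<dots> \<le> (1 - u) * (L y1 + e) + u * (L y2 + e)"
      using u x by (intro add_mono mult_left_mono) auto
    finally show ?thesis by (simp add: algebra_simps)
  qed
  then show "L ((1 - u) *\<^sub>R y1 + u *\<^sub>R y2) \<le> (1 - u) * L y1 + u * L y2"
    by (rule field_le_epsilon)
qed (rule I)

text \<open>The graphs bound the horizontal slices of a neighbourhood \<open>S\<close> of the convex
  hull of \<open>K\<close>. It is open and convex with closure inside \<open>\<Omega>\<close>, so
  closed slices stay in \<open>\<Omega>\<close>, and the graphs are continuous as a convex and a
  concave function.\<close>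

lemma convex_slices_between:
  fixes \<Omega> K :: "complex set"
  assumes \<Omega>: "open \<Omega>" "convex \<Omega>" and K: "compact K" "K \<subseteq> \<Omega>" "K \<noteq> {}"
  obtains \<eta> c1 d1 L R where "\<eta> > 0" "c1 \<le> d1"
    "continuous_on {c1 - \<eta>..d1 + \<eta>} L" "continuous_on {c1 - \<eta>..d1 + \<eta>} R"
    "\<And>y. y \<in> {c1 - \<eta>..d1 + \<eta>} \<Longrightarrow> L y < R y"
    "\<And>x y. \<lbrakk>y \<in> {c1 - \<eta>..d1 + \<eta>}; L y \<le> x; x \<le> R y\<rbrakk> \<Longrightarrow> Complex x y \<in> \<Omega>"
    "\<And>p. p \<in> K \<Longrightarrow> c1 \<le> Im p \<and> Im p \<le> d1 \<and> L (Im p) < Re p \<and> Re p < R (Im p)"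
proof -
  define K' where "K' = convex hull K"
  have K': "compact K'" "convex K'" "K' \<subseteq> \<Omega>" "K \<subseteq> K'"
    unfolding K'_def using compact_convex_hull[OF K(1)] hull_minimal[of K \<Omega> convex, OF K(2) \<Omega>(2)]
    by (simp_all add: hull_subset)
  obtain \<delta>2 where \<delta>2: "\<delta>2 > 0" "(\<Union>x\<in>K'. ball x \<delta>2) \<subseteq> \<Omega>"
    using compact_subset_open_imp_ball_epsilon_subset[OF K'(1) \<Omega>(1) K'(3)] by blast
  define \<delta> where "\<delta> = \<delta>2 / 2"
  have \<delta>: "\<delta> > 0" using \<delta>2 by (simp add: \<delta>_def)
  define S where "S = (\<Union>x\<in>K'. ball x \<delta>)"
  note S_alt = S_def
  have "convex S"
  proof (rule convexI)
    fix x y and u v :: real assume xy: "x \<in> S" "y \<in> S" and uv: "0 \<le> u" "0 \<le> v" "u + v = 1"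
    obtain a where a: "a \<in> K'" "norm (x - a) < \<delta>" using xy(1) unfolding S_def by (auto simp: dist_norm norm_minus_commute)
    obtain b where b: "b \<in> K'" "norm (y - b) < \<delta>" using xy(2) unfolding S_def by (auto simp: dist_norm norm_minus_commute)
    have "(u *\<^sub>R x + v *\<^sub>R y) - (u *\<^sub>R a + v *\<^sub>R b) = u *\<^sub>R (x - a) + v *\<^sub>R (y - b)" by (simp add: algebra_simps)
    then have "norm ((u *\<^sub>R x + v *\<^sub>R y) - (u *\<^sub>R a + v *\<^sub>R b)) \<le> u * norm (x - a) + v * norm (y - b)"
      using norm_triangle_ineq[of "u *\<^sub>R (x - a)" "v *\<^sub>R (y - b)"] uv by simp
    also have "\<dots> < \<delta>" by (rule convex_bound_lt[OF a(2) b(2) uv])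
    finally have "u *\<^sub>R x + v *\<^sub>R y \<in> ball (u *\<^sub>R a + v *\<^sub>R b) \<delta>" by (simp add: dist_norm norm_minus_commute)
    moreover have "u *\<^sub>R a + v *\<^sub>R b \<in> K'" by (rule convexD[OF K'(2) a(1) b(1) uv])
    ultimately show "u *\<^sub>R x + v *\<^sub>R y \<in> S" unfolding S_def by blast
  qed
  have "open S" unfolding S_alt by auto
  have KS: "K \<subseteq> S" unfolding S_alt using K'(4) \<delta> by fastforce
  have clS: "closure S \<subseteq> \<Omega>"
  proof
    fix w assume "w \<in> closure S"
    then obtain v where v: "v \<in> S" "dist v w < \<delta>" using \<delta> closure_approachable by blast
    then obtain x where x: "x \<in> K'" "dist x v < \<delta>" unfolding S_alt by auto
    then have "dist x w < \<delta>2" using v(2) dist_triangle[of x w v] unfolding \<delta>_def by linarith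
    then have "w \<in> (\<Union>x\<in>K'. ball x \<delta>2)" using x(1) by auto
    then show "w \<in> \<Omega>" using \<delta>2(2) by blast
  qed
  have "bounded K'" using K'(1) compact_imp_bounded by blast
  then obtain B0 where B0: "\<And>x. x \<in> K' \<Longrightarrow> norm x \<le> B0" using bounded_iff by blast
  define B where "B = B0 + \<delta>"
  have SB: "norm w \<le> B" if w: "w \<in> S" for w
  proof -
    obtain x where x: "x \<in> K'" "dist x w < \<delta>" using w unfolding S_alt by auto
    have "norm w \<le> norm x + dist x w" by (simp add: dist_norm norm_minus_commute norm_triangle_sub)
    then show ?thesis using B0[OF x(1)] x(2) by (simp add: B_def)
  qed
  obtain plo where plo: "plo \<in> K" "\<And>p. p \<in> K \<Longrightarrow> Im plo \<le> Im p"
    using continuous_attains_inf[OF K(1,3) continuous_on_Im[OF continuous_on_id]] by blast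
  obtain phi where phi: "phi \<in> K" "\<And>p. p \<in> K \<Longrightarrow> Im p \<le> Im phi"
    using continuous_attains_sup[OF K(1,3) continuous_on_Im[OF continuous_on_id]] by blast
  define c1 where "c1 = Im plo"
  define d1 where "d1 = Im phi"
  \<comment> \<open>Continuity of the graphs is obtained on an open interval. It overshoots the
    levels of \<open>K\<close> by \<open>2 / 3 * \<delta>\<close>: less than
    \<open>\<delta>\<close>, so that slices of \<open>S\<close> are nonempty, and more than the
    final margin \<open>\<delta> / 2\<close>.\<close>
  define I where "I = {c1 - 2 / 3 * \<delta> <..< d1 + 2 / 3 * \<delta>}"
  have cd: "c1 \<le> d1" using plo phi by (simp add: c1_def d1_def)
  have slice: "\<exists>x. Complex x y \<in> S" if y: "y \<in> I" for y
  proof -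
    have "plo - \<i> * of_real (2 / 3 * \<delta>) \<in> ball plo \<delta>" "phi + \<i> * of_real (2 / 3 * \<delta>) \<in> ball phi \<delta>"
      using \<delta> by (simp_all add: dist_norm norm_mult)
    then have "plo - \<i> * of_real (2 / 3 * \<delta>) \<in> S" "phi + \<i> * of_real (2 / 3 * \<delta>) \<in> S"
      unfolding S_alt using plo(1) phi(1) K'(4) by blast+
    then have ends: "c1 - 2 / 3 * \<delta> \<in> Im ` S" "d1 + 2 / 3 * \<delta> \<in> Im ` S" by (force simp: c1_def d1_def)+
    have "connected (Im ` S)"
      using \<open>convex S\<close> by (intro connected_continuous_image convex_connected continuous_intros)
    from connectedD_interval[OF this ends] have "y \<in> Im ` S" using y by (simp add: I_def)
    then obtain w where "w \<in> S" "y = Im w" by auto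
    then show ?thesis by (intro exI[of _ "Re w"]) simp
  qed
  define L where "L = (\<lambda>y. Inf {x. Complex x y \<in> S})"
  \<comment> \<open>Reflection in the imaginary axis makes the right graph a slice infimum as
    well.\<close>
  define S' where "S' = {w. Complex (- Re w) (Im w) \<in> S}"
  define R where "R = (\<lambda>y. - Inf {x. Complex x y \<in> S'})"
  have "convex S'"
  proof (rule convexI)
    fix x y and u v :: real assume xy: "x \<in> S'" "y \<in> S'" "0 \<le> u" "0 \<le> v" "u + v = 1"
    then have "u *\<^sub>R Complex (- Re x) (Im x) + v *\<^sub>R Complex (- Re y) (Im y) \<in> S"
      by (intro convexD[OF \<open>convex S\<close>]) (auto simp: S'_def)
    moreover have "u *\<^sub>R Complex (- Re x) (Im x) + v *\<^sub>R Complex (- Re y) (Im y)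
        = Complex (- Re (u *\<^sub>R x + v *\<^sub>R y)) (Im (u *\<^sub>R x + v *\<^sub>R y))" by (simp add: complex_eq_iff)
    ultimately show "u *\<^sub>R x + v *\<^sub>R y \<in> S'" by (simp add: S'_def)
  qed
  have S'iff: "Complex x y \<in> S' \<longleftrightarrow> Complex (- x) y \<in> S" for x y by (simp add: S'_def)
  have lowS: "- B \<le> x" if "Complex x y \<in> S" for x y
    using SB[OF that] abs_Re_le_cmod[of "Complex x y"] by simp
  have upS: "x \<le> B" if "Complex x y \<in> S" for x y
    using SB[OF that] abs_Re_le_cmod[of "Complex x y"] by simp
  have slice': "\<exists>x. Complex x y \<in> S'" if "y \<in> I" for y
    using slice[OF that] S'iff by (metis minus_minus)
  have lowS': "- B \<le> x" if "Complex x y \<in> S'" for x y using that upS S'iff by fastforce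
  have bdd: "bdd_below {x. Complex x y \<in> S}" "bdd_below {x. Complex x y \<in> S'}" for y
    using lowS lowS' by (auto intro!: bdd_belowI[of _ "- B"])
  have Iop: "convex I" "open I" by (auto simp: I_def)
  have contL: "continuous_on I L"
    unfolding L_def by (intro convex_on_continuous Iop convex_on_slice_inf[OF \<open>convex S\<close> Iop(1) slice lowS])
  have contR: "continuous_on I R"
    unfolding R_def by (intro continuous_on_minus convex_on_continuous Iop convex_on_slice_inf[OF \<open>convex S'\<close> Iop(1) slice' lowS'])
  have le: "L y \<le> x" "x \<le> R y" if "Complex x y \<in> S" for x y
  proof -
    show "L y \<le> x" unfolding L_def using bdd that by (intro cInf_lower) auto
    have "Inf {x. Complex x y \<in> S'} \<le> - x" using bdd(2) that S'iff by (intro cInf_lower) auto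
    then show "x \<le> R y" by (simp add: R_def)
  qed
  have strict: "L y < x" "x < R y" if xS: "Complex x y \<in> S" for x y
  proof -
    obtain e where e: "e > 0" "ball (Complex x y) e \<subseteq> S" using \<open>open S\<close> xS openE by blast
    have "Complex (x - e / 2) y = Complex x y - of_real (e / 2)" "Complex (x + e / 2) y = Complex x y + of_real (e / 2)"
      by (simp_all add: complex_eq_iff)
    then have "Complex (x - e / 2) y \<in> ball (Complex x y) e" "Complex (x + e / 2) y \<in> ball (Complex x y) e"
      using e(1) by (simp_all add: dist_norm)
    then have "Complex (x - e / 2) y \<in> S" "Complex (x + e / 2) y \<in> S" using e(2) by blast+
    then show "L y < x" "x < R y" using le[of "x - e / 2" y] le[of "x + e / 2" y] e(1) by linarith+
  qed
  have mid: "Complex x y \<in> S" if y: "y \<in> I" and x: "L y < x" "x < R y" for x y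
  proof -
    obtain x1 where x1: "Complex x1 y \<in> S" "x1 < x"
      using x(1) cInf_less_iff[OF _ bdd(1), of y x] slice[OF y] unfolding L_def by blast
    have "Inf {x. Complex x y \<in> S'} < - x" using x(2) by (simp add: R_def)
    then obtain x2 where x2: "Complex x2 y \<in> S'" "x2 < - x"
      using cInf_less_iff[OF _ bdd(2), of y "- x"] slice'[OF y] by blast
    have conn: "connected {x. Complex x y \<in> S}"
    proof -
      have "convex {x. Complex x y \<in> S}"
      proof (rule convexI)
        fix a b u v :: real assume ab: "a \<in> {x. Complex x y \<in> S}" "b \<in> {x. Complex x y \<in> S}" "0 \<le> u" "0 \<le> v" "u + v = 1"
        then have "u *\<^sub>R Complex a y + v *\<^sub>R Complex b y \<in> S" by (intro convexD[OF \<open>convex S\<close>]) auto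
        moreover have "u *\<^sub>R Complex a y + v *\<^sub>R Complex b y = Complex (u *\<^sub>R a + v *\<^sub>R b) y"
          using ab(5) by (simp add: complex_eq_iff flip: distrib_right)
        ultimately show "u *\<^sub>R a + v *\<^sub>R b \<in> {x. Complex x y \<in> S}" by simp
      qed
      then show ?thesis by (rule convex_connected)
    qed
    have "x1 \<in> {x. Complex x y \<in> S}" "- x2 \<in> {x. Complex x y \<in> S}" using x1 x2 S'iff by auto
    from connectedD_interval[OF conn this, of x] show ?thesis using x1 x2 by simp
  qed
  have LR: "L y < R y" if "y \<in> I" for y using slice[OF that] strict by (meson less_trans)
  have closedslice: "Complex x y \<in> \<Omega>" if y: "y \<in> I" and x: "L y \<le> x" "x \<le> R y" for x y
  proof -
    have "x \<in> closure {L y<..<R y}" using LR[OF y] x by (simp add: closure_greaterThanLessThan)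
    moreover have "(\<lambda>x. Complex x y) ` closure {L y<..<R y} \<subseteq> closure ((\<lambda>x. Complex x y) ` {L y<..<R y})"
      by (intro continuous_image_closure_subset[of UNIV] continuous_on_Complex continuous_intros) auto
    moreover have "(\<lambda>x. Complex x y) ` {L y<..<R y} \<subseteq> S" using mid[OF y] by auto
    ultimately have "Complex x y \<in> closure S" using closure_mono by blast
    then show ?thesis using clS by blast
  qed
  have sub: "{c1 - \<delta> / 2..d1 + \<delta> / 2} \<subseteq> I" unfolding I_def using \<delta> by auto
  show ?thesis
  proof (rule that[of "\<delta> / 2" c1 d1 L R])
    show "c1 \<le> Im p \<and> Im p \<le> d1 \<and> L (Im p) < Re p \<and> Re p < R (Im p)" if "p \<in> K" for p
      using plo(2) phi(2) strict[of "Re p" "Im p"] KS that by (auto simp: c1_def d1_def)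
  qed (use \<delta> cd contL contR sub LR closedslice in \<open>auto intro: continuous_on_subset\<close>)
qed

text \<open>A triangle wave, in the form \<open>arccos (cos x)\<close>. Composition with it extends
  a continuous function on \<open>{c..d}\<close> to a continuous periodic one by reflection at both
  ends.\<close>

lemma reflection_wave:
  fixes c d :: real
  assumes "c < d"
  obtains g where "continuous_on UNIV g" "\<And>y. g (y + 2 * (d - c)) = g y" "\<And>y. g y \<in> {c..d}"
    "\<And>y. y \<in> {c..d} \<Longrightarrow> g y = y"
proof -
  define k where "k = pi / (d - c)"
  have k: "k > 0" "k * (d - c) = pi" using assms by (simp_all add: k_def)
  define g where "g = (\<lambda>y. c + arccos (cos (k * (y - c))) / k)"
  have "continuous_on UNIV g"
    unfolding g_def by (intro continuous_intros continuous_on_arccos) (use k in auto)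
  moreover have "g (y + 2 * (d - c)) = g y" for y
  proof -
    have "k * (y + 2 * (d - c) - c) = k * (y - c) + 2 * (k * (d - c))" by (simp add: algebra_simps)
    then show ?thesis by (simp add: g_def k(2))
  qed
  moreover have "g y \<in> {c..d}" for y
  proof -
    have "0 \<le> arccos (cos (k * (y - c)))" "arccos (cos (k * (y - c))) \<le> k * (d - c)"
      unfolding k(2) by (intro arccos_lbound arccos_ubound; simp)+
    then show ?thesis using k(1) by (simp add: g_def field_simps)
  qed
  moreover have "g y = y" if "y \<in> {c..d}" for y
  proof -
    have "0 \<le> k * (y - c)" "k * (y - c) \<le> k * (d - c)" using that k(1) by auto
    then show ?thesis using k by (simp add: g_def arccos_cos)
  qed
  ultimately show ?thesis using that by blast
qed

text \<open>Take a slightly shrunken convex part of the image of \<open>F\<close>, pinch it near its lowest and highest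
  level, shear it by \<open>k \<circ> F\<^sup>-\<^sup>1\<close> and reflect it repeatedly in those two levels.\<close>

lemma periodic_domain_approximation:
  fixes F k :: "complex \<Rightarrow> complex"
  assumes F: "continuous_on (ball 0 1) F" "inj_on F (ball 0 1)" "convex (F ` ball 0 1)"
    and k: "continuous_on (ball 0 1) k"
    and Im: "\<And>z. z \<in> ball 0 1 \<Longrightarrow> Im (k z) = Im (F z)"
    and Re: "\<And>z1 z2. \<lbrakk>z1 \<in> ball 0 1; z2 \<in> ball 0 1; Im (F z1) = Im (F z2); Re (F z1) < Re (F z2)\<rbrakk> \<Longrightarrow> Re (k z1) < Re (k z2)"
    and K: "compact K" "K \<subseteq> ball 0 1" "K \<noteq> {}" and \<epsilon>: "\<epsilon> > 0"
  obtains l r T c d where "periodic_domain l r T" "c < d"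
    "\<And>z. z \<in> K \<Longrightarrow> k z \<in> periodic_domain.V l r \<and> c < Im (k z) \<and> Im (k z) < d"
    "\<And>w. \<lbrakk>w \<in> periodic_domain.V l r; c \<le> Im w; Im w \<le> d\<rbrakk> \<Longrightarrow> w \<in> k ` ball 0 1"
    "r c - l c < \<epsilon>" "r d - l d < \<epsilon>"
proof -
  define \<Omega> where "\<Omega> = F ` ball 0 1"
  have op: "open \<Omega>" unfolding \<Omega>_def by (intro invariance_of_domain F open_ball)
  obtain Z where Z: "homeomorphism (ball 0 1) \<Omega> F Z"
    using invariance_of_domain_homeomorphism[OF open_ball F(1) _ F(2)] unfolding \<Omega>_def by blast
  have ZF: "Z (F z) = z" if "z \<in> ball 0 1" for z using Z that by (simp add: homeomorphism_def)
  have FZ: "F (Z w) = w" "Z w \<in> ball 0 1" if "w \<in> \<Omega>" for w using Z that by (auto simp: homeomorphism_def)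
  have contZ: "continuous_on \<Omega> Z" using Z by (simp add: homeomorphism_def)
  \<comment> \<open>\<open>M\<close> maps the convex image to the image of \<open>k\<close>,
    preserving horizontal levels and the order on each of them.\<close>
  define M where "M = k \<circ> Z"
  have contM: "continuous_on \<Omega> M"
    unfolding M_def using FZ by (intro continuous_on_compose contZ continuous_on_subset[OF k]) auto
  have ImM: "Im (M w) = Im w" if "w \<in> \<Omega>" for w using FZ[OF that] Im by (simp add: M_def)
  have ReM: "Re (M w1) < Re (M w2)" if "w1 \<in> \<Omega>" "w2 \<in> \<Omega>" "Im w1 = Im w2" "Re w1 < Re w2" for w1 w2
    using Re[of "Z w1" "Z w2"] FZ that by (simp add: M_def)
  have FK: "compact (F ` K)" "F ` K \<subseteq> \<Omega>" "F ` K \<noteq> {}"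
    using K F(1) by (auto simp: \<Omega>_def intro: compact_continuous_image continuous_on_subset)
  obtain \<eta> c1 d1 L R where \<eta>: "\<eta> > 0" "c1 \<le> d1"
    and contLR: "continuous_on {c1 - \<eta>..d1 + \<eta>} L" "continuous_on {c1 - \<eta>..d1 + \<eta>} R"
    and LR: "\<And>y. y \<in> {c1 - \<eta>..d1 + \<eta>} \<Longrightarrow> L y < R y"
    and slice: "\<And>x y. \<lbrakk>y \<in> {c1 - \<eta>..d1 + \<eta>}; L y \<le> x; x \<le> R y\<rbrakk> \<Longrightarrow> Complex x y \<in> \<Omega>"
    and inside: "\<And>p. p \<in> F ` K \<Longrightarrow> c1 \<le> Im p \<and> Im p \<le> d1 \<and> L (Im p) < Re p \<and> Re p < R (Im p)"
    using convex_slices_between[OF op _ FK] F(3) unfolding \<Omega>_def[symmetric] by metis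
  define c where "c = c1 - \<eta>"
  define d where "d = d1 + \<eta>"
  have cd: "c < d" using \<eta> by (simp add: c_def d_def)
  note contLR = contLR[folded c_def d_def] and LR = LR[folded c_def d_def] and slice = slice[folded c_def d_def]
  define l0 where "l0 = (\<lambda>y. Re (M (Complex (L y) y)))"
  define r0 where "r0 = (\<lambda>y. Re (M (Complex (R y) y)))"
  have ends: "Complex (L y) y \<in> \<Omega>" "Complex (R y) y \<in> \<Omega>" if "y \<in> {c..d}" for y
    using slice[OF that] LR[OF that] by auto
  have cont0: "continuous_on {c..d} l0" "continuous_on {c..d} r0"
    unfolding l0_def r0_def using ends
    by (intro continuous_intros continuous_on_compose2[OF contM] continuous_on_Complex contLR; auto)+
  have lr0: "l0 y < r0 y" if "y \<in> {c..d}" for y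
    unfolding l0_def r0_def using ends[OF that] LR[OF that] by (intro ReM) auto
  have "compact ((\<lambda>y. r0 y - l0 y) ` {c..d})"
    by (intro compact_continuous_image continuous_intros cont0 compact_Icc)
  then have "bounded ((\<lambda>y. r0 y - l0 y) ` {c..d})" by (rule compact_imp_bounded)
  then obtain B where "B > 0" "\<forall>x\<in>(\<lambda>y. r0 y - l0 y) ` {c..d}. norm x \<le> B" unfolding bounded_pos by blast
  then have B: "B > 0" "\<And>y. y \<in> {c..d} \<Longrightarrow> \<bar>r0 y - l0 y\<bar> \<le> B" by auto
  \<comment> \<open>The pinching factor: the widths at the levels \<open>c\<close> and
    \<open>d\<close> are multiplied by \<open>\<kappa>\<close>, and
    \<open>\<kappa> * B < \<epsilon>\<close>.\<close>
  define \<kappa> where "\<kappa> = min 1 (\<epsilon> / (2 * B))"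
  have \<kappa>: "0 < \<kappa>" "\<kappa> \<le> 1" "\<kappa> * B < \<epsilon>"
  proof -
    show "0 < \<kappa>" "\<kappa> \<le> 1" using \<epsilon> B by (auto simp: \<kappa>_def)
    have "\<kappa> * B \<le> \<epsilon> / (2 * B) * B" using B by (intro mult_right_mono) (auto simp: \<kappa>_def)
    then show "\<kappa> * B < \<epsilon>" using B(1) \<epsilon> by simp
  qed
  \<comment> \<open>Equal to 1 on the levels from \<open>c1\<close> to \<open>d1\<close> met by
    \<open>F\<close> on \<open>K\<close>, and down to \<open>\<kappa>\<close> at \<open>c\<close>
    and \<open>d\<close>.\<close>
  define \<sigma> where "\<sigma> = (\<lambda>y. max \<kappa> (1 - max 0 (max (c1 - y) (y - d1)) / \<eta>))"
  have \<sigma>: "0 < \<sigma> y" "\<sigma> y \<le> 1" for y using \<kappa> \<eta> by (auto simp: \<sigma>_def)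
  have \<sigma>1: "\<sigma> y = 1" if "c1 \<le> y" "y \<le> d1" for y using that \<kappa> by (simp add: \<sigma>_def)
  have \<sigma>cd: "\<sigma> c = \<kappa>" "\<sigma> d = \<kappa>" using \<eta> \<kappa> by (auto simp: \<sigma>_def c_def d_def)
  have cont\<sigma>: "continuous_on {c..d} \<sigma>" unfolding \<sigma>_def using \<eta> by (intro continuous_intros) auto
  define r1 where "r1 = (\<lambda>y. l0 y + \<sigma> y * (r0 y - l0 y))"
  have cont1: "continuous_on {c..d} r1" unfolding r1_def by (intro continuous_intros cont0 cont\<sigma>)
  have lr1: "l0 y < r1 y" "r1 y \<le> r0 y" if "y \<in> {c..d}" for y
  proof -
    show "l0 y < r1 y" using \<sigma>(1) lr0[OF that] by (simp add: r1_def)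
    have "\<sigma> y * (r0 y - l0 y) \<le> 1 * (r0 y - l0 y)" using \<sigma>(2) lr0[OF that] by (intro mult_right_mono) auto
    then show "r1 y \<le> r0 y" by (simp add: r1_def)
  qed
  obtain g where g: "continuous_on UNIV g" "\<And>y. g (y + 2 * (d - c)) = g y" "\<And>y. g y \<in> {c..d}"
    "\<And>y. y \<in> {c..d} \<Longrightarrow> g y = y" using reflection_wave[OF cd] by blast
  define l where "l = l0 \<circ> g"
  define r where "r = r1 \<circ> g"
  interpret periodic_domain l r "2 * (d - c)"
  proof
    have gUNIV: "g ` UNIV \<subseteq> {c..d}" using g(3) by blast
    show "continuous_on UNIV l" "continuous_on UNIV r" unfolding l_def r_def
      by (intro continuous_on_compose g(1) continuous_on_subset[OF cont0(1) gUNIV] continuous_on_subset[OF cont1 gUNIV])+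
    show "l y < r y" for y using lr1(1)[OF g(3)] by (simp add: l_def r_def)
    show "0 < 2 * (d - c)" using cd by simp
    show "l (y + 2 * (d - c)) = l y" "r (y + 2 * (d - c)) = r y" for y by (simp_all only: l_def r_def comp_def g(2))
  qed
  have V_iff: "w \<in> V \<longleftrightarrow> l0 (g (Im w)) < Re w \<and> Re w < r1 (g (Im w))" for w
    unfolding V_def unfolding l_def r_def by simp
  have neck: "r y - l y < \<epsilon>" if "y \<in> {c, d}" for y
  proof -
    have ycd: "y \<in> {c..d}" using that cd by auto
    have "r y - l y = \<kappa> * (r0 y - l0 y)" using that \<sigma>cd g(4)[OF ycd] by (auto simp: l_def r_def r1_def)
    also have "\<dots> \<le> \<kappa> * B" using B(2)[OF ycd] \<kappa>(1) by (intro mult_left_mono) auto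
    finally show ?thesis using \<kappa>(3) by simp
  qed
  have KV: "k z \<in> V \<and> c < Im (k z) \<and> Im (k z) < d" if z: "z \<in> K" for z
  proof -
    have zb: "z \<in> ball 0 1" using K(2) z by blast
    define y where "y = Im (F z)"
    have in1: "c1 \<le> y" "y \<le> d1" "L y < Re (F z)" "Re (F z) < R y" using inside[of "F z"] z by (auto simp: y_def)
    have ycd: "y \<in> {c..d}" using in1 \<eta> by (auto simp: c_def d_def)
    have Mz: "M (F z) = k z" using ZF[OF zb] by (simp add: M_def)
    have Fz: "F z \<in> \<Omega>" using zb by (simp add: \<Omega>_def)
    have "l0 y < Re (k z)" "Re (k z) < r0 y"
      unfolding l0_def r0_def Mz[symmetric] using ends[OF ycd] Fz in1 by (auto intro!: ReM simp: y_def)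
    then show ?thesis
      using \<sigma>1[OF in1(1,2)] g(4)[OF ycd] Im[OF zb] in1 \<eta> by (simp add: V_iff r1_def y_def c_def d_def)
  qed
  have Vk: "w \<in> k ` ball 0 1" if w: "w \<in> V" "c \<le> Im w" "Im w \<le> d" for w
  proof -
    define y where "y = Im w"
    have ycd: "y \<in> {c..d}" using w by (simp add: y_def)
    have between: "l0 y < Re w" "Re w < r0 y"
      using w(1) g(4)[OF ycd] lr1(2)[OF ycd] by (auto simp: V_iff y_def)
    have "continuous_on {L y..R y} (\<lambda>x. Re (M (Complex x y)))"
      using slice[OF ycd] by (intro continuous_intros continuous_on_compose2[OF contM] continuous_on_Complex) auto
    then obtain x where x: "L y \<le> x" "x \<le> R y" "Re (M (Complex x y)) = Re w"
      using IVT'[of "\<lambda>x. Re (M (Complex x y))" "L y" "Re w" "R y"] between LR[OF ycd]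
      unfolding l0_def r0_def by auto
    have "Complex x y \<in> \<Omega>" using slice[OF ycd] x by blast
    then have "M (Complex x y) = w" "Z (Complex x y) \<in> ball 0 1"
      using ImM[of "Complex x y"] x(3) FZ by (auto simp: complex_eq_iff y_def)
    then show ?thesis unfolding M_def by (metis comp_apply imageI)
  qed
  show ?thesis
    by (rule that[OF periodic_domain_axioms cd KV Vk]) (use neck in auto)
qed

text \<open>By the distortion estimate the conformal map of the periodic domain cannot leave the middle
  piece through the thin necks on a disk of radius \<open>\<rho>\<close>.\<close>

lemma approximate_rotation:
  fixes F k :: "complex \<Rightarrow> complex"
  assumes F: "continuous_on (ball 0 1) F" "inj_on F (ball 0 1)" "convex (F ` ball 0 1)"
    and k: "k holomorphic_on ball 0 1" "inj_on k (ball 0 1)"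
    and Im: "\<And>z. z \<in> ball 0 1 \<Longrightarrow> Im (k z) = Im (F z)"
    and Re: "\<And>z1 z2. \<lbrakk>z1 \<in> ball 0 1; z2 \<in> ball 0 1; Im (F z1) = Im (F z2); Re (F z1) < Re (F z2)\<rbrakk> \<Longrightarrow> Re (k z1) < Re (k z2)"
    and \<rho>: "1 / 2 \<le> \<rho>" "\<rho> < 1"
  obtains g p q c where "g holomorphic_on ball 0 1" "g 0 = 0" "\<And>z. norm z < 1 \<Longrightarrow> norm (g z) < 1"
    "\<rho>\<^sup>2 \<le> norm (deriv g 0)" "norm p = 1" "norm q = 1" "norm c = 1"
    "\<And>z. z \<in> ball 0 1 \<Longrightarrow> 0 \<le> Im (c * deriv g z / (deriv k (of_real \<rho> * z) * (1 - cnj p * g z) * (1 - cnj q * g z)))"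
proof -
  have openk: "open (k ` ball 0 (1 / 2))"
    by (rule open_mapping_thm3) (auto intro: holomorphic_on_subset[OF k(1)] inj_on_subset[OF k(2)])
  moreover have "k 0 \<in> k ` ball 0 (1 / 2)" by (rule imageI) simp
  ultimately obtain d0 where d0: "d0 > 0" "ball (k 0) d0 \<subseteq> k ` ball 0 (1 / 2)" using openE by blast
  \<comment> \<open>The distance that the distortion estimate guarantees between \<open>j z\<close>,
    \<open>norm z \<le> \<rho>\<close>, and any point outside \<open>V\<close>, given that
    \<open>V\<close> contains the disk of radius \<open>d0\<close> around
    \<open>k 0\<close>.\<close>
  define \<epsilon> where "\<epsilon> = d0 * (1 - \<rho>) powr (12 * pi)"
  have \<epsilon>: "\<epsilon> > 0" using d0 \<rho> by (simp add: \<epsilon>_def)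
  have K: "compact (cball 0 \<rho> :: complex set)" "cball 0 \<rho> \<subseteq> (ball 0 1 :: complex set)" "cball 0 \<rho> \<noteq> ({} :: complex set)"
    using \<rho> by auto
  have "\<exists>l r T c d. periodic_domain l r T \<and> c < d \<and>
      (\<forall>z\<in>cball 0 \<rho>. k z \<in> periodic_domain.V l r \<and> c < Im (k z) \<and> Im (k z) < d) \<and>
      (\<forall>w. w \<in> periodic_domain.V l r \<longrightarrow> c \<le> Im w \<longrightarrow> Im w \<le> d \<longrightarrow> w \<in> k ` ball 0 1) \<and>
      r c - l c < \<epsilon> \<and> r d - l d < \<epsilon>"
  proof (rule periodic_domain_approximation[OF F holomorphic_on_imp_continuous_on[OF k(1)] _ _ K \<epsilon>])
    show "\<And>z. z \<in> ball 0 1 \<Longrightarrow> Im (k z) = Im (F z)" by (rule Im)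
    show "\<And>z1 z2. \<lbrakk>z1 \<in> ball 0 1; z2 \<in> ball 0 1; Im (F z1) = Im (F z2); Re (F z1) < Re (F z2)\<rbrakk> \<Longrightarrow> Re (k z1) < Re (k z2)"
      by (rule Re)
  qed blast
  then obtain l r T c d where pd: "periodic_domain l r T" "c < d"
    "\<And>z. z \<in> cball 0 \<rho> \<Longrightarrow> k z \<in> periodic_domain.V l r \<and> c < Im (k z) \<and> Im (k z) < d"
    "\<And>w. \<lbrakk>w \<in> periodic_domain.V l r; c \<le> Im w; Im w \<le> d\<rbrakk> \<Longrightarrow> w \<in> k ` ball 0 1"
    "r c - l c < \<epsilon>" "r d - l d < \<epsilon>"
    by blast
  interpret periodic_domain l r T by (rule pd(1))
  have w0: "k 0 \<in> V" using pd(3)[of 0] \<rho> by simp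
  have d0V: "ball (k 0) d0 \<subseteq> V"
  proof
    fix w assume "w \<in> ball (k 0) d0"
    then obtain z where "z \<in> ball 0 (1 / 2)" "w = k z" using d0(2) by blast
    then show "w \<in> V" using pd(3)[of z] \<rho> by simp
  qed
  obtain j f p q e where jf: "j holomorphic_on ball 0 1" "f holomorphic_on V"
    "\<And>z. z \<in> ball 0 1 \<Longrightarrow> j z \<in> V \<and> f (j z) = z" "\<And>w. w \<in> V \<Longrightarrow> f w \<in> ball 0 1 \<and> j (f w) = w"
    "j 0 = k 0" and pq: "norm p = 1" "norm q = 1" and e: "norm e = 1"
    and pos: "\<And>z. z \<in> ball 0 1 \<Longrightarrow> 0 \<le> Im (e / (deriv j z * (1 - cnj p * z) * (1 - cnj q * z)))"
    using conformal_map_positivity[OF w0] by blast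
  have jinj: "inj_on j (ball 0 1)" by (rule inj_on_inverseI[of _ f]) (use jf(3) in blast)
  have jim: "j ` ball 0 1 \<subseteq> V" using jf(3) by blast
  have far: "\<epsilon> \<le> norm (j z - w)" if z: "norm z \<le> \<rho>" and w: "w \<notin> V" for z w
  proof -
    have "w \<notin> j ` ball 0 1" using jim w by blast
    then have "norm (j 0 - w) * (1 - norm z) powr (12 * pi) \<le> norm (j z - w)"
      using z \<rho> by (intro inj_dist_omitted_lower_bound[OF jf(1) jinj]) auto
    moreover have "d0 \<le> norm (j 0 - w)"
    proof (rule ccontr)
      assume "\<not> d0 \<le> norm (j 0 - w)"
      then have "w \<in> ball (k 0) d0" by (simp add: jf(5) dist_norm)
      then show False using d0V w by blast
    qed
    moreover have "(1 - \<rho>) powr (12 * pi) \<le> (1 - norm z) powr (12 * pi)" using z \<rho> by (intro powr_mono2) auto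
    ultimately show ?thesis unfolding \<epsilon>_def using d0(1)
      by (meson mult_mono norm_ge_zero order_trans powr_ge_zero)
  qed
  \<comment> \<open>On a thin level the end \<open>Complex (l y) y\<close> of the slice is omitted
    but nearer to \<open>j z\<close> than \<open>\<epsilon>\<close>.\<close>
  have neck: "Im (j z) \<noteq> y" if z: "norm z \<le> \<rho>" and y: "r y - l y < \<epsilon>" for z y
  proof
    assume eq: "Im (j z) = y"
    have "j z \<in> V" using jf(3) z \<rho> by simp
    then have b: "l y < Re (j z)" "Re (j z) < r y" using eq by (auto simp: V_def)
    have "Complex (l y) y \<notin> V" by (simp add: V_def)
    from far[OF z this] have "\<epsilon> \<le> norm (j z - Complex (l y) y)" .
    moreover have "j z - Complex (l y) y = of_real (Re (j z) - l y)" using eq by (simp add: complex_eq_iff)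
    then have "norm (j z - Complex (l y) y) = \<bar>Re (j z) - l y\<bar>" by (simp only: norm_of_real)
    ultimately show False using b y by simp
  qed
  have jk: "j z \<in> k ` ball 0 1" if z: "norm z \<le> \<rho>" for z
  proof -
    define I where "I = (\<lambda>z. Im (j z)) ` cball 0 \<rho>"
    have conn: "connected I" unfolding I_def
      using \<rho> by (intro connected_continuous_image continuous_intros holomorphic_on_imp_continuous_on
          holomorphic_on_subset[OF jf(1)]) (auto simp: convex_connected)
    have I: "Im (j 0) \<in> I" "Im (j z) \<in> I" using z \<rho> by (auto simp: I_def)
    have cdI: "y \<notin> I" if "r y - l y < \<epsilon>" for y
    proof
      assume "y \<in> I"
      then obtain x where "norm x \<le> \<rho>" "Im (j x) = y" unfolding I_def by auto
      then show False using neck[OF _ that] by blast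
    qed
    have b0: "c < Im (j 0)" "Im (j 0) < d" using pd(3)[of 0] jf(5) \<rho> by auto
    have "c \<le> Im (j z)"
    proof (rule ccontr)
      assume "\<not> ?thesis"
      then have "c \<in> I" using b0 by (intro connectedD_interval[OF conn I(2,1)]) auto
      then show False using cdI pd(5) by blast
    qed
    moreover have "Im (j z) \<le> d"
    proof (rule ccontr)
      assume "\<not> ?thesis"
      then have "d \<in> I" using b0 by (intro connectedD_interval[OF conn I]) auto
      then show False using cdI pd(6) by blast
    qed
    ultimately have "c \<le> Im (j z)" "Im (j z) \<le> d" by blast+
    then show ?thesis using pd(4)[of "j z"] jf(3)[of z] z \<rho> by simp
  qed
  obtain k' where k': "k' holomorphic_on (k ` ball 0 1)" "\<And>z. z \<in> ball 0 1 \<Longrightarrow> deriv k z * deriv k' (k z) = 1"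
    "\<And>z. z \<in> ball 0 1 \<Longrightarrow> k' (k z) = z"
    using holomorphic_has_inverse[OF k(1) open_ball k(2)] by metis
  have openkD: "open (k ` ball 0 1)" by (rule open_mapping_thm3[OF k(1) open_ball k(2)])
  have \<rho>b: "of_real \<rho> * z \<in> ball 0 1" "norm (of_real \<rho> * z) \<le> \<rho>" if "z \<in> ball 0 1" for z :: complex
  proof -
    have "norm (of_real \<rho> * z) = \<rho> * norm z" using \<rho> by (simp add: norm_mult)
    moreover have "\<rho> * norm z \<le> \<rho> * 1" using \<rho> that by (intro mult_left_mono) auto
    ultimately show "norm (of_real \<rho> * z) \<le> \<rho>" by simp
    then show "of_real \<rho> * z \<in> ball 0 1" using \<rho> by simp
  qed
  have dlin: "((\<lambda>z. of_real \<rho> * z) has_field_derivative of_real \<rho>) (at z)" for z :: complex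
    by (auto intro!: derivative_eq_intros)
  have one: "deriv f (j z) * deriv j z = 1" if z: "z \<in> ball 0 1" for z
  proof -
    have "((f \<circ> j) has_field_derivative deriv f (j z) * deriv j z) (at z)"
      using jf(3)[OF z] by (intro DERIV_chain holomorphic_derivI[OF jf(1) open_ball z] holomorphic_derivI[OF jf(2) open_V]) auto
    moreover have "((f \<circ> j) has_field_derivative 1) (at z)"
      by (rule has_field_derivative_transform_within_open[OF DERIV_ident open_ball z]) (use jf(3) in auto)
    ultimately show ?thesis by (rule DERIV_unique)
  qed
  \<comment> \<open>Two self-maps of the disk fixing 0, \<open>h\<close> and \<open>g\<close>,
    compare \<open>j\<close> with \<open>k\<close> in both orders. The Schwarz lemma for
    \<open>h\<close> bounds \<open>deriv j 0\<close> from above, and this bounds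
    \<open>deriv g 0\<close> from below.\<close>
  define h where "h = k' \<circ> j \<circ> (\<lambda>z. of_real \<rho> * z)"
  define g where "g = f \<circ> k \<circ> (\<lambda>z. of_real \<rho> * z)"
  have dh: "(h has_field_derivative deriv k' (j (of_real \<rho> * z)) * deriv j (of_real \<rho> * z) * of_real \<rho>) (at z)" if z: "z \<in> ball 0 1" for z
    unfolding h_def using jk[OF \<rho>b(2)[OF z]] \<rho>b(1)[OF z]
    by (intro DERIV_chain dlin holomorphic_derivI[OF jf(1) open_ball] holomorphic_derivI[OF k'(1) openkD]) auto
  have dg: "(g has_field_derivative deriv f (k (of_real \<rho> * z)) * deriv k (of_real \<rho> * z) * of_real \<rho>) (at z)" if z: "z \<in> ball 0 1" for z
    unfolding g_def using pd(3)[of "of_real \<rho> * z"] \<rho>b[OF z]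
    by (intro DERIV_chain dlin holomorphic_derivI[OF k(1) open_ball] holomorphic_derivI[OF jf(2) open_V]) auto
  have hhol: "h holomorphic_on ball 0 1" and ghol: "g holomorphic_on ball 0 1"
    unfolding holomorphic_on_open[OF open_ball] using dh dg by blast+
  have h0: "h 0 = 0" using k'(3)[of 0] by (simp add: h_def jf(5))
  have g0: "g 0 = 0" using jf(3)[of 0] by (simp add: g_def flip: jf(5))
  have hb: "norm (h z) < 1" if z: "norm z < 1" for z
  proof -
    obtain x where "x \<in> ball 0 1" "j (of_real \<rho> * z) = k x" using jk[OF \<rho>b(2)] z by force
    then show ?thesis using k'(3)[of x] by (simp add: h_def)
  qed
  have gb: "norm (g z) < 1" if z: "norm z < 1" for z
  proof -
    have "k (of_real \<rho> * z) \<in> V" using pd(3)[of "of_real \<rho> * z"] \<rho>b[of z] z by simp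
    then show ?thesis using jf(4) by (simp add: g_def)
  qed
  have "norm (deriv h 0) \<le> 1" by (rule Schwarz_Lemma(2)[OF hhol h0 hb, of 0]) auto
  moreover have dk0: "deriv k 0 * deriv k' (k 0) = 1" using k'(2)[of 0] by simp
  moreover have "deriv h 0 = deriv k' (k 0) * deriv j 0 * of_real \<rho>" using DERIV_imp_deriv[OF dh, of 0] by (simp add: jf(5))
  ultimately have "norm (deriv k 0) * (norm (deriv k' (k 0)) * norm (deriv j 0) * \<rho>) \<le> norm (deriv k 0) * 1"
    using \<rho> by (intro mult_left_mono) (auto simp: norm_mult)
  moreover have "norm (deriv k 0) * norm (deriv k' (k 0)) = 1" using dk0 by (metis norm_mult norm_one)
  ultimately have jle: "norm (deriv j 0) * \<rho> \<le> norm (deriv k 0)" by (simp add: mult.assoc[symmetric])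
  have "\<rho>\<^sup>2 \<le> norm (deriv g 0)"
  proof -
    have "deriv g 0 = deriv f (k 0) * deriv k 0 * of_real \<rho>" using DERIV_imp_deriv[OF dg, of 0] by simp
    then have ng: "norm (deriv g 0) = norm (deriv f (k 0)) * norm (deriv k 0) * \<rho>" using \<rho> by (simp add: norm_mult)
    have "norm (deriv f (k 0)) * norm (deriv j 0) = 1" using one[of 0] by (simp add: jf(5) flip: norm_mult)
    then have "\<rho>\<^sup>2 = norm (deriv f (k 0)) * (norm (deriv j 0) * \<rho>) * \<rho>" by (simp add: power2_eq_square mult.assoc[symmetric])
    also have "\<dots> \<le> norm (deriv f (k 0)) * norm (deriv k 0) * \<rho>"
      using \<rho> jle by (intro mult_right_mono mult_left_mono) auto
    finally show ?thesis by (simp add: ng)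
  qed
  moreover have "0 \<le> Im (e * deriv g z / (deriv k (of_real \<rho> * z) * (1 - cnj p * g z) * (1 - cnj q * g z)))"
    if z: "z \<in> ball 0 1" for z
  proof -
    define x where "x = of_real \<rho> * z"
    have xb: "x \<in> ball 0 1" using \<rho>b[OF z] by (simp add: x_def)
    have kxV: "k x \<in> V" using pd(3)[of x] \<rho>b[OF z] by (simp add: x_def)
    have gz: "g z = f (k x)" by (simp add: g_def x_def)
    have gzb: "g z \<in> ball 0 1" and jgz: "j (g z) = k x" using jf(4)[OF kxV] by (auto simp: gz)
    have kx0: "deriv k x \<noteq> 0" using k'(2)[OF xb] by auto
    have j0: "deriv f (k x) * deriv j (g z) = 1" using one[OF gzb] by (simp add: jgz)
    have "deriv g z = deriv f (k x) * deriv k x * of_real \<rho>" using DERIV_imp_deriv[OF dg[OF z]] by (simp add: x_def)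
    moreover have "deriv f (k x) = 1 / deriv j (g z)" using j0 by (metis mult_zero_right nonzero_eq_divide_eq zero_neq_one)
    ultimately have eq: "e * deriv g z / (deriv k x * (1 - cnj p * g z) * (1 - cnj q * g z))
        = of_real \<rho> * (e / (deriv j (g z) * (1 - cnj p * g z) * (1 - cnj q * g z)))"
      using kx0 by (simp add: mult_ac)
    have "Im (of_real \<rho> * w) = \<rho> * Im w" for w by simp
    then show ?thesis unfolding x_def[symmetric] eq using mult_nonneg_nonneg[OF _ pos[OF gzb], of \<rho>] \<rho> by (simp only:)
  qed
  ultimately show ?thesis using that[OF ghol g0 gb _ pq e] by blast
qed

text \<open>Letting \<open>\<rho>\<close> tend to 1, Montel's theorem and compactness of the circle
  give limits of \<open>g\<close>, \<open>p\<close>, \<open>q\<close>, \<open>c\<close>. The limit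
  \<open>G\<close> satisfies \<open>norm (deriv G 0) = 1\<close>, hence is a rotation by the Schwarz
  lemma, and its factor \<open>a\<close> is absorbed into the constants.\<close>

lemma rotation_limit:
  fixes F k :: "complex \<Rightarrow> complex"
  assumes F: "continuous_on (ball 0 1) F" "inj_on F (ball 0 1)" "convex (F ` ball 0 1)"
    and k: "k holomorphic_on ball 0 1" "inj_on k (ball 0 1)"
    and Im: "\<And>z. z \<in> ball 0 1 \<Longrightarrow> Im (k z) = Im (F z)"
    and Re: "\<And>z1 z2. \<lbrakk>z1 \<in> ball 0 1; z2 \<in> ball 0 1; Im (F z1) = Im (F z2); Re (F z1) < Re (F z2)\<rbrakk> \<Longrightarrow> Re (k z1) < Re (k z2)"
  obtains p q c where "norm p = 1" "norm q = 1" "c \<noteq> 0"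
    "\<And>z. z \<in> ball 0 1 \<Longrightarrow> 0 \<le> Re (c * deriv k z * (1 - cnj p * z) * (1 - cnj q * z))"
proof -
  \<comment> \<open>With \<open>n + 2\<close> all radii are at least \<open>1 / 2\<close>.\<close>
  define \<rho> where "\<rho> = (\<lambda>n::nat. 1 - 1 / real (n + 2))"
  have \<rho>: "1 / 2 \<le> \<rho> n" "\<rho> n < 1" for n by (simp_all add: \<rho>_def field_simps)
  have \<rho>lim: "\<rho> \<longlonglongrightarrow> 1"
  proof -
    have "(\<lambda>n. 1 / real (n + 2)) \<longlonglongrightarrow> 0" using LIMSEQ_ignore_initial_segment[OF lim_1_over_n, of 2] by simp
    from tendsto_diff[OF tendsto_const[of 1] this] show ?thesis by (simp add: \<rho>_def)
  qed
  have "\<exists>g p q c. g holomorphic_on ball 0 1 \<and> g 0 = 0 \<and> (\<forall>z. norm z < 1 \<longrightarrow> norm (g z) < 1) \<and>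
    (\<rho> n)\<^sup>2 \<le> norm (deriv g 0) \<and> norm p = 1 \<and> norm q = 1 \<and> norm c = 1 \<and>
    (\<forall>z\<in>ball 0 1. 0 \<le> Im (c * deriv g z / (deriv k (of_real (\<rho> n) * z) * (1 - cnj p * g z) * (1 - cnj q * g z))))" for n
  proof -
    obtain g p q c where gp: "g holomorphic_on ball 0 1" "g 0 = 0" "\<And>z. norm z < 1 \<Longrightarrow> norm (g z) < 1"
      "(\<rho> n)\<^sup>2 \<le> norm (deriv g 0)" "norm p = 1" "norm q = 1" "norm c = 1"
      "\<And>z. z \<in> ball 0 1 \<Longrightarrow> 0 \<le> Im (c * deriv g z / (deriv k (of_real (\<rho> n) * z) * (1 - cnj p * g z) * (1 - cnj q * g z)))"
      by (rule approximate_rotation[OF F k Im Re \<rho>(1)[of n] \<rho>(2)[of n]]) (blast intro: that)+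
    then show ?thesis
      by (intro exI[of _ g] exI[of _ p] exI[of _ q] exI[of _ c] conjI allI ballI impI gp)
  qed
  then obtain g p q c where g: "\<And>n. g n holomorphic_on ball 0 1" "\<And>n. g n 0 = 0"
    "\<And>n z. norm z < 1 \<Longrightarrow> norm (g n z) < 1" "\<And>n. (\<rho> n)\<^sup>2 \<le> norm (deriv (g n) 0)"
    and pqc: "\<And>n. norm (p n) = 1" "\<And>n. norm (q n) = 1" "\<And>n. norm (c n) = 1"
    and pos: "\<And>n z. z \<in> ball 0 1 \<Longrightarrow> 0 \<le> Im (c n * deriv (g n) z / (deriv k (of_real (\<rho> n) * z) * (1 - cnj (p n) * g n z) * (1 - cnj (q n) * g n z)))"
    by metis
  obtain G r1 where G: "G holomorphic_on ball 0 1" "strict_mono (r1 :: nat \<Rightarrow> nat)"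
    "\<And>x. x \<in> ball 0 1 \<Longrightarrow> (\<lambda>n. g (r1 n) x) \<longlonglongrightarrow> G x"
    "\<And>K. \<lbrakk>compact K; K \<subseteq> ball 0 1\<rbrakk> \<Longrightarrow> uniform_limit K (g \<circ> r1) G sequentially"
  proof (rule Montel[OF open_ball, of "range g" 0 1 g])
    show "\<And>h. h \<in> range g \<Longrightarrow> h holomorphic_on ball 0 1" using g(1) by blast
    show "\<exists>B. \<forall>h\<in>range g. \<forall>z\<in>K. norm (h z) \<le> B" if "compact K" "K \<subseteq> ball 0 1" for K
      using g(3) that by (intro exI[of _ 1]) (force intro: less_imp_le)
  qed auto
  define Sp where "Sp = (sphere 0 1 \<times> sphere 0 1 \<times> sphere 0 1 :: (complex \<times> complex \<times> complex) set)"
  have "compact Sp" unfolding Sp_def by (intro compact_Times compact_sphere)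
  moreover have "(p (r1 n), q (r1 n), c (r1 n)) \<in> Sp" for n using pqc by (simp add: Sp_def)
  ultimately obtain L r2 where L: "L \<in> Sp" "strict_mono (r2 :: nat \<Rightarrow> nat)" "((\<lambda>n. (p (r1 n), q (r1 n), c (r1 n))) \<circ> r2) \<longlonglongrightarrow> L"
    unfolding compact_def by meson
  obtain P Q C where PQC: "L = (P, Q, C)" by (metis surj_pair)
  define s where "s = (\<lambda>n. r1 (r2 n))"
  have s: "strict_mono s" using G(2) L(2) by (simp add: s_def strict_mono_def)
  have lims: "(\<lambda>n. p (s n)) \<longlonglongrightarrow> P" "(\<lambda>n. q (s n)) \<longlonglongrightarrow> Q" "(\<lambda>n. c (s n)) \<longlonglongrightarrow> C"
    using tendsto_fst[OF L(3)] tendsto_fst[OF tendsto_snd[OF L(3)]] tendsto_snd[OF tendsto_snd[OF L(3)]]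
    by (simp_all add: PQC s_def o_def)
  have nPQC: "norm P = 1" "norm Q = 1" "norm C = 1" using L(1) by (auto simp: PQC Sp_def)
  have glim: "(\<lambda>n. g (s n) x) \<longlonglongrightarrow> G x" if "x \<in> ball 0 1" for x
    using LIMSEQ_subseq_LIMSEQ[OF G(3)[OF that] L(2)] by (simp add: s_def o_def)
  have dlim: "(\<lambda>n. deriv (g (s n)) x) \<longlonglongrightarrow> deriv G x" if x: "x \<in> ball 0 1" for x
  proof -
    define e where "e = (1 - norm x) / 2"
    have e: "e > 0" "cball x e \<subseteq> ball 0 1"
    proof -
      show "e > 0" using x by (simp add: e_def)
      show "cball x e \<subseteq> ball 0 1" using x by (simp add: e_def cball_subset_ball_iff field_simps)
    qed
    have "uniform_limit (cball x e) (g \<circ> r1) G sequentially" by (rule G(4)[OF compact_cball e(2)])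
    then have u: "uniform_limit (ball x e) (g \<circ> r1) G sequentially"
      by (rule uniform_limit_on_subset) auto
    have ball_sub: "ball x e \<subseteq> ball 0 1" using e(2) ball_subset_cball by blast
    have "((\<lambda>n. (deriv ^^ 1) ((g \<circ> r1) n) x) \<longlongrightarrow> (deriv ^^ 1) G x) sequentially"
      by (rule higher_deriv_complex_uniform_limit[OF u])
        (use e(1) holomorphic_on_subset[OF g(1) ball_sub] in \<open>simp_all add: always_eventually\<close>)
    then have "(\<lambda>n. deriv (g (r1 n)) x) \<longlonglongrightarrow> deriv G x" by simp
    from LIMSEQ_subseq_LIMSEQ[OF this L(2)] show ?thesis by (simp add: s_def o_def)
  qed
  have \<rho>s: "(\<lambda>n. \<rho> (s n)) \<longlonglongrightarrow> 1" using LIMSEQ_subseq_LIMSEQ[OF \<rho>lim s] by (simp add: o_def)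
  have G0: "G 0 = 0" using glim[of 0] g(2) by (simp add: LIMSEQ_const_iff)
  \<comment> \<open>A limit inherits only weak bounds; \<open>norm (g z) \<le> norm z\<close>
    survives it and yields the strict one.\<close>
  have Gb: "norm (G z) < 1" if z: "norm z < 1" for z
  proof -
    have "norm (G z) \<le> norm z"
    proof (rule LIMSEQ_le_const2[OF tendsto_norm[OF glim]])
      show "\<exists>N. \<forall>n\<ge>N. norm (g (s n) z) \<le> norm z"
        using Schwarz_Lemma(1)[OF g(1) g(2) g(3) z] by blast
    qed (use z in simp)
    then show ?thesis using z by simp
  qed
  have "1 \<le> norm (deriv G 0)"
  proof (rule LIMSEQ_le)
    show "(\<lambda>n. (\<rho> (s n))\<^sup>2) \<longlonglongrightarrow> 1" using tendsto_power[OF \<rho>s, of 2] by simp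
    show "(\<lambda>n. norm (deriv (g (s n)) 0)) \<longlonglongrightarrow> norm (deriv G 0)" by (intro tendsto_norm dlim) simp
    show "\<exists>N. \<forall>n\<ge>N. (\<rho> (s n))\<^sup>2 \<le> norm (deriv (g (s n)) 0)" using g(4) by blast
  qed
  moreover have "norm (deriv G 0) \<le> 1" by (rule Schwarz_Lemma(2)[OF G(1) G0 Gb, of 0]) auto
  ultimately have "norm (deriv G 0) = 1" by simp
  then obtain a where a: "\<And>z. norm z < 1 \<Longrightarrow> G z = a * z" "norm a = 1"
    using Schwarz_Lemma(3)[OF G(1) G0 Gb, of 0] by auto
  have dG: "deriv G z = a" if z: "z \<in> ball 0 1" for z
  proof -
    have "((\<lambda>z. a * z) has_field_derivative a) (at z)" by (auto intro!: derivative_eq_intros)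
    then have "(G has_field_derivative a) (at z)"
      by (rule has_field_derivative_transform_within_open[OF _ open_ball z]) (simp add: a(1))
    then show ?thesis by (rule DERIV_imp_deriv)
  qed
  define P' where "P' = P * cnj a"
  define Q' where "Q' = Q * cnj a"
  \<comment> \<open>Chosen so that \<open>Re (C' * Y)\<close> equals \<open>Im (C * a / Y)\<close>
    times \<open>(norm Y)\<^sup>2\<close>: positivity for the reciprocal of \<open>Y\<close> becomes
    positivity for \<open>Y\<close> itself.\<close>
  define C' where "C' = \<i> * cnj (C * a)"
  have n': "norm P' = 1" "norm Q' = 1" "C' \<noteq> 0"
    using nPQC a(2) by (auto simp: P'_def Q'_def C'_def norm_mult)
  have dk: "deriv k z \<noteq> 0" if "z \<in> ball 0 1" for z
    by (rule holomorphic_injective_imp_regular[OF k(1) open_ball k(2) that])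
  have dkhol: "deriv k holomorphic_on ball 0 1" by (rule holomorphic_deriv[OF k(1) open_ball])
  have fin: "0 \<le> Re (C' * deriv k z * (1 - cnj P' * z) * (1 - cnj Q' * z))" if z: "z \<in> ball 0 1" for z
  proof -
    define Y where "Y = deriv k z * (1 - cnj P' * z) * (1 - cnj Q' * z)"
    have Gz: "G z = a * z" using a(1) z by simp
    have "isCont (deriv k) z"
      using holomorphic_on_imp_continuous_on[OF dkhol] z continuous_on_eq_continuous_at open_ball by blast
    moreover have "(\<lambda>n. of_real (\<rho> (s n)) * z) \<longlonglongrightarrow> z"
      using tendsto_mult[OF tendsto_of_real[OF \<rho>s] tendsto_const[of z]] by simp
    ultimately have "(\<lambda>n. deriv k (of_real (\<rho> (s n)) * z)) \<longlonglongrightarrow> deriv k z" by (rule isCont_tendsto_compose)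
    then have "(\<lambda>n. deriv k (of_real (\<rho> (s n)) * z) * (1 - cnj (p (s n)) * g (s n) z) * (1 - cnj (q (s n)) * g (s n) z))
        \<longlonglongrightarrow> deriv k z * (1 - cnj P * G z) * (1 - cnj Q * G z)"
      by (intro tendsto_intros tendsto_cnj lims glim z)
    moreover have Yeq: "deriv k z * (1 - cnj P * G z) * (1 - cnj Q * G z) = Y"
      by (simp add: Y_def P'_def Q'_def Gz mult.assoc)
    moreover have Y0: "Y \<noteq> 0"
      using dk[OF z] unimodular_denominator(1)[OF n'(1), of z] unimodular_denominator(1)[OF n'(2), of z] z
      by (simp add: Y_def)
    ultimately have "(\<lambda>n. c (s n) * deriv (g (s n)) z / (deriv k (of_real (\<rho> (s n)) * z) * (1 - cnj (p (s n)) * g (s n) z) * (1 - cnj (q (s n)) * g (s n) z)))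
        \<longlonglongrightarrow> C * a / Y"
      using dlim[OF z] lims(3) dG[OF z] by (auto intro!: tendsto_intros)
    then have "0 \<le> Im (C * a / Y)"
      by (intro LIMSEQ_le_const[OF tendsto_Im]) (use pos[OF z] in blast)+
    then have "0 \<le> Im (C * a / Y) * (norm Y)\<^sup>2" by simp
    also have "Im (C * a / Y) * (norm Y)\<^sup>2 = Im (C * a / Y * of_real ((norm Y)\<^sup>2))"
    proof -
      have "Im (x * of_real y) = Im x * y" for x y by simp
      then show ?thesis by (simp only:)
    qed
    also have "C * a / Y * of_real ((norm Y)\<^sup>2) = C * a * cnj Y" unfolding complex_norm_square using Y0 by simp
    also have "Im (C * a * cnj Y) = Re (C' * Y)" by (simp add: C'_def algebra_simps)
    finally show ?thesis by (simp add: Y_def mult.assoc)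
  qed
  show ?thesis by (rule that[OF n' fin])
qed

text \<open>The shear \<open>k = H - G\<close> has the imaginary part of \<open>F\<close>. On a
  horizontal line its real part is increasing in \<open>Re F\<close>: for increments with
  \<open>Im A = Im B\<close> the difference \<open>norm A ^ 2 - norm B ^ 2\<close> factors as
  \<open>(Re A + Re B) * (Re A - Re B)\<close>.\<close>

lemma convex_harmonic_shear:
  assumes H: "H holomorphic_on ball 0 1" and G: "G holomorphic_on ball 0 1"
    and J: "\<And>z. z \<in> ball 0 1 \<Longrightarrow> norm (deriv G z) < norm (deriv H z)"
    and inj: "inj_on (\<lambda>z. H z + cnj (G z)) (ball 0 1)"
    and conv: "convex ((\<lambda>z. H z + cnj (G z)) ` ball 0 1)"
  obtains p q c where "norm p = 1" "norm q = 1" "c \<noteq> 0"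
    "\<And>z. z \<in> ball 0 1 \<Longrightarrow> 0 \<le> Re (c * (deriv H z - deriv G z) * (1 - cnj p * z) * (1 - cnj q * z))"
proof -
  define F where "F = (\<lambda>z. H z + cnj (G z))"
  define k where "k = (\<lambda>z. H z - G z)"
  have diff: "norm (G z2 - G z1) < norm (H z2 - H z1)"
    if "z1 \<in> ball 0 1" "z2 \<in> ball 0 1" "z1 \<noteq> z2" for z1 z2
    by (rule norm_diff_less_of_convex_harmonic[OF H G J inj conv that])
  have contF: "continuous_on (ball 0 1) F" unfolding F_def
    by (intro continuous_intros holomorphic_on_imp_continuous_on H G)
  have khol: "k holomorphic_on ball 0 1" unfolding k_def by (intro holomorphic_intros H G)
  have kinj: "inj_on k (ball 0 1)"
  proof (rule inj_onI)
    fix x y assume xy: "x \<in> ball 0 1" "y \<in> ball 0 1" "k x = k y"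
    then have "G y - G x = H y - H x" by (simp add: k_def algebra_simps)
    then show "x = y" using diff[OF xy(1,2)] by (cases "x = y") simp_all
  qed
  have ReF: "Re (k z1) < Re (k z2)"
    if z: "z1 \<in> ball 0 1" "z2 \<in> ball 0 1" and F12: "Im (F z1) = Im (F z2)" "Re (F z1) < Re (F z2)" for z1 z2
  proof -
    define A where "A = H z2 - H z1"
    define B where "B = G z2 - G z1"
    have "norm B < norm A" unfolding A_def B_def using F12(2) by (intro diff z) auto
    then have "(norm B)\<^sup>2 < (norm A)\<^sup>2" by (simp add: power_strict_mono)
    moreover have "Im A = Im B" "0 < Re A + Re B" using F12 by (simp_all add: F_def A_def B_def)
    ultimately have "0 < (Re A + Re B) * (Re A - Re B)" unfolding cmod_power2 by (simp add: power2_eq_square algebra_simps)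
    then have "0 < Re A - Re B" using \<open>0 < Re A + Re B\<close> by (simp add: zero_less_mult_iff)
    then show ?thesis by (simp add: A_def B_def k_def)
  qed
  have dk: "deriv k z = deriv H z - deriv G z" if "z \<in> ball 0 1" for z
    unfolding k_def using that H G by (intro deriv_diff) (auto intro: holomorphic_on_imp_differentiable_at)
  have ImF: "Im (k z) = Im (F z)" if "z \<in> ball 0 1" for z by (simp add: k_def F_def)
  obtain p q c where pqc: "norm p = 1" "norm q = 1" "c \<noteq> 0"
    and pos: "\<And>z. z \<in> ball 0 1 \<Longrightarrow> 0 \<le> Re (c * deriv k z * (1 - cnj p * z) * (1 - cnj q * z))"
    by (rule rotation_limit[OF contF inj[folded F_def] conv[folded F_def] khol kinj ImF ReF]) (blast intro: that)+
  show ?thesis by (rule that[OF pqc]) (use pos dk in simp)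
qed

text \<open>With \<open>e\<close> a square root of \<open>\<omega>\<close>, rotating
  \<open>F\<close> by \<open>cnj e\<close> replaces the pair by \<open>cnj e * H\<close> and
  \<open>e * G\<close>, whose shear is \<open>cnj e * (H - \<omega> * G)\<close>.\<close>

lemma convex_harmonic_shear_direction:
  assumes H: "H holomorphic_on ball 0 1" and G: "G holomorphic_on ball 0 1"
    and J: "\<And>z. z \<in> ball 0 1 \<Longrightarrow> norm (deriv G z) < norm (deriv H z)"
    and inj: "inj_on (\<lambda>z. H z + cnj (G z)) (ball 0 1)"
    and conv: "convex ((\<lambda>z. H z + cnj (G z)) ` ball 0 1)"
    and \<omega>: "norm \<omega> = 1"
  obtains p q c where "norm p = 1" "norm q = 1" "c \<noteq> 0"
    "\<And>z. z \<in> ball 0 1 \<Longrightarrow> 0 \<le> Re (c * (deriv H z - \<omega> * deriv G z) * (1 - cnj p * z) * (1 - cnj q * z))"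
proof -
  define e where "e = csqrt \<omega>"
  have e2: "e * e = \<omega>" by (simp add: e_def flip: power2_eq_square)
  then have "norm e * norm e = 1" using \<omega> by (metis norm_mult)
  then have "(norm e)\<^sup>2 = 1" by (simp add: power2_eq_square)
  then have e1: "norm e = 1" using norm_ge_zero[of e] by (simp add: power2_eq_1_iff)
  have ee: "e * cnj e = 1" using complex_norm_square[of e] e1 by simp
  define H1 where "H1 = (\<lambda>z. cnj e * H z)"
  define G1 where "G1 = (\<lambda>z. e * G z)"
  have hol: "H1 holomorphic_on ball 0 1" "G1 holomorphic_on ball 0 1"
    unfolding H1_def G1_def by (intro holomorphic_intros H G)+
  have d: "deriv H1 z = cnj e * deriv H z" "deriv G1 z = e * deriv G z" if "z \<in> ball 0 1" for z
    unfolding H1_def G1_def using that H G by (auto intro!: deriv_cmult holomorphic_on_imp_differentiable_at)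
  have J1: "norm (deriv G1 z) < norm (deriv H1 z)" if "z \<in> ball 0 1" for z
    using J[OF that] by (simp add: d[OF that] norm_mult e1)
  have F1: "H1 z + cnj (G1 z) = cnj e * (H z + cnj (G z))" for z by (simp add: H1_def G1_def algebra_simps)
  have e0: "cnj e \<noteq> 0" using e1 by auto
  have inj1: "inj_on (\<lambda>z. H1 z + cnj (G1 z)) (ball 0 1)"
    using inj e0 unfolding F1 inj_on_def by simp
  have "(\<lambda>z. H1 z + cnj (G1 z)) ` ball 0 1 = (\<lambda>w. cnj e * w) ` (\<lambda>z. H z + cnj (G z)) ` ball 0 1"
    unfolding F1 by (simp add: image_image)
  then have conv1: "convex ((\<lambda>z. H1 z + cnj (G1 z)) ` ball 0 1)"
    using convex_linear_image[OF _ conv, of "\<lambda>w. cnj e * w"] by (simp add: linear_times)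
  obtain p q c where k: "norm p = 1" "norm q = 1" "c \<noteq> 0"
    "\<And>z. z \<in> ball 0 1 \<Longrightarrow> 0 \<le> Re (c * (deriv H1 z - deriv G1 z) * (1 - cnj p * z) * (1 - cnj q * z))"
    by (rule convex_harmonic_shear[OF hol J1 inj1 conv1]) (blast intro: that)+
  have eqc: "c * (deriv H1 z - deriv G1 z) = (c * cnj e) * (deriv H z - \<omega> * deriv G z)" if z: "z \<in> ball 0 1" for z
  proof -
    have "cnj e * \<omega> = e" using ee by (simp add: mult.commute mult.left_commute flip: e2)
    then have "cnj e * (deriv H z - \<omega> * deriv G z) = cnj e * deriv H z - e * deriv G z"
      by (simp add: right_diff_distrib flip: mult.assoc)
    then show ?thesis by (simp add: d[OF z] mult.assoc)
  qed
  show ?thesis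
  proof (rule that[OF k(1,2)])
    show "c * cnj e \<noteq> 0" using k(3) e0 by simp
    show "0 \<le> Re (c * cnj e * (deriv H z - \<omega> * deriv G z) * (1 - cnj p * z) * (1 - cnj q * z))"
      if "z \<in> ball 0 1" for z
      unfolding eqc[OF that, symmetric] by (rule k(4)[OF that])
  qed
qed

section \<open>Rotation of the tangent\<close>

text \<open>Once the tangent direction at one point is fixed, this replaces the antiholomorphic term in the
  tangent by a holomorphic one.\<close>

lemma Arg_shear:
  assumes t: "norm t < 1"
  shows "Arg (1 + (cis (Arg (1 - t)))\<^sup>2 * cnj t) = Arg (1 - t)"
proof -
  define s where "s = cis (Arg (1 - t))"
  have t1: "1 - t \<noteq> 0" using t by auto
  define \<rho> where "\<rho> = norm (1 - t)"
  have \<rho>: "\<rho> > 0" using t1 by (simp add: \<rho>_def)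
  have st: "1 - t = of_real \<rho> * s" unfolding s_def \<rho>_def by (metis rcis_cmod_Arg rcis_def)
  have ss: "s * cnj s = 1" by (simp add: s_def cis_cnj flip: cis_inverse)
  have "norm t < 1 \<Longrightarrow> (norm t)\<^sup>2 < 1" by (simp add: power_less_one_iff)
  then have pos: "(1 - (norm t)\<^sup>2) / \<rho> > 0" using t \<rho> by simp
  have "1 + s\<^sup>2 * cnj t = s * (cnj s + s * cnj t)" using ss by (simp add: algebra_simps power2_eq_square)
  also have "cnj s + s * cnj t = of_real ((1 - (norm t)\<^sup>2) / \<rho>)"
  proof -
    have "of_real \<rho> * (cnj s + s * cnj t) = cnj (1 - t) + (1 - t) * cnj t"
      unfolding st by (simp add: algebra_simps)
    also have "\<dots> = 1 - of_real ((norm t)\<^sup>2)" unfolding complex_norm_square by (simp add: algebra_simps)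
    finally show ?thesis using \<rho> by (simp add: field_simps)
  qed
  finally have "1 + s\<^sup>2 * cnj t = of_real ((1 - (norm t)\<^sup>2) / \<rho>) * s" by (simp add: mult.commute)
  moreover have "1 - t = of_real \<rho> * s" by (rule st)
  ultimately show ?thesis
    using Arg_times_of_real[OF pos, of s] Arg_times_of_real[OF \<rho>, of s] unfolding s_def[symmetric] by simp
qed

text \<open>For fixed \<open>q1\<close>, \<open>q2\<close> the difference of arguments is the
  imaginary part of a function holomorphic in the parameter, with principal branches since both
  factors stay in the right half-plane. Its minimum over the closed disk is attained on the circle,
  so the bound remains strict.\<close>

lemma min_principle_Im_log_quotient:
  assumes q: "norm q1 < 1" "norm q2 < 1"
    and circ: "\<And>\<omega>. norm \<omega> = 1 \<Longrightarrow> m < Arg (1 - \<omega> * q2) - Arg (1 - \<omega> * q1)"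
    and l: "norm \<mu> \<le> 1"
  shows "m < Arg (1 - \<mu> * q2) - Arg (1 - \<mu> * q1)"
proof -
  have pos: "Re (1 - \<omega> * q) > 0" if "norm \<omega> \<le> 1" "norm q < 1" for \<omega> q :: complex
  proof -
    have "norm (\<omega> * q) < 1" using that by (metis mult_left_le_one_le norm_ge_zero norm_mult order_le_less_trans)
    then show ?thesis using complex_Re_le_cmod[of "\<omega> * q"] by simp
  qed
  have npos: "1 - \<omega> * q \<notin> \<real>\<^sub>\<le>\<^sub>0" "1 - \<omega> * q \<noteq> 0" if "norm \<omega> \<le> 1" "norm q < 1" for \<omega> q :: complex
  proof -
    show "1 - \<omega> * q \<noteq> 0" using pos[OF that] by (metis less_irrefl zero_complex.sel(1))
    show "1 - \<omega> * q \<notin> \<real>\<^sub>\<le>\<^sub>0" using pos[OF that] unfolding complex_nonpos_Reals_iff by linarith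
  qed
  define U where "U = (\<lambda>\<omega>. Ln (1 - \<omega> * q2) - Ln (1 - \<omega> * q1))"
  have ImU: "Im (U \<omega>) = Arg (1 - \<omega> * q2) - Arg (1 - \<omega> * q1)" if "norm \<omega> \<le> 1" for \<omega>
    using npos(2)[OF that q(1)] npos(2)[OF that q(2)] by (simp add: U_def Arg_eq_Im_Ln)
  have holU: "U holomorphic_on ball 0 1" unfolding U_def
    using npos q by (intro holomorphic_intros) (auto simp: less_imp_le)
  have contU: "continuous_on (cball 0 1) U" unfolding U_def
    using npos q by (intro continuous_intros) auto
  have "compact (sphere 0 1 :: complex set)" "sphere 0 1 \<noteq> ({} :: complex set)" by auto
  moreover have "continuous_on (sphere 0 1) (\<lambda>\<omega>. Im (U \<omega>))"
    by (intro continuous_intros continuous_on_subset[OF contU]) auto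
  ultimately obtain \<omega>0 where \<omega>0: "\<omega>0 \<in> sphere 0 1" "\<And>\<omega>. \<omega> \<in> sphere 0 1 \<Longrightarrow> Im (U \<omega>0) \<le> Im (U \<omega>)"
    using continuous_attains_inf[of "sphere 0 1 :: complex set" "\<lambda>\<omega>. Im (U \<omega>)"] by blast
  have "norm (exp (\<i> * U \<mu>)) \<le> exp (- Im (U \<omega>0))"
  proof (rule maximum_modulus_frontier[of "\<lambda>\<omega>. exp (\<i> * U \<omega>)" "cball 0 1"])
    show "(\<lambda>\<omega>. exp (\<i> * U \<omega>)) holomorphic_on interior (cball 0 1)"
      using holU by (auto intro!: holomorphic_intros)
    show "continuous_on (closure (cball 0 1)) (\<lambda>\<omega>. exp (\<i> * U \<omega>))"
      using contU by (auto intro!: continuous_intros)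
    show "norm (exp (\<i> * U z)) \<le> exp (- Im (U \<omega>0))" if "z \<in> frontier (cball 0 1)" for z
      using \<omega>0(2)[of z] that by simp
  qed (use l in auto)
  then have "Im (U \<omega>0) \<le> Im (U \<mu>)" by simp
  moreover have "m < Im (U \<omega>0)" using \<omega>0(1) circ[of \<omega>0] ImU[of \<omega>0] by simp
  ultimately show ?thesis using ImU[OF l] by simp
qed

section \<open>Angles along a circle\<close>

lemma has_vector_derivative_circle:
  "((\<lambda>t. of_real r * cis t) has_vector_derivative \<i> * (of_real r * cis t)) (at t)"
proof -
  have "((\<lambda>t. \<i> * of_real t) has_vector_derivative \<i>) (at t)"
    by (auto intro!: derivative_eq_intros simp: has_vector_derivative_def scaleR_conv_of_real fun_eq_iff)
  from field_vector_diff_chain_at[OF this DERIV_exp]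
  have "(cis has_vector_derivative \<i> * cis t) (at t)" by (simp add: o_def cis_conv_exp[abs_def])
  then have "((\<lambda>t. of_real r * cis t) has_vector_derivative of_real r * (\<i> * cis t)) (at t)"
    by (rule has_vector_derivative_mult_right)
  then show ?thesis by (simp add: mult_ac)
qed

text \<open>Up to a factor 2 and a constant this is the tangent angle of the half-plane mapping
  \<open>z / (1 - cnj p * z)\<close>, whose images of circles are convex. The derivative is half of
  \<open>Re ((1 + x) / (1 - x))\<close> with \<open>x = cnj p * z\<close>.\<close>

lemma Arg_convex_increasing:
  assumes p: "norm p = 1" and r: "0 < r" "r < 1" and t: "t1 < t2"
  shows "t1 / 2 - Arg (1 - cnj p * (of_real r * cis t1)) < t2 / 2 - Arg (1 - cnj p * (of_real r * cis t2))"
proof -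
  define z where "z = (\<lambda>t. of_real r * cis t)"
  have nz: "norm (z t) < 1" for t using r by (simp add: z_def norm_mult)
  have pos: "Re (1 - cnj p * z t) > 0" for t
  proof -
    have "norm (cnj p * z t) < 1" using p nz by (simp add: norm_mult)
    then show ?thesis using complex_Re_le_cmod[of "cnj p * z t"] by simp
  qed
  have npos: "1 - cnj p * z t \<notin> \<real>\<^sub>\<le>\<^sub>0" "1 - cnj p * z t \<noteq> 0" for t
  proof -
    show "1 - cnj p * z t \<noteq> 0" using pos[of t] by (metis less_irrefl zero_complex.sel(1))
    show "1 - cnj p * z t \<notin> \<real>\<^sub>\<le>\<^sub>0" using pos[of t] unfolding complex_nonpos_Reals_iff by linarith
  qed
  define h where "h = (\<lambda>t. t / 2 - Im (Ln (1 - cnj p * z t)))"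
  have "h t1 < h t2"
  proof (rule DERIV_pos_imp_increasing[OF t])
    fix t
    have dz: "(z has_vector_derivative \<i> * z t) (at t)" unfolding z_def by (rule has_vector_derivative_circle)
    define D where "D = - cnj p * (\<i> * z t) / (1 - cnj p * z t)"
    have "((\<lambda>x. Ln (1 - cnj p * x)) has_field_derivative (- cnj p / (1 - cnj p * z t))) (at (z t))"
      using npos[of t] by (auto intro!: derivative_eq_intros simp: divide_inverse)
    from field_vector_diff_chain_at[OF dz this]
    have "((\<lambda>t. Ln (1 - cnj p * z t)) has_vector_derivative D) (at t)"
      by (simp add: o_def D_def mult_ac)
    from bounded_linear.has_vector_derivative[OF bounded_linear_Im this]
    have "((\<lambda>t. Im (Ln (1 - cnj p * z t))) has_real_derivative Im D) (at t)"
      by (simp add: has_real_derivative_iff_has_vector_derivative)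
    moreover have "((\<lambda>t. t / 2) has_real_derivative (1 / 2)) (at t)" by (auto intro!: derivative_eq_intros)
    ultimately have "(h has_real_derivative (1 / 2 - Im D)) (at t)"
      unfolding h_def by (intro DERIV_diff)
    moreover have "1 / 2 - Im D > 0"
    proof -
      define x where "x = cnj p * z t"
      have x: "norm x < 1" using p nz by (simp add: x_def norm_mult)
      have x1: "1 - x \<noteq> 0" using npos by (simp add: x_def)
      have "Im D = - Re (x / (1 - x))" 
      proof -
        have "D = - (\<i> * (x / (1 - x)))" by (simp add: D_def x_def)
        then show ?thesis by (simp only: uminus_complex.sel Im_i_times)
      qed
      moreover have "1 + 2 * Re (x / (1 - x)) = Re ((1 + x) / (1 - x))"
      proof -
        define w where "w = x / (1 - x)"
        have "1 + 2 * w = (1 + x) / (1 - x)" using x1 by (simp add: w_def field_simps)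
        then have "Re (1 + 2 * w) = Re ((1 + x) / (1 - x))" by simp
        then show ?thesis unfolding w_def[symmetric] by simp
      qed
      moreover have "Re ((1 + x) / (1 - x)) > 0"
      proof -
        have "(1 + x) / (1 - x) = (1 + x) * cnj (1 - x) / of_real ((norm (1 - x))\<^sup>2)"
          using x1 unfolding complex_norm_square by simp
        then have "Re ((1 + x) / (1 - x)) = Re ((1 + x) * cnj (1 - x)) / (norm (1 - x))\<^sup>2"
          by (simp only: Re_divide_of_real)
        moreover have "Re ((1 + x) * cnj (1 - x)) = 1 - (norm x)\<^sup>2"
          unfolding cmod_power2 by (simp add: algebra_simps power2_eq_square)
        moreover have "(norm x)\<^sup>2 < 1" using x by (simp add: power_less_one_iff)
        ultimately show ?thesis using x1 by simp
      qed
      ultimately show ?thesis by linarith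
    qed
    ultimately show "\<exists>y. (h has_real_derivative y) (at t) \<and> 0 < y" by blast
  qed
  moreover have "Im (Ln (1 - cnj p * z t)) = Arg (1 - cnj p * z t)" for t using npos by (simp add: Arg_eq_Im_Ln)
  ultimately show ?thesis by (simp add: h_def z_def)
qed

text \<open>By hypothesis the argument of \<open>exp lg * (1 - h)\<close> times the two linear
  factors stays in a half-plane, while
  \<open>t / 2 - Arg (1 - cnj p * z)\<close> increases along the circle.\<close>

lemma Arg_rotation_of_close_to_convex:
  fixes g lg h :: "complex \<Rightarrow> complex"
  assumes lg: "lg holomorphic_on ball 0 1" and h: "h holomorphic_on ball 0 1"
    and h1: "\<And>z. z \<in> ball 0 1 \<Longrightarrow> norm (h z) < 1"
    and p: "norm p = 1" and q: "norm q = 1" and c: "c \<noteq> 0"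
    and Re: "\<And>z. z \<in> ball 0 1 \<Longrightarrow> 0 \<le> Re (c * (exp (lg z) * (1 - h z)) * (1 - cnj p * z) * (1 - cnj q * z))"
    and r: "0 < r" "r < 1" and t: "t1 < t2"
  shows "(t1 + Im (lg (of_real r * cis t1)) + Arg (1 - h (of_real r * cis t1))) - pi
       < t2 + Im (lg (of_real r * cis t2)) + Arg (1 - h (of_real r * cis t2))"
proof -
  define P where "P = (\<lambda>z. c * (exp (lg z) * (1 - h z)) * (1 - cnj p * z) * (1 - cnj q * z))"
  \<comment> \<open>\<open>exp E\<close> is the constant \<open>1 / c\<close>, hence
    \<open>E\<close> is constant and the arguments add up without jumps by 2 pi.\<close>
  define E where "E = (\<lambda>z. lg z + Ln (1 - h z) + Ln (1 - cnj p * z) + Ln (1 - cnj q * z) - Ln (P z))"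
  have np: "1 - x \<notin> \<real>\<^sub>\<le>\<^sub>0" "1 - x \<noteq> 0" if "norm x < 1" for x :: complex
    using complex_Re_le_cmod[of x] that by (auto simp: complex_nonpos_Reals_iff)
  have npz: "norm (cnj p * z) < 1" "norm (cnj q * z) < 1" if "z \<in> ball 0 1" for z
    using that p q by (simp_all add: norm_mult)
  have P0: "P z \<noteq> 0" if "z \<in> ball 0 1" for z
    using np(2)[OF npz(1)[OF that]] np(2)[OF npz(2)[OF that]] np(2)[OF h1[OF that]] c by (simp add: P_def)
  have RePz: "0 \<le> Re (P z)" if "z \<in> ball 0 1" for z using Re[OF that] by (simp only: P_def)
  have Pnp: "P z \<notin> \<real>\<^sub>\<le>\<^sub>0" if "z \<in> ball 0 1" for z
  proof
    assume "P z \<in> \<real>\<^sub>\<le>\<^sub>0"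
    then have "Re (P z) = 0" "Im (P z) = 0" using RePz[OF that] by (auto simp: complex_nonpos_Reals_iff)
    then show False using P0[OF that] by (simp add: complex_eq_iff)
  qed
  have "E holomorphic_on ball 0 1" unfolding E_def
  proof (intro holomorphic_intros lg h)
    show "P holomorphic_on ball 0 1" unfolding P_def by (intro holomorphic_intros lg h)
  qed (use np h1 npz Pnp in blast)+
  moreover have "exp (E z) = 1 / c" if z: "z \<in> ball 0 1" for z
    using P0[OF z] np(2)[OF npz(1)[OF z]] np(2)[OF npz(2)[OF z]] np(2)[OF h1[OF z]] c
    by (simp add: E_def exp_add exp_diff) (simp add: P_def)
  ultimately obtain C where C: "\<And>z. z \<in> ball 0 1 \<Longrightarrow> E z = C" using constant_of_exp_constant by blast
  have Im: "Im (lg z) + Arg (1 - h z) + Arg (1 - cnj p * z) + Arg (1 - cnj q * z) = Im C + Arg (P z)"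
    if z: "z \<in> ball 0 1" for z
  proof -
    have "Im (lg z) + Arg (1 - h z) + Arg (1 - cnj p * z) + Arg (1 - cnj q * z) - Arg (P z) = Im (E z)"
      using P0[OF z] np(2)[OF npz(1)[OF z]] np(2)[OF npz(2)[OF z]] np(2)[OF h1[OF z]]
      by (simp add: E_def Arg_eq_Im_Ln)
    then show ?thesis using C[OF z] by simp
  qed
  \<comment> \<open>The half-plane condition: \<open>Arg (P z)\<close> varies by at most pi, the
    whole loss allowed in the claim.\<close>
  have half: "\<bar>Arg (P z)\<bar> \<le> pi / 2" if z: "z \<in> ball 0 1" for z
    using Re_Ln_pos_le[OF P0[OF z]] RePz[OF z] P0[OF z] by (simp add: Arg_eq_Im_Ln)
  define z where "z = (\<lambda>t. of_real r * cis t)"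
  have zb: "z t \<in> ball 0 1" for t using r by (simp add: z_def norm_mult)
  have "t1 - Arg (1 - cnj p * z t1) - Arg (1 - cnj q * z t1) < t2 - Arg (1 - cnj p * z t2) - Arg (1 - cnj q * z t2)"
    using Arg_convex_increasing[OF p r t] Arg_convex_increasing[OF q r t] by (simp add: z_def)
  then have "(t1 + Im (lg (z t1)) + Arg (1 - h (z t1))) - pi < t2 + Im (lg (z t2)) + Arg (1 - h (z t2))"
    using Im[OF zb[of t1]] Im[OF zb[of t2]] half[OF zb[of t1]] half[OF zb[of t2]] by linarith
  then show ?thesis by (simp add: z_def)
qed

text \<open>In the application \<open>exp lg = H'\<close> and \<open>q = G' / H'\<close>, and
  \<open>\<nu>\<close> is the angle of the outer normal of \<open>H + \<epsilon> * cnj G\<close>. If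
  it dropped by pi or more, it would drop by exactly pi at some \<open>t\<close>, where the normals
  are opposite. Then \<open>Arg_shear\<close> holds at both points with the same
  \<open>\<mu>\<close>, and \<open>rot\<close>, extended to \<open>\<mu>\<close> by the minimum
  principle, is contradicted.\<close>

lemma rotation_of_harmonic:
  fixes lg q :: "complex \<Rightarrow> complex"
  assumes lg: "continuous_on (ball 0 1) lg" and q: "continuous_on (ball 0 1) q"
    and q1: "\<And>z. z \<in> ball 0 1 \<Longrightarrow> norm (q z) < 1"
    and r: "0 < r" "r < 1" and \<epsilon>: "0 \<le> \<epsilon>" "\<epsilon> \<le> 1"
    and rot: "\<And>\<omega> t1 t2. \<lbrakk>norm \<omega> = 1; t1 < t2\<rbrakk> \<Longrightarrow>
        (t1 + Im (lg (of_real r * cis t1)) + Arg (1 - \<omega> * q (of_real r * cis t1))) - pi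
         < t2 + Im (lg (of_real r * cis t2)) + Arg (1 - \<omega> * q (of_real r * cis t2))"
    and Q: "\<And>z. Q z = of_real \<epsilon> * cnj (z * exp (lg z) * q z) / (z * exp (lg z))"
    and \<nu>: "\<And>t. \<nu> t = t + Im (lg (of_real r * cis t)) + Arg (1 - Q (of_real r * cis t))"
  shows "continuous_on UNIV \<nu>" "t1 < t2 \<Longrightarrow> \<nu> t1 - pi < \<nu> t2"
proof -
  define z where "z = (\<lambda>t. of_real r * cis t)"
  have zb: "z t \<in> ball 0 1" for t using r by (simp add: z_def norm_mult)
  have z0: "z t \<noteq> 0" for t using r by (simp add: z_def)
  have Q1: "norm (Q (z t)) < 1" for t
  proof -
    have "norm (Q (z t)) = \<epsilon> * norm (q (z t))" using z0[of t] \<epsilon> by (simp add: Q norm_mult norm_divide)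
    also have "\<dots> \<le> norm (q (z t))" using \<epsilon> by (simp add: mult_left_le_one_le)
    finally show ?thesis using q1[OF zb[of t]] by simp
  qed
  have np: "1 - x \<notin> \<real>\<^sub>\<le>\<^sub>0" "1 - x \<noteq> 0" if "norm x < 1" for x :: complex
    using complex_Re_le_cmod[of x] that by (auto simp: complex_nonpos_Reals_iff)
  have contz: "continuous_on UNIV z" unfolding z_def by (intro continuous_intros)
  have contlg: "continuous_on UNIV (\<lambda>t. lg (z t))" "continuous_on UNIV (\<lambda>t. q (z t))"
    using zb by (auto intro!: continuous_on_compose2[OF lg contz] continuous_on_compose2[OF q contz])
  have \<nu>': "\<nu> = (\<lambda>t. t + Im (lg (z t)) + Im (Ln (1 - Q (z t))))"
    using np(2)[OF Q1] by (intro ext) (simp add: \<nu> z_def Arg_eq_Im_Ln)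
  show cont: "continuous_on UNIV \<nu>"
    unfolding \<nu>' unfolding Q using np(1)[OF Q1] z0 unfolding Q
    by (intro continuous_intros contlg contz) auto
  show "\<nu> t1 - pi < \<nu> t2" if t12: "t1 < t2"
  proof (rule ccontr)
    assume "\<not> \<nu> t1 - pi < \<nu> t2"
    then obtain t where t: "t1 \<le> t" "t \<le> t2" "\<nu> t = \<nu> t1 - pi"
      using IVT2'[of \<nu> t2 "\<nu> t1 - pi" t1] t12 continuous_on_subset[OF cont] by auto
    then have lt: "t1 < t" using pi_gt_zero by (cases "t = t1") auto
    define e where "e = cis (\<nu> t1)"
    define \<mu> where "\<mu> = - of_real \<epsilon> * e\<^sup>2"
    \<comment> \<open>Only the square of \<open>cis (\<nu> u)\<close> enters, so opposite normals
      share the constant \<open>\<mu>\<close>.\<close>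
    have same: "Arg (1 - \<mu> * q (z u)) = Arg (1 - Q (z u))" if e2: "e\<^sup>2 = (cis (\<nu> u))\<^sup>2" for u
    proof -
      define x where "x = z u * exp (lg (z u))"
      have x0: "x \<noteq> 0" using z0 by (simp add: x_def)
      define \<xi> where "\<xi> = cis (u + Im (lg (z u)))"
      have x: "x = of_real (norm x) * \<xi>"
      proof -
        have "x = of_real (r * exp (Re (lg (z u)))) * \<xi>"
          unfolding x_def z_def \<xi>_def by (simp add: exp_eq_polar cis_mult[symmetric])
        moreover have "norm x = r * exp (Re (lg (z u)))" using r by (simp add: x_def z_def norm_mult)
        ultimately show ?thesis by simp
      qed
      have \<xi>1: "\<xi> * cnj \<xi> = 1" by (simp add: \<xi>_def cis_cnj cis_mult)
      define s where "s = cis (Arg (1 - Q (z u)))"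
      have "cis (\<nu> u) = \<xi> * s" by (simp add: \<nu> z_def \<xi>_def s_def cis_mult)
      then have e2': "e\<^sup>2 = \<xi>\<^sup>2 * s\<^sup>2" by (simp add: e2 power_mult_distrib)
      have "cnj (Q (z u)) = of_real \<epsilon> * x * q (z u) / cnj x" by (simp add: Q x_def)
      also have "\<dots> = of_real \<epsilon> * (\<xi> / cnj \<xi>) * q (z u)"
        using x0 by (subst (1 2) x) simp
      also have "\<xi> / cnj \<xi> = \<xi>\<^sup>2" using \<xi>1 by (metis nonzero_eq_divide_eq mult_eq_0_iff mult.assoc mult.right_neutral power2_eq_square zero_neq_one)
      finally have "- \<mu> * q (z u) = s\<^sup>2 * cnj (Q (z u))" by (simp add: \<mu>_def e2')
      then have eq1: "1 - \<mu> * q (z u) = 1 + s\<^sup>2 * cnj (Q (z u))" by simp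
      show ?thesis unfolding eq1 s_def by (rule Arg_shear[OF Q1])
    qed
    have same1: "Arg (1 - \<mu> * q (z t1)) = Arg (1 - Q (z t1))" by (rule same) (simp add: e_def)
    have "cis (\<nu> t) = - e" unfolding t(3) e_def by (simp add: cis.ctr complex_eq_iff)
    then have same2: "Arg (1 - \<mu> * q (z t)) = Arg (1 - Q (z t))" by (intro same) simp
    define m where "m = - pi - (t - t1) - (Im (lg (z t)) - Im (lg (z t1)))"
    have "m < Arg (1 - \<mu> * q (z t)) - Arg (1 - \<mu> * q (z t1))"
    proof (rule min_principle_Im_log_quotient[OF q1[OF zb] q1[OF zb]])
      show "m < Arg (1 - \<omega> * q (z t)) - Arg (1 - \<omega> * q (z t1))" if "norm \<omega> = 1" for \<omega>
        using rot[OF that lt] by (simp add: m_def z_def)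
      show "norm \<mu> \<le> 1" using \<epsilon> by (simp add: \<mu>_def norm_mult norm_power e_def)
    qed
    then have "\<nu> t1 - pi < \<nu> t" unfolding same1 same2 by (simp add: m_def \<nu> z_def)
    then show False using t(3) by simp
  qed
qed

text \<open>At a first return to the level, \<open>\<delta>\<close> would be above the level just
  before, which \<open>up\<close> forbids at every point of the level.\<close>

lemma upward_crossing_stays_above:
  fixes \<delta> :: "real \<Rightarrow> real"
  assumes cont: "continuous_on UNIV \<delta>"
    and up: "\<And>x. \<delta> x = L \<Longrightarrow> \<exists>d>0. (\<forall>y. x < y \<and> y \<le> x + d \<longrightarrow> L < \<delta> y) \<and> (\<forall>y. x - d \<le> y \<and> y < x \<longrightarrow> \<delta> y < L)"
    and a: "\<delta> a = L" and ab: "a < b"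
  shows "L < \<delta> b"
proof (rule ccontr)
  assume "\<not> L < \<delta> b"
  then have b: "\<delta> b \<le> L" by simp
  obtain d where d: "d > 0" "\<And>y. a < y \<Longrightarrow> y \<le> a + d \<Longrightarrow> L < \<delta> y" using up[OF a] by blast
  have adb: "a + d < b" using d(2)[of b] b ab by (meson not_le)
  \<comment> \<open>Starting at \<open>a + d\<close> keeps \<open>a\<close> itself, where the level
    is also met, out of the search.\<close>
  define S where "S = {a + d..b} \<inter> {x. \<delta> x \<le> L}"
  have "closed {x. \<delta> x \<le> L}" by (intro closed_Collect_le cont continuous_on_const)
  then have "compact S" unfolding S_def by (intro compact_Int_closed) auto
  moreover have "b \<in> S" using b adb by (simp add: S_def)
  then have "S \<noteq> {}" by blast
  ultimately obtain x where x: "x \<in> S" "\<And>y. y \<in> S \<Longrightarrow> x \<le> y" using compact_attains_inf by meson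
  have x_gt: "a + d < x" using x(1) d(2)[of "a + d"] d(1) by (auto simp: S_def less_le)
  have above: "L < \<delta> y" if "a + d \<le> y" "y < x" for y
    using x(2)[of y] x(1) that by (force simp: S_def)
  have "\<delta> x = L"
  proof (rule antisym)
    show "\<delta> x \<le> L" using x(1) by (simp add: S_def)
    show "L \<le> \<delta> x"
    proof (rule ccontr)
      assume lt: "\<not> L \<le> \<delta> x"
      then obtain z where "a + d \<le> z" "z \<le> x" "\<delta> z = L"
        using IVT2'[of \<delta> x L "a + d"] d x_gt continuous_on_subset[OF cont] by (metis add_le_same_cancel1 less_add_same_cancel1 less_eq_real_def not_le order_refl subset_UNIV)
      then show False using above[of z] lt by (metis less_irrefl not_le order_le_less)
    qed
  qed
  from up[OF this] obtain e where e: "e > 0" "\<And>y. x - e \<le> y \<Longrightarrow> y < x \<Longrightarrow> \<delta> y < L" by blast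
  define y where "y = max (a + d) (x - e)"
  have "a + d \<le> y" "x - e \<le> y" "y < x" using x_gt e(1) by (auto simp: y_def)
  then show False using above[of y] e(2)[of y] by simp
qed

section \<open>A monotone direction near the normal\<close>

lemma real_mod_representative:
  fixes x y :: real
  obtains n :: int where "x \<le> y - 2 * pi * of_int n" "y - 2 * pi * of_int n < x + 2 * pi"
proof
  define n where "n = \<lfloor>(y - x) / (2 * pi)\<rfloor>"
  have "of_int n \<le> (y - x) / (2 * pi)" "(y - x) / (2 * pi) < of_int n + 1"
    unfolding n_def by linarith+
  then show "x \<le> y - 2 * pi * of_int n" "y - 2 * pi * of_int n < x + 2 * pi"
    by (simp_all add: field_simps)
qed

lemma quasi_periodic_int:
  fixes g :: "real \<Rightarrow> real"
  assumes "\<And>\<theta>. g (\<theta> + 2 * pi) = g \<theta> + c"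
  shows "g (\<theta> + 2 * pi * of_int n) = g \<theta> + of_int n * c"
proof -
  have nat: "g (\<theta> + 2 * pi * of_nat n) = g \<theta> + of_nat n * c" for n \<theta>
  proof (induction n)
    case (Suc n)
    have "\<theta> + 2 * pi * of_nat (Suc n) = (\<theta> + 2 * pi * of_nat n) + 2 * pi" by (simp add: algebra_simps)
    then have "g (\<theta> + 2 * pi * of_nat (Suc n)) = g (\<theta> + 2 * pi * of_nat n) + c" by (simp only: assms)
    then show ?case unfolding Suc by (simp add: algebra_simps)
  qed simp
  show ?thesis
  proof (cases n)
    case (nonneg m) then show ?thesis using nat by simp
  next
    case (neg m)
    have "g (\<theta> + 2 * pi * of_int n + 2 * pi * of_nat (Suc m)) = g (\<theta> + 2 * pi * of_int n) + of_nat (Suc m) * c"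
      by (rule nat)
    moreover have "\<theta> + 2 * pi * of_int n + 2 * pi * of_nat (Suc m) = \<theta>" by (simp add: neg algebra_simps)
    ultimately show ?thesis by (simp add: neg algebra_simps)
  qed
qed

text \<open>The running supremum \<open>S\<close> of \<open>\<nu>\<close> is monotone and lies above
  \<open>\<nu>\<close> by less than pi, because \<open>\<nu>\<close> never drops by pi. Compactness
  over a period turns this into \<open>S - \<nu> \<le> - m < pi\<close>; lowering \<open>S\<close>
  by nearly \<open>pi / 2\<close> then leaves an error below \<open>pi / 2\<close> on both
  sides.\<close>

lemma monotone_direction:
  fixes \<nu> :: "real \<Rightarrow> real"
  assumes cont: "continuous_on UNIV \<nu>" and per: "\<And>\<theta>. \<nu> (\<theta> + 2 * pi) = \<nu> \<theta> + 2 * pi"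
    and rot: "\<And>s t. s < t \<Longrightarrow> \<nu> s - pi < \<nu> t"
  obtains \<beta> where "continuous_on UNIV \<beta>" "\<And>\<theta>. \<beta> (\<theta> + 2 * pi) = \<beta> \<theta> + 2 * pi" "mono \<beta>"
    "\<And>\<theta>. \<bar>\<beta> \<theta> - \<nu> \<theta>\<bar> < pi / 2"
proof -
  define K where "K = {0..2 * pi} \<times> {0..2 * pi}"
  have "compact K" "K \<noteq> {}" unfolding K_def by (auto intro: compact_Times)
  moreover have "continuous_on K (\<lambda>(a, s). \<nu> (a + s) - \<nu> a)"
    unfolding split_beta by (intro continuous_intros continuous_on_compose2[OF cont]) auto
  ultimately obtain x0 where x0: "x0 \<in> K" "\<And>x. x \<in> K \<Longrightarrow> (\<lambda>(a, s). \<nu> (a + s) - \<nu> a) x0 \<le> (\<lambda>(a, s). \<nu> (a + s) - \<nu> a) x"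
    using continuous_attains_inf[of K "\<lambda>(a, s). \<nu> (a + s) - \<nu> a"] by blast
  obtain a0 s0 where x0': "x0 = (a0, s0)" "0 \<le> s0" using x0(1) by (auto simp: K_def)
  define m where "m = \<nu> (a0 + s0) - \<nu> a0"
  have m: "- pi < m" using rot[of a0 "a0 + s0"] x0'(2) pi_gt_zero by (cases "s0 = 0") (auto simp: m_def)
  have all: "m \<le> \<nu> t - \<nu> s" if "s \<le> t" for s t
  proof -
    obtain k where k: "0 \<le> s - 2 * pi * of_int k" "s - 2 * pi * of_int k < 0 + 2 * pi"
      by (rule real_mod_representative)
    obtain n where n: "0 \<le> (t - s) - 2 * pi * of_int n" "(t - s) - 2 * pi * of_int n < 0 + 2 * pi"
      by (rule real_mod_representative)
    have "0 \<le> n"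
    proof (rule ccontr)
      assume "\<not> 0 \<le> n"
      then have "real_of_int n \<le> - 1" by linarith
      then have "2 * pi * of_int n \<le> 2 * pi * (- 1)" by (intro mult_left_mono) auto
      then show False using n(2) that by simp
    qed
    define a where "a = s - 2 * pi * of_int k"
    define u where "u = (t - s) - 2 * pi * of_int n"
    have "m \<le> \<nu> (a + u) - \<nu> a"
      using x0(2)[of "(a, u)"] k n by (simp add: K_def a_def u_def m_def x0')
    moreover have "\<nu> s = \<nu> a + of_int k * (2 * pi)"
      using quasi_periodic_int[of \<nu> "2 * pi", OF per, of a k] by (simp add: a_def)
    moreover have "\<nu> t = \<nu> (a + u) + of_int (k + n) * (2 * pi)"
      using quasi_periodic_int[of \<nu> "2 * pi", OF per, of "a + u" "k + n"] by (simp add: a_def u_def algebra_simps)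
    moreover have "0 \<le> of_int n * (2 * pi)" using \<open>0 \<le> n\<close> by simp
    ultimately show ?thesis by (simp add: algebra_simps)
  qed
  \<comment> \<open>At most half of the margin \<open>m + pi\<close>, so the shifted error lies
    between \<open>\<eta> - pi / 2\<close> and \<open>pi / 2 - \<eta>\<close>.\<close>
  define \<eta> where "\<eta> = min (pi / 4) ((m + pi) / 2)"
  have "\<eta> \<le> (m + pi) / 2" unfolding \<eta>_def by (rule min.cobounded2)
  then have \<eta>: "0 < \<eta>" "2 * \<eta> - pi \<le> m" using m by (simp_all add: \<eta>_def)
  define S where "S = (\<lambda>\<theta>. Sup (\<nu> ` {..\<theta>}))"
  have up: "\<nu> s \<le> \<nu> t - m" if "s \<le> t" for s t using all[OF that] by simp
  have bdd: "bdd_above (\<nu> ` {..\<theta>})" for \<theta> using up by (intro bdd_aboveI[of _ "\<nu> \<theta> - m"]) auto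
  have S_ge: "\<nu> s \<le> S \<theta>" if "s \<le> \<theta>" for s \<theta> unfolding S_def using bdd that by (intro cSUP_upper) auto
  have S_le: "S \<theta> \<le> c" if "\<And>s. s \<le> \<theta> \<Longrightarrow> \<nu> s \<le> c" for \<theta> c
    unfolding S_def using that by (intro cSUP_least) auto
  have monoS: "S s \<le> S t" if "s \<le> t" for s t using S_ge that by (intro S_le) auto
  have perS: "S (\<theta> + 2 * pi) = S \<theta> + 2 * pi" for \<theta>
  proof (rule antisym)
    show "S (\<theta> + 2 * pi) \<le> S \<theta> + 2 * pi"
    proof (rule S_le)
      fix s assume "s \<le> \<theta> + 2 * pi"
      then have "\<nu> (s - 2 * pi) \<le> S \<theta>" by (intro S_ge) simp
      then show "\<nu> s \<le> S \<theta> + 2 * pi" using per[of "s - 2 * pi"] by simp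
    qed
    have "S \<theta> \<le> S (\<theta> + 2 * pi) - 2 * pi"
    proof (rule S_le)
      fix s assume "s \<le> \<theta>"
      then have "\<nu> (s + 2 * pi) \<le> S (\<theta> + 2 * pi)" by (intro S_ge) simp
      then show "\<nu> s \<le> S (\<theta> + 2 * pi) - 2 * pi" using per[of s] by simp
    qed
    then show "S \<theta> + 2 * pi \<le> S (\<theta> + 2 * pi)" by simp
  qed
  have contS: "continuous_on UNIV S"
    unfolding continuous_on_iff
  proof (intro ballI allI impI)
    fix x e :: real assume e: "e > 0"
    then obtain d where d: "d > 0" "\<And>t. dist t x < d \<Longrightarrow> dist (\<nu> t) (\<nu> x) < e / 3"
      using cont unfolding continuous_on_iff by (metis UNIV_I divide_pos_pos zero_less_numeral)
    have step: "S t - S s \<le> 2 * e / 3" if "s \<le> t" "dist s x < d" "dist t x < d" for s t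
    proof -
      have "\<nu> u \<le> S s + 2 * e / 3" if u: "u \<le> t" for u
      proof (cases "u \<le> s")
        case True then show ?thesis using S_ge[OF True] e by linarith
      next
        case False
        then have "dist u x < d" using u \<open>dist s x < d\<close> \<open>dist t x < d\<close> by (auto simp: dist_real_def)
        then have "\<bar>\<nu> u - \<nu> x\<bar> < e / 3" "\<bar>\<nu> s - \<nu> x\<bar> < e / 3"
          using d(2)[of u] d(2)[of s] \<open>dist s x < d\<close> by (simp_all add: dist_real_def)
        then have "\<nu> u \<le> \<nu> s + 2 * e / 3" by linarith
        then show ?thesis using S_ge[of s s] by simp
      qed
      then show ?thesis using S_le[of t "S s + 2 * e / 3"] by simp
    qed
    show "\<exists>d>0. \<forall>x'\<in>UNIV. dist x' x < d \<longrightarrow> dist (S x') (S x) < e"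
    proof (intro exI conjI ballI impI)
      fix t assume t: "dist t x < d"
      consider "t \<le> x" | "x \<le> t" by linarith
      then show "dist (S t) (S x) < e"
      proof cases
        case 1 then show ?thesis using step[of t x] monoS[of t x] t d(1) e by (simp add: dist_real_def)
      next
        case 2 then show ?thesis using step[of x t] monoS[of x t] t d(1) e by (simp add: dist_real_def)
      qed
    qed (rule d(1))
  qed
  define \<beta> where "\<beta> = (\<lambda>\<theta>. S \<theta> - pi / 2 + \<eta>)"
  show ?thesis
  proof (rule that[of \<beta>])
    show "continuous_on UNIV \<beta>" unfolding \<beta>_def by (intro continuous_intros contS)
    show "\<beta> (\<theta> + 2 * pi) = \<beta> \<theta> + 2 * pi" for \<theta> by (simp add: \<beta>_def perS)
    show "mono \<beta>" using monoS by (auto simp: \<beta>_def mono_def)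
    show "\<bar>\<beta> \<theta> - \<nu> \<theta>\<bar> < pi / 2" for \<theta>
    proof -
      have "\<nu> \<theta> \<le> S \<theta>" "S \<theta> \<le> \<nu> \<theta> - m" using S_ge S_le up by auto
      then have "S \<theta> - pi / 2 + \<eta> - \<nu> \<theta> < pi / 2" "- (S \<theta> - pi / 2 + \<eta> - \<nu> \<theta>) < pi / 2"
        using \<eta> by linarith+
      then show ?thesis by (simp only: \<beta>_def abs_less_iff)
    qed
  qed
qed

section \<open>Half-lines from a closed curve\<close>

text \<open>The half-lines leave the curve on its outer side; because their directions turn
  monotonically, the angle between the direction at \<open>\<theta>\<close> and the vector from the curve to a fixed
  point can cross a multiple of \<open>2\<pi>\<close> only upwards. Comparing with its total change, which is \<open>2\<pi>\<close>
  for outer and zero for inner points, every outer point is hit exactly once and no inner point is.\<close>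

locale ray_family =
  fixes \<gamma> :: "real \<Rightarrow> complex" and \<rho> \<nu> \<beta> :: "real \<Rightarrow> real" and W :: "complex set"
  assumes der: "(\<gamma> has_vector_derivative of_real (\<rho> \<theta>) * (\<i> * cis (\<nu> \<theta>))) (at \<theta>)"
    and \<rho>: "\<rho> \<theta> > 0"
    and per\<gamma>: "\<gamma> (\<theta> + 2 * pi) = \<gamma> \<theta>"
    and cont\<beta>: "continuous_on UNIV \<beta>" and per\<beta>: "\<beta> (\<theta> + 2 * pi) = \<beta> \<theta> + 2 * pi"
    and mono\<beta>: "mono \<beta>" and close: "\<bar>\<beta> \<theta> - \<nu> \<theta>\<bar> < pi / 2"
    and W\<gamma>: "\<gamma> \<theta> \<notin> W" and clW: "\<gamma> \<theta> \<in> closure W"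
    and winding: "y \<notin> range \<gamma> \<Longrightarrow> \<exists>\<alpha>. continuous_on UNIV \<alpha> \<and>
        (\<forall>\<theta>. y - \<gamma> \<theta> = of_real (norm (y - \<gamma> \<theta>)) * cis (\<alpha> \<theta>)) \<and>
        (\<forall>\<theta>. \<alpha> (\<theta> + 2 * pi) = \<alpha> \<theta> + (if y \<in> W then 2 * pi else 0))"
begin

lemma cont\<gamma>: "continuous_on UNIV \<gamma>"
  by (rule continuous_on_vector_derivative) (use der in simp)

text \<open>Seen from the moving curve point and turned so that the ray direction is the real axis,
  \<open>y\<close> moves downwards as \<open>\<theta>\<close> passes \<open>\<theta>1\<close>: the
  imaginary part of \<open>A\<close> has a negative derivative because \<open>\<beta>\<close> is
  within a right angle of the normal. Since \<open>\<beta>\<close> is only known to be continuous,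
  its turning \<open>\<Delta>\<close> is treated separately; by monotonicity it acts in the same
  direction.\<close>

lemma rotated_near_ray:
  assumes t: "t > 0" and y: "y = \<gamma> \<theta>1 + of_real t * cis (\<beta> \<theta>1)"
  obtains d where "d > 0"
    "\<And>\<theta>. \<bar>\<theta> - \<theta>1\<bar> \<le> d \<Longrightarrow> 0 < Re (cis (- \<beta> \<theta>) * (y - \<gamma> \<theta>))"
    "\<And>\<theta>. \<lbrakk>\<theta>1 < \<theta>; \<theta> \<le> \<theta>1 + d\<rbrakk> \<Longrightarrow> Im (cis (- \<beta> \<theta>) * (y - \<gamma> \<theta>)) < 0"
    "\<And>\<theta>. \<lbrakk>\<theta>1 - d \<le> \<theta>; \<theta> < \<theta>1\<rbrakk> \<Longrightarrow> 0 < Im (cis (- \<beta> \<theta>) * (y - \<gamma> \<theta>))"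
proof -
  define A where "A = (\<lambda>\<theta>. cis (- \<beta> \<theta>1) * (y - \<gamma> \<theta>))"
  define C where "C = (\<lambda>\<theta>. cis (- \<beta> \<theta>) * (y - \<gamma> \<theta>))"
  define \<Delta> where "\<Delta> = (\<lambda>\<theta>. \<beta> \<theta> - \<beta> \<theta>1)"
  have A1: "A \<theta>1 = of_real t" unfolding A_def y by (simp add: cis_mult mult.left_commute)
  have C1: "C \<theta>1 = of_real t" using A1 by (simp add: A_def C_def)
  have CA: "C \<theta> = cis (- \<Delta> \<theta>) * A \<theta>" for \<theta> by (simp add: C_def A_def \<Delta>_def cis_mult flip: mult.assoc)
  have ImC: "Im (C \<theta>) = cos (\<Delta> \<theta>) * Im (A \<theta>) - sin (\<Delta> \<theta>) * Re (A \<theta>)" for \<theta> by (simp add: CA)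
  have "(A has_vector_derivative cis (- \<beta> \<theta>1) * (0 - of_real (\<rho> \<theta>1) * (\<i> * cis (\<nu> \<theta>1)))) (at \<theta>1)"
    unfolding A_def by (intro has_vector_derivative_mult_right has_vector_derivative_diff has_vector_derivative_const der)
  from bounded_linear.has_vector_derivative[OF bounded_linear_Im this]
  have dA: "DERIV (\<lambda>\<theta>. Im (A \<theta>)) \<theta>1 :> Im (cis (- \<beta> \<theta>1) * (0 - of_real (\<rho> \<theta>1) * (\<i> * cis (\<nu> \<theta>1))))"
    by (simp add: has_real_derivative_iff_has_vector_derivative)
  have "cis (- \<beta> \<theta>1) * (0 - of_real (\<rho> \<theta>1) * (\<i> * cis (\<nu> \<theta>1))) = - of_real (\<rho> \<theta>1) * (\<i> * cis (\<nu> \<theta>1 - \<beta> \<theta>1))"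
    by (simp add: cis_mult mult.left_commute)
  then have "Im (cis (- \<beta> \<theta>1) * (0 - of_real (\<rho> \<theta>1) * (\<i> * cis (\<nu> \<theta>1)))) = - (\<rho> \<theta>1 * cos (\<nu> \<theta>1 - \<beta> \<theta>1))"
    by (simp only:) simp
  moreover have "\<bar>\<nu> \<theta>1 - \<beta> \<theta>1\<bar> < pi / 2" using close[of \<theta>1] by (simp add: abs_minus_commute)
  then have "0 < cos (\<nu> \<theta>1 - \<beta> \<theta>1)" by (intro cos_gt_zero_pi) linarith+
  ultimately have neg: "Im (cis (- \<beta> \<theta>1) * (0 - of_real (\<rho> \<theta>1) * (\<i> * cis (\<nu> \<theta>1)))) < 0"
    using \<rho>[of \<theta>1] by (simp only:) simp
  obtain d1 where d1: "d1 > 0" "\<And>h. \<lbrakk>0 < h; h < d1\<rbrakk> \<Longrightarrow> Im (A (\<theta>1 + h)) < Im (A \<theta>1)"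
    using DERIV_neg_dec_right[OF dA neg] by auto
  obtain d2 where d2: "d2 > 0" "\<And>h. \<lbrakk>0 < h; h < d2\<rbrakk> \<Longrightarrow> Im (A \<theta>1) < Im (A (\<theta>1 - h))"
    using DERIV_neg_dec_left[OF dA neg] by auto
  have near: "\<exists>d>0. \<forall>\<theta>. \<bar>\<theta> - \<theta>1\<bar> < d \<longrightarrow> \<bar>g \<theta> - g \<theta>1\<bar> < e" if "continuous_on UNIV g" "e > 0" for g :: "real \<Rightarrow> real" and e
    using that unfolding continuous_on_iff dist_real_def by blast
  have contC: "continuous_on UNIV C" unfolding C_def
    unfolding cis_conv_exp by (intro continuous_intros cont\<beta> cont\<gamma>)
  have contA: "continuous_on UNIV A" unfolding A_def by (intro continuous_intros cont\<gamma>)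
  obtain d3 where d3: "d3 > 0" "\<And>\<theta>. \<bar>\<theta> - \<theta>1\<bar> < d3 \<Longrightarrow> \<bar>Re (C \<theta>) - Re (C \<theta>1)\<bar> < t"
    using near[of "\<lambda>\<theta>. Re (C \<theta>)" t] contC t by (auto intro: continuous_intros)
  obtain d4 where d4: "d4 > 0" "\<And>\<theta>. \<bar>\<theta> - \<theta>1\<bar> < d4 \<Longrightarrow> \<bar>Re (A \<theta>) - Re (A \<theta>1)\<bar> < t"
    using near[of "\<lambda>\<theta>. Re (A \<theta>)" t] contA t by (auto intro: continuous_intros)
  obtain d5 where d5: "d5 > 0" "\<And>\<theta>. \<bar>\<theta> - \<theta>1\<bar> < d5 \<Longrightarrow> \<bar>\<Delta> \<theta>\<bar> < pi / 2"
    using near[of \<beta> "pi / 2"] cont\<beta> by (auto simp: \<Delta>_def)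
  define d where "d = min (min d1 d2) (min d3 (min d4 d5)) / 2"
  have d: "d > 0" "d < d1" "d < d2" "d < d3" "d < d4" "d < d5" using d1 d2 d3 d4 d5 by (auto simp: d_def)
  have cosp: "0 < cos (\<Delta> \<theta>)" if "\<bar>\<theta> - \<theta>1\<bar> \<le> d" for \<theta>
    using d5(2)[of \<theta>] that d by (intro cos_gt_zero_pi) auto
  have ReA: "0 < Re (A \<theta>)" if "\<bar>\<theta> - \<theta>1\<bar> \<le> d" for \<theta> using d4(2)[of \<theta>] that d A1 by auto
  have "0 < Re (C \<theta>)" if "\<bar>\<theta> - \<theta>1\<bar> \<le> d" for \<theta> using d3(2)[of \<theta>] that d C1 by auto
  moreover have "Im (C \<theta>) < 0" if \<theta>: "\<theta>1 < \<theta>" "\<theta> \<le> \<theta>1 + d" for \<theta>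
  proof -
    have abs: "\<bar>\<theta> - \<theta>1\<bar> \<le> d" using \<theta> by auto
    have "Im (A \<theta>) < 0" using d1(2)[of "\<theta> - \<theta>1"] \<theta> d A1 by simp
    then have neg1: "cos (\<Delta> \<theta>) * Im (A \<theta>) < 0" using cosp[OF abs] by (simp add: mult_pos_neg)
    have "0 \<le> \<Delta> \<theta>" using monoD[OF mono\<beta>, of \<theta>1 \<theta>] \<theta> by (simp add: \<Delta>_def)
    moreover have "\<bar>\<Delta> \<theta>\<bar> < pi / 2" using d5(2)[of \<theta>] abs d by simp
    ultimately have "0 \<le> sin (\<Delta> \<theta>)" using pi_gt_zero by (intro sin_ge_zero) linarith+
    then have "0 \<le> sin (\<Delta> \<theta>) * Re (A \<theta>)" using ReA[OF abs] by simp
    then show ?thesis unfolding ImC using neg1 by linarith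
  qed
  moreover have "0 < Im (C \<theta>)" if \<theta>: "\<theta>1 - d \<le> \<theta>" "\<theta> < \<theta>1" for \<theta>
  proof -
    have abs: "\<bar>\<theta> - \<theta>1\<bar> \<le> d" using \<theta> by auto
    have "0 < Im (A \<theta>)" using d2(2)[of "\<theta>1 - \<theta>"] \<theta> d A1 by simp
    then have pos1: "0 < cos (\<Delta> \<theta>) * Im (A \<theta>)" using cosp[OF abs] by simp
    have "\<Delta> \<theta> \<le> 0" using monoD[OF mono\<beta>, of \<theta> \<theta>1] \<theta> by (simp add: \<Delta>_def)
    moreover have "\<bar>\<Delta> \<theta>\<bar> < pi / 2" using d5(2)[of \<theta>] abs d by simp
    ultimately have "0 \<le> sin (- \<Delta> \<theta>)" using pi_gt_zero by (intro sin_ge_zero) linarith+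
    then have "sin (\<Delta> \<theta>) * Re (A \<theta>) \<le> 0" using ReA[OF abs] by (simp add: mult_nonpos_nonneg)
    then show ?thesis unfolding ImC using pos1 by linarith
  qed
  ultimately show ?thesis using that d(1) unfolding C_def by blast
qed

section \<open>The angle between the half-line direction and a fixed point\<close>

lemma ray_through:
  assumes "y - \<gamma> \<theta> = of_real (norm (y - \<gamma> \<theta>)) * cis (\<alpha> \<theta>)" "\<beta> \<theta> - \<alpha> \<theta> = 2 * pi * of_int n"
  shows "y = \<gamma> \<theta> + of_real (norm (y - \<gamma> \<theta>)) * cis (\<beta> \<theta>)"
proof -
  have "\<beta> \<theta> = \<alpha> \<theta> + 2 * pi * of_int n" using assms(2) by simp
  then have "cis (\<beta> \<theta>) = cis (\<alpha> \<theta>)"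
    by (simp add: cis_mult[symmetric] cis_multiple_2pi)
  then show ?thesis using assms(1) by (metis add.commute diff_add_cancel)
qed

lemma angle_on_ray:
  assumes y: "y = \<gamma> \<theta> + of_real t * cis (\<beta> \<theta>)" "t > 0"
    and \<alpha>: "y - \<gamma> \<theta> = of_real (norm (y - \<gamma> \<theta>)) * cis (\<alpha> \<theta>)"
  obtains n :: int where "\<beta> \<theta> - \<alpha> \<theta> = 2 * pi * of_int n"
proof -
  have "norm (y - \<gamma> \<theta>) = t" using y by (simp add: norm_mult)
  then have "of_real t * cis (\<beta> \<theta>) = of_real t * cis (\<alpha> \<theta>)" using \<alpha> y(1) by simp
  then have "cis (\<beta> \<theta>) = cis (\<alpha> \<theta>)" using y(2) by simp
  then have "exp (\<i> * of_real (\<beta> \<theta>)) = exp (\<i> * of_real (\<alpha> \<theta>))" by (simp add: cis_conv_exp)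
  then obtain n :: int where "\<i> * of_real (\<beta> \<theta>) = \<i> * of_real (\<alpha> \<theta>) + (of_int (2 * n) * pi) * \<i>"
    using exp_eq by blast
  then have "\<beta> \<theta> = \<alpha> \<theta> + of_int (2 * n) * pi" by (simp add: complex_eq_iff)
  then show ?thesis using that[of n] by simp
qed

text \<open>The imaginary part in \<open>rotated_near_ray\<close> is minus the distance times the
  sine of the angle difference \<open>\<delta>\<close>, and while
  \<open>\<bar>\<delta>\<bar> < pi\<close>, the sign of the sine determines that of
  \<open>\<delta>\<close>.\<close>

lemma angle_crosses_upwards:
  assumes cont: "continuous_on UNIV \<alpha>"
    and \<alpha>: "\<And>\<theta>. y - \<gamma> \<theta> = of_real (norm (y - \<gamma> \<theta>)) * cis (\<alpha> \<theta>)"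
    and y: "y \<notin> range \<gamma>" and hit: "\<beta> \<theta>1 - \<alpha> \<theta>1 = 2 * pi * of_int n"
  shows "\<exists>d>0. (\<forall>\<theta>. \<theta>1 < \<theta> \<and> \<theta> \<le> \<theta>1 + d \<longrightarrow> 2 * pi * of_int n < \<beta> \<theta> - \<alpha> \<theta>) \<and>
               (\<forall>\<theta>. \<theta>1 - d \<le> \<theta> \<and> \<theta> < \<theta>1 \<longrightarrow> \<beta> \<theta> - \<alpha> \<theta> < 2 * pi * of_int n)"
proof -
  have np: "norm (y - \<gamma> \<theta>) > 0" for \<theta> using y by auto
  define \<delta> where "\<delta> = (\<lambda>\<theta>. \<beta> \<theta> - \<alpha> \<theta> - 2 * pi * of_int n)"
  have Im: "Im (cis (- \<beta> \<theta>) * (y - \<gamma> \<theta>)) = - (norm (y - \<gamma> \<theta>) * sin (\<delta> \<theta>))" for \<theta>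
  proof -
    have "cis (- \<beta> \<theta>) * (y - \<gamma> \<theta>) = of_real (norm (y - \<gamma> \<theta>)) * cis (\<alpha> \<theta> - \<beta> \<theta>)"
      by (subst \<alpha>) (simp add: cis_mult mult.left_commute)
    moreover have "cis (\<alpha> \<theta> - \<beta> \<theta>) = cis (- \<delta> \<theta>)"
    proof -
      have "\<alpha> \<theta> - \<beta> \<theta> = - \<delta> \<theta> + 2 * pi * of_int (- n)" by (simp add: \<delta>_def)
      then show ?thesis by (metis cis_mult cis_multiple_2pi Ints_of_int mult.right_neutral)
    qed
    ultimately show ?thesis by simp
  qed
  obtain d where d: "d > 0"
    "\<And>\<theta>. \<lbrakk>\<theta>1 < \<theta>; \<theta> \<le> \<theta>1 + d\<rbrakk> \<Longrightarrow> Im (cis (- \<beta> \<theta>) * (y - \<gamma> \<theta>)) < 0"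
    "\<And>\<theta>. \<lbrakk>\<theta>1 - d \<le> \<theta>; \<theta> < \<theta>1\<rbrakk> \<Longrightarrow> 0 < Im (cis (- \<beta> \<theta>) * (y - \<gamma> \<theta>))"
    using rotated_near_ray[OF np ray_through[where \<alpha> = \<alpha>, OF \<alpha>[of \<theta>1] hit]] by metis
  have "continuous_on UNIV \<delta>" unfolding \<delta>_def by (intro continuous_intros cont cont\<beta>)
  moreover have "\<delta> \<theta>1 = 0" using hit by (simp add: \<delta>_def)
  ultimately obtain e where e: "e > 0" "\<And>\<theta>. \<bar>\<theta> - \<theta>1\<bar> < e \<Longrightarrow> \<bar>\<delta> \<theta>\<bar> < pi"
    unfolding continuous_on_iff dist_real_def by (metis UNIV_I diff_zero pi_gt_zero)
  define d' where "d' = min d (e / 2)"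
  have d': "d' > 0" "d' \<le> d" "d' < e" using d(1) e(1) by (auto simp: d'_def)
  have "0 < \<delta> \<theta>" if \<theta>: "\<theta>1 < \<theta>" "\<theta> \<le> \<theta>1 + d'" for \<theta>
  proof (rule ccontr)
    assume "\<not> 0 < \<delta> \<theta>"
    then have "0 \<le> sin (- \<delta> \<theta>)" using e(2)[of \<theta>] \<theta> d' by (intro sin_ge_zero) (auto simp: abs_less_iff)
    then have "norm (y - \<gamma> \<theta>) * sin (\<delta> \<theta>) \<le> 0" by (simp add: mult_nonneg_nonpos)
    then show False using d(2)[of \<theta>] \<theta> d' Im[of \<theta>] by simp
  qed
  moreover have "\<delta> \<theta> < 0" if \<theta>: "\<theta>1 - d' \<le> \<theta>" "\<theta> < \<theta>1" for \<theta>
  proof (rule ccontr)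
    assume "\<not> \<delta> \<theta> < 0"
    then have "0 \<le> sin (\<delta> \<theta>)" using e(2)[of \<theta>] \<theta> d' by (intro sin_ge_zero) (auto simp: abs_less_iff)
    then have "0 \<le> norm (y - \<gamma> \<theta>) * sin (\<delta> \<theta>)" by simp
    then show False using d(3)[of \<theta>] \<theta> d' Im[of \<theta>] by simp
  qed
  ultimately show ?thesis using d'(1) unfolding \<delta>_def by (intro exI[of _ d']) auto
qed

lemma angle_stays_above:
  assumes "continuous_on UNIV \<alpha>" "\<And>\<theta>. y - \<gamma> \<theta> = of_real (norm (y - \<gamma> \<theta>)) * cis (\<alpha> \<theta>)"
    "y \<notin> range \<gamma>" "\<beta> \<theta>1 - \<alpha> \<theta>1 = 2 * pi * of_int n" "\<theta>1 < \<theta>2"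
  shows "2 * pi * of_int n < \<beta> \<theta>2 - \<alpha> \<theta>2"
  by (rule upward_crossing_stays_above[of "\<lambda>\<theta>. \<beta> \<theta> - \<alpha> \<theta>", OF _ angle_crosses_upwards[OF assms(1,2,3)] assms(4,5)])
     (intro continuous_intros assms(1) cont\<beta>)

text \<open>For \<open>y\<close> in \<open>W\<close> the angle \<open>\<alpha>\<close> gains 2 pi in
  a period just as \<open>\<beta>\<close> does, so the difference returns to its level, which
  \<open>angle_stays_above\<close> forbids after a hit.\<close>

lemma ray_avoids_W:
  assumes y: "y = \<gamma> \<theta> + of_real t * cis (\<beta> \<theta>)" "t \<ge> 0"
  shows "y \<notin> W"
proof
  assume yW: "y \<in> W"
  have y\<gamma>: "y \<notin> range \<gamma>" using yW W\<gamma> by blast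
  have t: "t > 0" using y y\<gamma> by (cases "t = 0") auto
  obtain \<alpha> where \<alpha>: "continuous_on UNIV \<alpha>" "\<And>\<theta>. y - \<gamma> \<theta> = of_real (norm (y - \<gamma> \<theta>)) * cis (\<alpha> \<theta>)"
    "\<And>\<theta>. \<alpha> (\<theta> + 2 * pi) = \<alpha> \<theta> + 2 * pi"
    using winding[OF y\<gamma>] yW by auto
  obtain n where n: "\<beta> \<theta> - \<alpha> \<theta> = 2 * pi * of_int n" using angle_on_ray[where \<alpha> = \<alpha>, OF y(1) t \<alpha>(2)[of \<theta>]] by blast
  have "2 * pi * of_int n < \<beta> (\<theta> + 2 * pi) - \<alpha> (\<theta> + 2 * pi)"
    by (rule angle_stays_above[OF \<alpha>(1,2) y\<gamma> n]) simp
  then show False using n by (simp add: per\<beta> \<alpha>(3))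
qed

text \<open>The winding assumption gives no angle function at a point of the curve. Near it there
  are points \<open>v\<close> of \<open>W\<close>, and the sign change of the rotated vector
  persists for \<open>v\<close>; at the zero in between, \<open>v\<close> lies on a half-line,
  against \<open>ray_avoids_W\<close>.\<close>

lemma open_ray_avoids_curve:
  assumes y: "y = \<gamma> \<theta>1 + of_real t * cis (\<beta> \<theta>1)" "t > 0"
  shows "y \<notin> range \<gamma>"
proof
  assume "y \<in> range \<gamma>"
  then have ycl: "y \<in> closure W" using clW by blast
  obtain d where d: "d > 0"
    "\<And>\<theta>. \<bar>\<theta> - \<theta>1\<bar> \<le> d \<Longrightarrow> 0 < Re (cis (- \<beta> \<theta>) * (y - \<gamma> \<theta>))"
    "\<And>\<theta>. \<lbrakk>\<theta>1 < \<theta>; \<theta> \<le> \<theta>1 + d\<rbrakk> \<Longrightarrow> Im (cis (- \<beta> \<theta>) * (y - \<gamma> \<theta>)) < 0"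
    "\<And>\<theta>. \<lbrakk>\<theta>1 - d \<le> \<theta>; \<theta> < \<theta>1\<rbrakk> \<Longrightarrow> 0 < Im (cis (- \<beta> \<theta>) * (y - \<gamma> \<theta>))"
    using rotated_near_ray[OF y(2,1)] by blast
  define C where "C = (\<lambda>v \<theta>. cis (- \<beta> \<theta>) * (v - \<gamma> \<theta>))"
  have contC: "continuous_on S (C v)" for v S unfolding C_def cis_conv_exp
    by (intro continuous_intros continuous_on_subset[OF cont\<beta>] continuous_on_subset[OF cont\<gamma>]) auto
  define I where "I = {\<theta>1 - d..\<theta>1 + d}"
  have "compact I" "I \<noteq> {}" using d(1) by (auto simp: I_def)
  moreover have "continuous_on I (\<lambda>\<theta>. Re (C y \<theta>))" by (intro continuous_intros contC)
  ultimately obtain \<theta>m where \<theta>m: "\<theta>m \<in> I" "\<And>\<theta>. \<theta> \<in> I \<Longrightarrow> Re (C y \<theta>m) \<le> Re (C y \<theta>)"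
    using continuous_attains_inf[of I "\<lambda>\<theta>. Re (C y \<theta>)"] by blast
  \<comment> \<open>Bounded by the real parts on \<open>I\<close> and by the absolute imaginary
    parts at its ends, so that replacing \<open>y\<close> by \<open>v\<close> preserves these
    signs.\<close>
  define e where "e = min (Re (C y \<theta>m)) (min (Im (C y (\<theta>1 - d))) (- Im (C y (\<theta>1 + d))))"
  have e: "e > 0" unfolding e_def
    using d(2)[of \<theta>m] d(3)[of "\<theta>1 + d"] d(4)[of "\<theta>1 - d"] d(1) \<theta>m(1) by (auto simp: C_def I_def abs_le_iff)
  obtain v where v: "v \<in> W" "dist v y < e" using ycl e closure_approachable by blast
  have diff: "norm (C v \<theta> - C y \<theta>) < e" for \<theta>
  proof -
    have "C v \<theta> - C y \<theta> = cis (- \<beta> \<theta>) * (v - y)" by (simp add: C_def algebra_simps)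
    then show ?thesis using v(2) by (simp add: norm_mult dist_norm)
  qed
  have diffs: "\<bar>Re (C v \<theta>) - Re (C y \<theta>)\<bar> < e" "\<bar>Im (C v \<theta>) - Im (C y \<theta>)\<bar> < e" for \<theta>
    using diff[of \<theta>] abs_Re_le_cmod[of "C v \<theta> - C y \<theta>"] abs_Im_le_cmod[of "C v \<theta> - C y \<theta>"] by simp_all
  have "Im (C v (\<theta>1 + d)) < 0" "0 < Im (C v (\<theta>1 - d))"
    using diffs(2)[of "\<theta>1 + d"] diffs(2)[of "\<theta>1 - d"] unfolding e_def by (auto simp: abs_less_iff)
  then obtain \<theta> where \<theta>: "\<theta>1 - d \<le> \<theta>" "\<theta> \<le> \<theta>1 + d" "Im (C v \<theta>) = 0"
    using IVT2'[of "\<lambda>\<theta>. Im (C v \<theta>)" "\<theta>1 + d" 0 "\<theta>1 - d"] contC d(1) by (auto intro: continuous_intros)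
  have pos: "0 < Re (C v \<theta>)" using diffs(1)[of \<theta>] \<theta>m(2)[of \<theta>] \<theta> unfolding e_def by (auto simp: I_def abs_less_iff)
  have "C v \<theta> = of_real (Re (C v \<theta>))" using \<theta>(3) by (simp add: complex_eq_iff)
  moreover have "cis (\<beta> \<theta>) * C v \<theta> = v - \<gamma> \<theta>" by (simp add: C_def cis_mult flip: mult.assoc)
  ultimately have "v = \<gamma> \<theta> + of_real (Re (C v \<theta>)) * cis (\<beta> \<theta>)" by (metis add.commute diff_add_cancel mult.commute)
  then show False using ray_avoids_W[of v \<theta> "Re (C v \<theta>)"] pos v(1) by simp
qed

lemma per_ray:
  "\<gamma> (\<theta> + 2 * pi * of_int n) = \<gamma> \<theta>" "cis (\<beta> (\<theta> + 2 * pi * of_int n)) = cis (\<beta> \<theta>)"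
proof -
  have "Re (\<gamma> (\<theta> + 2 * pi * of_int n)) = Re (\<gamma> \<theta>) + of_int n * 0" "Im (\<gamma> (\<theta> + 2 * pi * of_int n)) = Im (\<gamma> \<theta>) + of_int n * 0"
    by (rule quasi_periodic_int, simp add: per\<gamma>)+
  then show "\<gamma> (\<theta> + 2 * pi * of_int n) = \<gamma> \<theta>" by (simp add: complex_eq_iff)
  have "\<beta> (\<theta> + 2 * pi * of_int n) = \<beta> \<theta> + of_int n * (2 * pi)" by (rule quasi_periodic_int) (rule per\<beta>)
  then have "\<beta> (\<theta> + 2 * pi * of_int n) = \<beta> \<theta> + 2 * pi * of_int n" by simp
  then show "cis (\<beta> (\<theta> + 2 * pi * of_int n)) = cis (\<beta> \<theta>)"
    by (simp add: cis_mult[symmetric] cis_multiple_2pi)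
qed

lemma complement_covered:
  assumes "y \<notin> W"
  shows "\<exists>\<theta> t. t \<ge> 0 \<and> y = \<gamma> \<theta> + of_real t * cis (\<beta> \<theta>)"
proof (cases "y \<in> range \<gamma>")
  case True
  then obtain \<theta> where "y = \<gamma> \<theta>" by blast
  then show ?thesis by (intro exI[of _ \<theta>] exI[of _ 0]) simp
next
  case False
  obtain \<alpha> where \<alpha>: "continuous_on UNIV \<alpha>" "\<And>\<theta>. y - \<gamma> \<theta> = of_real (norm (y - \<gamma> \<theta>)) * cis (\<alpha> \<theta>)"
    "\<And>\<theta>. \<alpha> (\<theta> + 2 * pi) = \<alpha> \<theta>"
    using winding[OF False] assms by auto
  define \<delta> where "\<delta> = (\<lambda>\<theta>. \<beta> \<theta> - \<alpha> \<theta>)"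
  have "continuous_on {0..2 * pi} \<delta>" unfolding \<delta>_def
    by (intro continuous_intros continuous_on_subset[OF cont\<beta>] continuous_on_subset[OF \<alpha>(1)]) auto
  define n where "n = \<lceil>\<delta> 0 / (2 * pi)\<rceil>"
  have "\<delta> 0 / (2 * pi) \<le> of_int n" "of_int n \<le> \<delta> 0 / (2 * pi) + 1" unfolding n_def by linarith+
  then have "\<delta> 0 \<le> 2 * pi * of_int n" "2 * pi * of_int n \<le> \<delta> 0 + 2 * pi" by (simp_all add: field_simps)
  moreover have "\<delta> (2 * pi) = \<delta> 0 + 2 * pi" using per\<beta>[of 0] \<alpha>(3)[of 0] by (simp add: \<delta>_def)
  ultimately obtain \<theta> where "\<delta> \<theta> = 2 * pi * of_int n"
    using IVT'[of \<delta> 0 "2 * pi * of_int n" "2 * pi"] \<open>continuous_on {0..2 * pi} \<delta>\<close> by auto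
  then have "y = \<gamma> \<theta> + of_real (norm (y - \<gamma> \<theta>)) * cis (\<beta> \<theta>)" using ray_through[where \<alpha> = \<alpha>, OF \<alpha>(2)[of \<theta>]] by (simp add: \<delta>_def)
  then show ?thesis by (intro exI[of _ \<theta>] exI[of _ "norm (y - \<gamma> \<theta>)"]) simp
qed

text \<open>Two hits in one period reach levels \<open>n < m\<close>, and after the full period the
  difference exceeds level \<open>m\<close>. But it has then grown by exactly 2 pi, to level
  \<open>n + 1\<close>, so \<open>m < n + 1\<close>.\<close>

lemma rays_disjoint:
  assumes y: "y = \<gamma> \<theta>1 + of_real t1 * cis (\<beta> \<theta>1)" "t1 > 0" "y = \<gamma> \<theta>2 + of_real t2 * cis (\<beta> \<theta>2)" "t2 > 0"
  shows "\<gamma> \<theta>1 = \<gamma> \<theta>2 \<and> cis (\<beta> \<theta>1) = cis (\<beta> \<theta>2)"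
proof -
  obtain k where k: "\<theta>1 \<le> \<theta>2 - 2 * pi * of_int k" "\<theta>2 - 2 * pi * of_int k < \<theta>1 + 2 * pi"
    by (rule real_mod_representative)
  define \<theta>3 where "\<theta>3 = \<theta>2 - 2 * pi * of_int k"
  have same: "\<gamma> \<theta>2 = \<gamma> \<theta>3" "cis (\<beta> \<theta>2) = cis (\<beta> \<theta>3)" using per_ray[of \<theta>3 k] by (simp_all add: \<theta>3_def)
  have "\<theta>3 = \<theta>1"
  proof (rule ccontr)
    assume "\<theta>3 \<noteq> \<theta>1"
    then have lt: "\<theta>1 < \<theta>3" "\<theta>3 < \<theta>1 + 2 * pi" using k by (auto simp: \<theta>3_def)
    have yW: "y \<notin> W" using ray_avoids_W[OF y(1)] y(2) by simp
    have y\<gamma>: "y \<notin> range \<gamma>" by (rule open_ray_avoids_curve[OF y(1,2)])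
    obtain \<alpha> where \<alpha>: "continuous_on UNIV \<alpha>" "\<And>\<theta>. y - \<gamma> \<theta> = of_real (norm (y - \<gamma> \<theta>)) * cis (\<alpha> \<theta>)"
      "\<And>\<theta>. \<alpha> (\<theta> + 2 * pi) = \<alpha> \<theta>"
      using winding[OF y\<gamma>] yW by auto
    obtain n where n: "\<beta> \<theta>1 - \<alpha> \<theta>1 = 2 * pi * of_int n" using angle_on_ray[where \<alpha> = \<alpha>, OF y(1,2) \<alpha>(2)[of \<theta>1]] by blast
    obtain m where m: "\<beta> \<theta>3 - \<alpha> \<theta>3 = 2 * pi * of_int m"
      using angle_on_ray[where \<alpha> = \<alpha>, OF y(3)[unfolded same] y(4) \<alpha>(2)[of \<theta>3]] by blast
    have "2 * pi * of_int n < \<beta> \<theta>3 - \<alpha> \<theta>3" by (rule angle_stays_above[OF \<alpha>(1,2) y\<gamma> n lt(1)])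
    then have "n < m" unfolding m by simp
    have "2 * pi * of_int m < \<beta> (\<theta>1 + 2 * pi) - \<alpha> (\<theta>1 + 2 * pi)" by (rule angle_stays_above[OF \<alpha>(1,2) y\<gamma> m lt(2)])
    also have "\<dots> = 2 * pi * of_int (n + 1)" unfolding per\<beta> \<alpha>(3) using n by (simp add: algebra_simps)
    finally have "real_of_int m < of_int (n + 1)" by (simp add: mult_less_cancel_left_pos)
    then have "m < n + 1" by (simp only: of_int_less_iff)
    then show False using \<open>n < m\<close> by simp
  qed
  then show ?thesis using same by simp
qed

lemma close_to_convex:
  assumes "open W" "connected W" "W \<noteq> {}"
  shows "close_to_convex_domain W"
proof -
  define L where "L = range (\<lambda>\<theta>. (\<gamma> \<theta>, cis (\<beta> \<theta>)))"
  have "L \<subseteq> UNIV \<times> sphere 0 1" by (auto simp: L_def)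
  moreover have "- W = (\<Union>(a, u)\<in>L. closed_half_line a u)"
  proof (rule set_eqI)
    fix y
    show "y \<in> - W \<longleftrightarrow> y \<in> (\<Union>(a, u)\<in>L. closed_half_line a u)"
      using complement_covered[of y] ray_avoids_W[of y] unfolding L_def closed_half_line_def by auto
  qed
  moreover have "disjoint_family_on (\<lambda>(a, u). open_half_line a u) L"
    unfolding disjoint_family_on_def
  proof (intro ballI impI)
    fix x x' assume x: "x \<in> L" "x' \<in> L" "x \<noteq> x'"
    then obtain \<theta> \<theta>' where \<theta>: "x = (\<gamma> \<theta>, cis (\<beta> \<theta>))" "x' = (\<gamma> \<theta>', cis (\<beta> \<theta>'))" by (auto simp: L_def)
    show "(case x of (a, u) \<Rightarrow> open_half_line a u) \<inter> (case x' of (a, u) \<Rightarrow> open_half_line a u) = {}"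
    proof (rule ccontr)
      assume "\<not> ?thesis"
      then obtain y where "y \<in> open_half_line (\<gamma> \<theta>) (cis (\<beta> \<theta>))" "y \<in> open_half_line (\<gamma> \<theta>') (cis (\<beta> \<theta>'))"
        unfolding \<theta> by auto
      then obtain t t' where "y = \<gamma> \<theta> + of_real t * cis (\<beta> \<theta>)" "t > 0" "y = \<gamma> \<theta>' + of_real t' * cis (\<beta> \<theta>')" "t' > 0"
        unfolding open_half_line_def by blast
      from rays_disjoint[OF this] show False using x(3) \<theta> by simp
    qed
  qed
  ultimately show ?thesis unfolding close_to_convex_domain_def using assms by blast
qed

end

section \<open>Increasing unions of close-to-convex domains\<close>

text \<open>Origins of half-lines may escape to infinity in a limit, but directions form a compact
  set. So only a direction field on the complement is kept, every point being given the direction of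
  one half-line containing it.\<close>

lemma close_to_convex_directions:
  assumes "close_to_convex_domain D"
  obtains u where "\<And>w. norm (u w) = 1" "\<And>w t. \<lbrakk>w \<notin> D; t \<ge> 0\<rbrakk> \<Longrightarrow> w + of_real t * u w \<notin> D"
    "\<And>w w' t t'. \<lbrakk>w \<notin> D; w' \<notin> D; t > 0; t' > 0; w + of_real t * u w = w' + of_real t' * u w'\<rbrakk> \<Longrightarrow> u w = u w'"
proof -
  obtain L where L: "L \<subseteq> UNIV \<times> sphere 0 1" "- D = (\<Union>(a, u)\<in>L. closed_half_line a u)"
    "disjoint_family_on (\<lambda>(a, u). open_half_line a u) L"
    using assms unfolding close_to_convex_domain_def by blast
  \<comment> \<open>The default direction 1 inside \<open>D\<close> makes the field unimodular
    everywhere, as a point of a product of circles.\<close>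
  have "\<exists>x. (w \<notin> D \<longrightarrow> x \<in> L \<and> w \<in> closed_half_line (fst x) (snd x)) \<and> (w \<in> D \<longrightarrow> x = (0, 1))" for w
  proof (cases "w \<in> D")
    case False
    then have "w \<in> (\<Union>(a, u)\<in>L. closed_half_line a u)" using L(2) by blast
    then obtain x where "x \<in> L" "w \<in> closed_half_line (fst x) (snd x)" by auto
    then show ?thesis using False by blast
  qed simp
  then obtain x where x: "\<And>w. w \<notin> D \<Longrightarrow> x w \<in> L \<and> w \<in> closed_half_line (fst (x w)) (snd (x w))" "\<And>w. w \<in> D \<Longrightarrow> x w = (0, 1)"
    by metis
  define u where "u = (\<lambda>w. snd (x w))"
  have norm: "norm (u w) = 1" for w
  proof (cases "w \<in> D")
    case False
    then have "x w \<in> UNIV \<times> sphere 0 1" using x(1) L(1) by blast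
    then show ?thesis by (auto simp: u_def)
  qed (simp add: u_def x(2))
  have onray: "\<exists>s\<ge>0. w = fst (x w) + of_real s * u w" if "w \<notin> D" for w
    using x(1)[OF that] by (auto simp: closed_half_line_def u_def)
  have shifted: "\<exists>s\<ge>0. \<forall>t. w + of_real t * u w = fst (x w) + of_real (s + t) * u w" if "w \<notin> D" for w
  proof -
    from onray[OF that] obtain s where s: "s \<ge> 0" "w = fst (x w) + of_real s * u w" by blast
    have "w + of_real t * u w = fst (x w) + of_real (s + t) * u w" for t
      by (subst s(2)) (simp add: algebra_simps)
    then show ?thesis using s(1) by blast
  qed
  show ?thesis
  proof (rule that[of u])
    fix w and t :: real assume w: "w \<notin> D" and t: "t \<ge> 0"
    then obtain s where s: "s \<ge> 0" "w + of_real t * u w = fst (x w) + of_real (s + t) * u w" using shifted by blast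
    then have "w + of_real t * u w \<in> closed_half_line (fst (x w)) (snd (x w))"
      unfolding closed_half_line_def u_def using t by (intro CollectI exI[of _ "s + t"]) auto
    then have "w + of_real t * u w \<in> (\<Union>(a, u)\<in>L. closed_half_line a u)" using x(1)[OF w] by force
    then show "w + of_real t * u w \<notin> D" using L(2) by blast
  next
    fix w w' and t t' :: real
    assume w: "w \<notin> D" "w' \<notin> D" and t: "t > 0" "t' > 0" and eq: "w + of_real t * u w = w' + of_real t' * u w'"
    have open_ray: "w + of_real t * u w \<in> (\<lambda>(a, u). open_half_line a u) (x w)" if "w \<notin> D" "t > 0" for w and t :: real
    proof -
      from shifted[OF that(1)] obtain s where s: "s \<ge> 0" "w + of_real t * u w = fst (x w) + of_real (s + t) * u w" by blast
      then have "w + of_real t * u w \<in> open_half_line (fst (x w)) (snd (x w))"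
        unfolding open_half_line_def u_def using that by (intro CollectI exI[of _ "s + t"]) auto
      then show ?thesis by (simp add: split_beta)
    qed
    have "x w = x w'"
    proof (rule ccontr)
      assume neq: "x w \<noteq> x w'"
      have "x w \<in> L" "x w' \<in> L" using x(1) w by blast+
      from disjoint_family_onD[OF L(3) this neq]
      have "(\<lambda>(a, u). open_half_line a u) (x w) \<inter> (\<lambda>(a, u). open_half_line a u) (x w') = {}" .
      then show False using open_ray[OF w(1) t(1)] open_ray[OF w(2) t(2)] eq by auto
    qed
    then show "u w = u w'" by (simp add: u_def)
  qed (rule norm)
qed

text \<open>In a limit two half-lines may overlap in opposite directions on the same line, so
  \<open>cross\<close> admits \<open>- u w\<close>. Points joined along a common line by equal or
  opposite directions form a class; each class is replaced by at most two half-lines on its line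
  with disjoint open parts, and open half-lines of different classes do not meet.\<close>

lemma directions_close_to_convex:
  assumes D: "open D" "connected D" "D \<noteq> {}"
    and u: "\<And>w. w \<notin> D \<Longrightarrow> norm (u w) = 1"
    and ray: "\<And>w t. \<lbrakk>w \<notin> D; t \<ge> 0\<rbrakk> \<Longrightarrow> w + of_real t * u w \<notin> D"
    and cross: "\<And>w w' t t'. \<lbrakk>w \<notin> D; w' \<notin> D; t > 0; t' > 0; w + of_real t * u w = w' + of_real t' * u w'\<rbrakk>
        \<Longrightarrow> u w' = u w \<or> u w' = - u w"
  shows "close_to_convex_domain D"
proof -
  define E where "E = (\<lambda>x y. x \<notin> D \<and> y \<notin> D \<and> (u y = u x \<or> u y = - u x) \<and> (\<exists>s::real. y = x + of_real s * u x))"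
  have E_refl: "E x x" if "x \<notin> D" for x using that by (auto simp: E_def intro!: exI[of _ 0])
  have E_sym: "E y x" if "E x y" for x y
  proof -
    from that obtain s :: real where s: "y = x + of_real s * u x" by (auto simp: E_def)
    from that consider "u y = u x" | "u y = - u x" by (auto simp: E_def)
    then have "\<exists>s::real. x = y + of_real s * u y"
    proof cases
      case 1 then show ?thesis by (intro exI[of _ "- s"]) (simp add: s)
    next
      case 2 then show ?thesis by (intro exI[of _ s]) (simp add: s)
    qed
    moreover have "x \<notin> D" "y \<notin> D" "u x = u y \<or> u x = - u y" using that by (auto simp: E_def)
    ultimately show ?thesis by (simp add: E_def)
  qed
  have E_trans: "E x z" if xy: "E x y" and yz: "E y z" for x y z
  proof -
    obtain s :: real where s: "y = x + of_real s * u x" using xy by (auto simp: E_def)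
    obtain t :: real where t: "z = y + of_real t * u y" using yz by (auto simp: E_def)
    from xy consider "u y = u x" | "u y = - u x" by (auto simp: E_def)
    then have "\<exists>s::real. z = x + of_real s * u x"
    proof cases
      case 1 then show ?thesis by (intro exI[of _ "s + t"]) (simp add: s t algebra_simps)
    next
      case 2 then show ?thesis by (intro exI[of _ "s - t"]) (simp add: s t algebra_simps)
    qed
    then show ?thesis using xy yz by (auto simp: E_def)
  qed
  \<comment> \<open>One representative per class, so that each class contributes its half-lines only
    once.\<close>
  define rep where "rep = (\<lambda>x. SOME y. E x y)"
  have rep: "E x (rep x)" if "x \<notin> D" for x unfolding rep_def using E_refl[OF that] by (rule someI)
  have rep_eq: "rep x = rep y" if "E x y" for x y
  proof -
    have "E x = E y" using that E_sym E_trans by (intro ext) blast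
    then show ?thesis by (simp add: rep_def)
  qed
  define pt where "pt = (\<lambda>w (s::real). w + of_real s * u w)"
  \<comment> \<open>Parameters along the line through \<open>w\<close> at which the assigned
    direction is that of \<open>w\<close> (\<open>Fw\<close>) or the opposite one
    (\<open>Bw\<close>).\<close>
  define Fw where "Fw = (\<lambda>w. {s. pt w s \<notin> D \<and> u (pt w s) = u w})"
  define Bw where "Bw = (\<lambda>w. {s. pt w s \<notin> D \<and> u (pt w s) = - u w})"
  define U where "U = (\<lambda>w. (\<Union>s\<in>Fw w. {s<..}) \<union> (\<Union>s\<in>Bw w. {..<s}))"
  \<comment> \<open>If the open rays of a class cover the line, it is cut at \<open>w\<close>.
    Otherwise an uncovered parameter separates \<open>Bw\<close> from \<open>Fw\<close>, and the two
    extreme rays remain.\<close>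
  define fam where "fam = (\<lambda>w. if U w = UNIV then {(w, u w), (w, - u w)}
      else insert (pt w (Inf (Fw w)), u w) (if Bw w = {} then {} else {(pt w (Sup (Bw w)), - u w)}))"
  have E_pt: "E w (pt w s)" if "w \<notin> D" "s \<in> Fw w \<union> Bw w" for w s
    using that by (auto simp: E_def Fw_def Bw_def pt_def)
  have E_index: "\<exists>s\<in>Fw w \<union> Bw w. x = pt w s" if "E w x" for w x
    using that by (auto simp: E_def Fw_def Bw_def pt_def)
  have zero: "0 \<in> Fw w" if "w \<notin> D" for w using that by (simp add: Fw_def pt_def)
  have reach: "\<exists>x t. E w x \<and> t > 0 \<and> pt w s = x + of_real t * u x" if w: "w \<notin> D" and s: "s \<in> U w" for w s
  proof -
    from s consider s0 where "s0 \<in> Fw w" "s0 < s" | s0 where "s0 \<in> Bw w" "s < s0" by (auto simp: U_def)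
    then show ?thesis
    proof cases
      case 1
      then show ?thesis using E_pt[OF w, of s0]
        by (intro exI[of _ "pt w s0"] exI[of _ "s - s0"]) (auto simp: Fw_def pt_def algebra_simps)
    next
      case 2
      then show ?thesis using E_pt[OF w, of s0]
        by (intro exI[of _ "pt w s0"] exI[of _ "s0 - s"]) (auto simp: Bw_def pt_def algebra_simps)
    qed
  qed
  have U_C: "pt w s \<notin> D" if w: "w \<notin> D" and s: "s \<in> U w" for w s
  proof -
    obtain x t where "E w x" "t > 0" "pt w s = x + of_real t * u x" using reach[OF w s] by blast
    then show ?thesis using ray[of x t] by (simp add: E_def)
  qed
  have U_meet: "E w w'" if w: "w \<notin> D" "w' \<notin> D" and s: "s \<in> U w" "s' \<in> U w'" and eq: "pt w s = pt w' s'" for w w' s s'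
  proof -
    obtain x t where x: "E w x" "t > 0" "pt w s = x + of_real t * u x" using reach[OF w(1) s(1)] by blast
    obtain x' t' where x': "E w' x'" "t' > 0" "pt w' s' = x' + of_real t' * u x'" using reach[OF w(2) s(2)] by blast
    have C: "x \<notin> D" "x' \<notin> D" using x(1) x'(1) by (auto simp: E_def)
    have eq': "x + of_real t * u x = x' + of_real t' * u x'" using eq x(3) x'(3) by simp
    have dir: "u x' = u x \<or> u x' = - u x" by (rule cross[OF C x(2) x'(2) eq'])
    moreover have "\<exists>s::real. x' = x + of_real s * u x"
    proof -
      from dir show ?thesis
      proof
        assume "u x' = u x" then show ?thesis using eq' by (intro exI[of _ "t - t'"]) (simp add: algebra_simps)
      next
        assume "u x' = - u x" then show ?thesis using eq' by (intro exI[of _ "t + t'"]) (simp add: algebra_simps)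
      qed
    qed
    ultimately have "E x x'" using C by (auto simp: E_def)
    then show ?thesis using x(1) x'(1) E_sym E_trans by blast
  qed
  have split: "bdd_below (Fw w)" "bdd_above (Bw w)" "Bw w \<noteq> {} \<Longrightarrow> Sup (Bw w) \<le> Inf (Fw w)"
    if w: "w \<notin> D" and full: "U w \<noteq> UNIV" for w
  proof -
    obtain c where "c \<notin> U w" using full by blast
    then have c: "\<And>s. s \<in> Fw w \<Longrightarrow> c \<le> s" "\<And>s. s \<in> Bw w \<Longrightarrow> s \<le> c" by (auto simp: U_def not_less)
    show "bdd_below (Fw w)" by (rule bdd_belowI[of _ c]) (rule c(1))
    show "bdd_above (Bw w)" by (rule bdd_aboveI[of _ c]) (rule c(2))
    have "c \<le> Inf (Fw w)" using zero[OF w] c by (intro cInf_greatest) auto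
    moreover have "Sup (Bw w) \<le> c" if "Bw w \<noteq> {}" using that c by (intro cSup_least) auto
    ultimately show "Sup (Bw w) \<le> Inf (Fw w)" if "Bw w \<noteq> {}" using that by force
  qed
  have shift: "pt w a + of_real t * u w = pt w (a + t)" "pt w a + of_real t * (- u w) = pt w (a - t)" for w a t
    by (simp_all add: pt_def algebra_simps)
  have openF: "open_half_line (pt w a) (u w) = pt w ` {a<..}" for w a
  proof (intro set_eqI iffI)
    fix y assume "y \<in> open_half_line (pt w a) (u w)"
    then obtain t where "t > 0" "y = pt w (a + t)" by (auto simp: open_half_line_def shift)
    then show "y \<in> pt w ` {a<..}" by auto
  next
    fix y assume "y \<in> pt w ` {a<..}"
    then obtain s where "s > a" "y = pt w s" by auto
    then show "y \<in> open_half_line (pt w a) (u w)" unfolding open_half_line_def shift by (intro CollectI exI[of _ "s - a"]) auto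
  qed
  have openB: "open_half_line (pt w a) (- u w) = pt w ` {..<a}" for w a
  proof (intro set_eqI iffI)
    fix y assume "y \<in> open_half_line (pt w a) (- u w)"
    then obtain t where "t > 0" "y = pt w (a - t)" unfolding open_half_line_def shift by auto
    then show "y \<in> pt w ` {..<a}" by auto
  next
    fix y assume "y \<in> pt w ` {..<a}"
    then obtain s where "s < a" "y = pt w s" by auto
    then show "y \<in> open_half_line (pt w a) (- u w)" unfolding open_half_line_def shift by (intro CollectI exI[of _ "a - s"]) auto
  qed
  have closed_ins: "closed_half_line a v = insert a (open_half_line a v)" for a v
    unfolding closed_half_line_def open_half_line_def by (force simp: order_le_less)
  have pt0: "pt w 0 = w" for w by (simp add: pt_def)
  have fam_cases: "\<exists>a. (x = (pt w a, u w) \<and> {a<..} \<subseteq> U w) \<or> (x = (pt w a, - u w) \<and> {..<a} \<subseteq> U w)"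
    if w: "w \<notin> D" and x: "x \<in> fam w" for w x
  proof (cases "U w = UNIV")
    case True
    then show ?thesis using x by (auto simp: fam_def pt0 intro!: exI[of _ 0])
  next
    case False
    have F: "{Inf (Fw w)<..} \<subseteq> U w"
    proof
      fix s assume "s \<in> {Inf (Fw w)<..}"
      then obtain s0 where "s0 \<in> Fw w" "s0 < s" using cInf_less_iff[OF _ split(1)[OF w False], of s] zero[OF w] by auto
      then show "s \<in> U w" by (auto simp: U_def)
    qed
    have B: "{..<Sup (Bw w)} \<subseteq> U w" if neB: "Bw w \<noteq> {}"
    proof
      fix s assume "s \<in> {..<Sup (Bw w)}"
      then obtain s0 where "s0 \<in> Bw w" "s < s0" using less_cSup_iff[OF neB split(2)[OF w False], of s] by auto
      then show "s \<in> U w" by (auto simp: U_def)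
    qed
    have "x = (pt w (Inf (Fw w)), u w) \<or> (Bw w \<noteq> {} \<and> x = (pt w (Sup (Bw w)), - u w))"
      using x False by (simp add: fam_def split: if_splits)
    then show ?thesis
    proof (elim disjE conjE)
      assume "x = (pt w (Inf (Fw w)), u w)"
      then show ?thesis using F by blast
    next
      assume "Bw w \<noteq> {}" "x = (pt w (Sup (Bw w)), - u w)"
      then show ?thesis using B by blast
    qed
  qed
  have fam_open: "open_half_line a v \<subseteq> pt w ` U w" "norm v = 1" if w: "w \<notin> D" and av: "(a, v) \<in> fam w" for w a v
  proof -
    from fam_cases[OF w av] obtain b where
      "((a, v) = (pt w b, u w) \<and> {b<..} \<subseteq> U w) \<or> ((a, v) = (pt w b, - u w) \<and> {..<b} \<subseteq> U w)" by blast
    then consider "a = pt w b" "v = u w" "{b<..} \<subseteq> U w" | "a = pt w b" "v = - u w" "{..<b} \<subseteq> U w" by auto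
    then have "open_half_line a v \<subseteq> pt w ` U w \<and> norm v = 1"
    proof cases
      case 1 then show ?thesis using u[OF w] by (simp add: openF image_mono)
    next
      case 2 then show ?thesis using u[OF w] by (simp add: openB image_mono)
    qed
    then show "open_half_line a v \<subseteq> pt w ` U w" "norm v = 1" by blast+
  qed
  have fam_closed: "closed_half_line a v \<subseteq> - D" if w: "w \<notin> D" and av: "(a, v) \<in> fam w" for w a v
  proof -
    have op: "open_half_line a v \<subseteq> - D" using fam_open(1)[OF w av] U_C[OF w] by auto
    \<comment> \<open>The origin need not belong to the class; it is a limit of points of the open
      half-line, and the complement is closed.\<close>
    have "(\<lambda>n. a + of_real (inverse (real (Suc n))) * v) \<longlonglongrightarrow> a + of_real 0 * v"
      by (intro tendsto_intros tendsto_of_real LIMSEQ_inverse_real_of_nat)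
    moreover have "a + of_real (inverse (real (Suc n))) * v \<in> - D" for n
    proof (rule subsetD[OF op])
      have "inverse (real (Suc n)) > 0" by simp
      then show "a + of_real (inverse (real (Suc n))) * v \<in> open_half_line a v" unfolding open_half_line_def by blast
    qed
    ultimately have "a \<in> - D" using D(1) closed_sequentially[of "- D"] by (metis closed_Compl add_cancel_right_right mult_zero_left of_real_0)
    then show ?thesis unfolding closed_ins using op by simp
  qed
  have fam_cover: "\<exists>(a, v)\<in>fam w. x \<in> closed_half_line a v" if w: "w \<notin> D" and x: "E w x" for w x
  proof -
    obtain s where s: "s \<in> Fw w \<union> Bw w" "x = pt w s" using E_index[OF x] by blast
    show ?thesis
    proof (cases "U w = UNIV")
      case True
      have "x \<in> closed_half_line (pt w 0) (u w) \<or> x \<in> closed_half_line (pt w 0) (- u w)"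
        unfolding closed_ins openF openB s(2) by (cases "s = 0"; cases "s > 0") auto
      then show ?thesis using True by (auto simp: fam_def pt0)
    next
      case False
      show ?thesis
      proof (cases "s \<in> Fw w")
        case True
        then have "Inf (Fw w) \<le> s" using split(1)[OF w False] by (simp add: cInf_lower)
        then have "x \<in> closed_half_line (pt w (Inf (Fw w))) (u w)" unfolding closed_ins openF s(2) by (cases "s = Inf (Fw w)") auto
        then show ?thesis using False by (auto simp: fam_def)
      next
        case sB: False
        then have "s \<in> Bw w" using s(1) by blast
        then have "s \<le> Sup (Bw w)" using split(2)[OF w False] by (simp add: cSup_upper)
        then have "x \<in> closed_half_line (pt w (Sup (Bw w))) (- u w)" unfolding closed_ins openB s(2) by (cases "s = Sup (Bw w)") auto
        then show ?thesis using False \<open>s \<in> Bw w\<close> by (auto simp: fam_def)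
      qed
    qed
  qed
  have fam_disj: "open_half_line a v \<inter> open_half_line a' v' = {}"
    if w: "w \<notin> D" and av: "(a, v) \<in> fam w" "(a', v') \<in> fam w" "(a, v) \<noteq> (a', v')" for w a v a' v'
  proof -
    have inj: "pt w s = pt w s' \<longleftrightarrow> s = s'" for s s'
      using u[OF w] by (auto simp: pt_def)
    have opp: "open_half_line (pt w a) (u w) \<inter> open_half_line (pt w b) (- u w) = {}" if "b \<le> a" for a b
      unfolding openF openB using inj that by auto
    show ?thesis
    proof (cases "U w = UNIV")
      case True
      then show ?thesis using av opp[of 0 0] by (auto simp: fam_def pt0)
    next
      case False
      then show ?thesis using av opp[OF split(3)[OF w False]] by (auto simp: fam_def split: if_splits)
    qed
  qed
  define L where "L = (\<Union>x\<in>- D. fam (rep x))"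
  have repD: "rep x \<notin> D" if "x \<notin> D" for x using rep[OF that] by (simp add: E_def)
  have "L \<subseteq> UNIV \<times> sphere 0 1"   proof
    fix b assume "b \<in> L"
    then obtain x where x1: "x \<notin> D" "b \<in> fam (rep x)" unfolding L_def by blast
    obtain a v where "b = (a, v)" by (cases b)
    with x1 have x: "x \<notin> D" "b = (a, v)" "(a, v) \<in> fam (rep x)" by simp_all
    then show "b \<in> UNIV \<times> sphere 0 1" using fam_open(2)[OF repD[OF x(1)] x(3)] by simp
  qed
  moreover have "- D = (\<Union>(a, v)\<in>L. closed_half_line a v)"
  proof (intro equalityI subsetI)
    fix x assume "x \<in> - D"
    then have x: "x \<notin> D" by simp
    have "\<exists>(a, v)\<in>fam (rep x). x \<in> closed_half_line a v" by (rule fam_cover[OF repD[OF x] E_sym[OF rep[OF x]]])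
    then show "x \<in> (\<Union>(a, v)\<in>L. closed_half_line a v)" using x unfolding L_def by blast
  next
    fix x assume "x \<in> (\<Union>(a, v)\<in>L. closed_half_line a v)"
    then obtain y a v where "y \<notin> D" "(a, v) \<in> fam (rep y)" "x \<in> closed_half_line a v" unfolding L_def by auto
    then show "x \<in> - D" using fam_closed repD by blast
  qed
  moreover have "disjoint_family_on (\<lambda>(a, v). open_half_line a v) L"
    unfolding disjoint_family_on_def
  proof (intro ballI impI)
    fix b b' assume b: "b \<in> L" "b' \<in> L" "b \<noteq> b'"
    obtain a v a' v' where bb: "b = (a, v)" "b' = (a', v')" by (cases b, cases b') blast
    obtain y y' where y: "y \<notin> D" "(a, v) \<in> fam (rep y)" "y' \<notin> D" "(a', v') \<in> fam (rep y')"
      using b(1,2) unfolding L_def bb by auto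
    have "open_half_line a v \<inter> open_half_line a' v' = {}"
    proof (rule ccontr)
      assume ne: "\<not> ?thesis"
      then obtain s s' where "s \<in> U (rep y)" "s' \<in> U (rep y')" "pt (rep y) s = pt (rep y') s'"
        using fam_open(1)[OF repD[OF y(1)] y(2)] fam_open(1)[OF repD[OF y(3)] y(4)] by blast
      then have "E (rep y) (rep y')" using U_meet repD y by blast
      then have "E y y'" using rep[OF y(1)] rep[OF y(3)] E_sym E_trans by blast
      then have "rep y = rep y'" by (rule rep_eq)
      then show False using fam_disj[OF repD[OF y(1)] y(2), of a' v'] y(4) b(3) ne bb by simp
    qed
    then show "(case b of (a, v) \<Rightarrow> open_half_line a v) \<inter> (case b' of (a, v) \<Rightarrow> open_half_line a v) = {}"
      by (simp add: bb)
  qed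
  ultimately show ?thesis unfolding close_to_convex_domain_def using D by blast
qed

text \<open>Cramer's rule for \<open>s * a - s' * b = v\<close>. With \<open>a\<close>,
  \<open>b\<close> the directions of two half-lines and \<open>v\<close> the difference of their
  origins it gives the parameters of the crossing point.\<close>

lemma cross_product_solution:
  fixes a b v :: complex
  assumes "Im (cnj b * a) \<noteq> 0"
  shows "of_real (Im (cnj b * v) / Im (cnj b * a)) * a - of_real (Im (cnj a * v) / Im (cnj b * a)) * b = v"
proof -
  define k where "k = Im (cnj b * a)"
  have "of_real (Im (cnj b * v)) * a - of_real (Im (cnj a * v)) * b = of_real k * v"
    by (simp add: complex_eq_iff k_def algebra_simps)
  then have "(of_real (Im (cnj b * v)) * a - of_real (Im (cnj a * v)) * b) / of_real k = v"
    using assms unfolding k_def[symmetric] by (simp only: nonzero_mult_div_cancel_left of_real_eq_0_iff not_False_eq_True)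
  then show ?thesis unfolding k_def[symmetric] by (simp only: diff_divide_distrib of_real_divide times_divide_eq_left)
qed

lemma unimodular_parallel:
  fixes a b :: complex
  assumes a: "norm a = 1" and b: "norm b = 1" and "Im (cnj b * a) = 0"
  shows "b = a \<or> b = - a"
proof -
  have "norm (cnj b * a) = 1" using a b by (simp add: norm_mult)
  then have "\<bar>Re (cnj b * a)\<bar> = 1" using assms(3) unfolding cmod_def by (simp only: power_zero_numeral add_0_right real_sqrt_abs)
  then have "cnj b * a = 1 \<or> cnj b * a = - 1" using assms(3) by (auto simp: complex_eq_iff abs_if split: if_splits)
  moreover have "b * (cnj b * a) = a" using complex_norm_square[of b] b by (simp flip: mult.assoc)
  ultimately have "b * 1 = a \<or> b * (- 1) = a" by metis
  then show ?thesis by auto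
qed

text \<open>Tychonoff's theorem provides a cluster point of the direction fields of the approximating
  domains. Transversal crossings are stable under perturbation, so none can appear in the limit.\<close>

lemma close_to_convex_increasing_union:
  fixes D :: "nat \<Rightarrow> complex set"
  assumes ctc: "\<And>n. close_to_convex_domain (D n)" and inc: "incseq D"
  shows "close_to_convex_domain (\<Union>n. D n)"
proof -
  have opn: "open (D n)" and conn: "connected (D n)" and ne: "D n \<noteq> {}" for n
    using ctc[of n] by (auto simp: close_to_convex_domain_def)
  have "\<exists>u. (\<forall>w. norm (u w) = 1) \<and> (\<forall>w t. w \<notin> D n \<longrightarrow> t \<ge> 0 \<longrightarrow> w + of_real t * u w \<notin> D n) \<and>
    (\<forall>w w' t t'. w \<notin> D n \<longrightarrow> w' \<notin> D n \<longrightarrow> t > 0 \<longrightarrow> t' > 0 \<longrightarrow> w + of_real t * u w = w' + of_real t' * u w' \<longrightarrow> u w = u w')" for n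
    using close_to_convex_directions[OF ctc[of n]] by metis
  then obtain u where u1: "\<And>n w. norm (u n w) = 1"
    and ray: "\<And>n w t. w \<notin> D n \<Longrightarrow> t \<ge> 0 \<Longrightarrow> w + of_real t * u n w \<notin> D n"
    and cross: "\<And>n w w' t t'. w \<notin> D n \<Longrightarrow> w' \<notin> D n \<Longrightarrow> t > 0 \<Longrightarrow> t' > 0 \<Longrightarrow>
        w + of_real t * u n w = w' + of_real t' * u n w' \<Longrightarrow> u n w = u n w'"
    by metis
  define K where "K = (Pi\<^sub>E UNIV (\<lambda>_. sphere 0 1) :: (complex \<Rightarrow> complex) set)"
  have "compactin (product_topology (\<lambda>_. euclidean) UNIV) K"
    unfolding K_def by (subst compactin_PiE) simp
  then have "compact K" by (simp add: euclidean_product_topology)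
  moreover have "eventually (\<lambda>x. x \<in> K) (filtermap u sequentially)"
    unfolding eventually_filtermap K_def using u1 by (intro always_eventually) (simp add: PiE_UNIV_domain)
  moreover have "filtermap u sequentially \<noteq> bot" by (simp add: filtermap_bot_iff)
  ultimately obtain U where U: "U \<in> K" "inf (nhds U) (filtermap u sequentially) \<noteq> bot"
    unfolding compact_filter by blast
  have U1: "norm (U w) = 1" for w using U(1) by (auto simp: K_def)
  \<comment> \<open>A cluster point controls finitely many coordinates along the sequence; two at a
    time suffice, as a crossing involves two points only.\<close>
  have freq: "\<exists>n\<ge>N. dist (u n w) (U w) < e \<and> dist (u n w') (U w') < e" if e: "e > 0" for N w w' e
  proof (rule ccontr)
    assume neg: "\<not> ?thesis"
    define O' where "O' = {g. dist (g w) (U w) < e \<and> dist (g w') (U w') < e}"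
    have "open O'" unfolding O'_def
      by (intro open_Collect_conj open_Collect_less continuous_intros continuous_on_product_coordinates)
    then have "eventually (\<lambda>g. g \<in> O') (nhds U)" using e by (intro eventually_nhds_in_open) (auto simp: O'_def)
    moreover have "eventually (\<lambda>n. u n \<notin> O') sequentially"
      using neg unfolding eventually_sequentially O'_def by blast
    then have "eventually (\<lambda>g. g \<notin> O') (filtermap u sequentially)" by (simp add: eventually_filtermap)
    ultimately have "eventually (\<lambda>g. False) (inf (nhds U) (filtermap u sequentially))"
      unfolding eventually_inf by blast
    then show False using U(2) by (simp add: trivial_limit_def)
  qed
  define E where "E = (\<Union>n. D n)"
  have notE: "w \<notin> D n" if "w \<notin> E" for w n using that by (auto simp: E_def)
  have rayE: "w + of_real t * U w \<notin> E" if w: "w \<notin> E" and t: "t \<ge> 0" for w t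
  proof
    assume "w + of_real t * U w \<in> E"
    then obtain N where N: "w + of_real t * U w \<in> D N" by (auto simp: E_def)
    then obtain e where e: "e > 0" "ball (w + of_real t * U w) e \<subseteq> D N" using opn openE by blast
    \<comment> \<open>The summand 1 avoids division by zero for \<open>t = 0\<close>.\<close>
    obtain n where n: "n \<ge> N" "dist (u n w) (U w) < e / (t + 1)" using freq[of "e / (t + 1)" N w w] e t by auto
    have "dist (w + of_real t * U w) (w + of_real t * u n w) = t * dist (u n w) (U w)"
    proof -
      have "(w + of_real t * U w) - (w + of_real t * u n w) = of_real t * (U w - u n w)" by (simp add: algebra_simps)
      then show ?thesis using t by (simp add: dist_norm norm_mult norm_minus_commute)
    qed
    also have "\<dots> \<le> t * (e / (t + 1))" using n(2) t by (intro mult_left_mono) auto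
    also have "\<dots> < e" using e(1) t by (simp add: field_simps)
    finally have "w + of_real t * u n w \<in> D N" using e(2) by auto
    then have "w + of_real t * u n w \<in> D n" using inc n(1) by (meson incseqD subsetD)
    then show False using ray[OF notE[OF w] t] by blast
  qed
  have crossE: "U w' = U w \<or> U w' = - U w"
    if w: "w \<notin> E" "w' \<notin> E" and t: "t > 0" "t' > 0" and eq: "w + of_real t * U w = w' + of_real t' * U w'" for w w' t t'
  proof (rule unimodular_parallel[OF U1 U1], rule ccontr)
    assume k0: "Im (cnj (U w') * U w) \<noteq> 0"
    define v where "v = w' - w"
    define k where "k = (\<lambda>x::complex \<times> complex. Im (cnj (snd x) * fst x))"
    \<comment> \<open>The parameters of the crossing, \<open>s\<close> and \<open>s'\<close>, as
      functions of the two directions. They are continuous and positive at the limit pair, hence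
      positive for a nearby pair of the sequence.\<close>
    define s where "s = (\<lambda>x::complex \<times> complex. Im (cnj (snd x) * v) / k x)"
    define s' where "s' = (\<lambda>x::complex \<times> complex. Im (cnj (fst x) * v) / k x)"
    define x0 where "x0 = (U w, U w')"
    have v: "v = of_real t * U w - of_real t' * U w'" using eq by (simp add: v_def algebra_simps)
    have kx0: "k x0 \<noteq> 0" using k0 by (simp add: k_def x0_def)
    have "cnj (U w') * v = of_real t * (cnj (U w') * U w) - of_real t' * (cnj (U w') * U w')"
      by (simp add: v algebra_simps)
    then have "Im (cnj (U w') * v) = t * k x0" by (simp add: k_def x0_def)
    then have s0: "s x0 = t" using kx0 by (simp add: s_def x0_def)
    have "Im (cnj (U w) * v) = t' * k x0"
      by (simp add: v k_def x0_def algebra_simps)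
    then have s'0: "s' x0 = t'" using kx0 by (simp add: s'_def x0_def)
    have contk: "isCont k x0" unfolding k_def
      by (auto intro!: continuous_intros)
    have conts: "isCont s x0" "isCont s' x0" unfolding s_def s'_def
      using kx0 by (auto intro!: continuous_intros contk)
    have "eventually (\<lambda>x. 0 < s x) (nhds x0)" "eventually (\<lambda>x. 0 < s' x) (nhds x0)"
      using conts s0 s'0 t by (auto simp: continuous_at_imp_continuous_on isCont_def tendsto_at_iff_tendsto_nhds intro: order_tendstoD)
    moreover have "eventually (\<lambda>x. k x \<noteq> 0) (nhds x0)"
      using contk kx0 by (auto simp: isCont_def tendsto_at_iff_tendsto_nhds intro: tendsto_imp_eventually_ne)
    ultimately have "eventually (\<lambda>x. 0 < s x \<and> 0 < s' x \<and> k x \<noteq> 0) (nhds x0)" by eventually_elim auto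
    then obtain e where e: "e > 0" "\<And>x. dist x x0 < e \<Longrightarrow> 0 < s x \<and> 0 < s' x \<and> k x \<noteq> 0"
      unfolding eventually_nhds_metric by blast
    obtain n where n: "dist (u n w) (U w) < e / 2" "dist (u n w') (U w') < e / 2"
      using freq[of "e / 2" 0 w w'] e(1) by auto
    define x where "x = (u n w, u n w')"
    have "dist x x0 \<le> dist (u n w) (U w) + dist (u n w') (U w')"
      unfolding x_def x0_def dist_Pair_Pair by (rule sqrt_sum_squares_le_sum) auto
    then have x: "0 < s x" "0 < s' x" "k x \<noteq> 0" using e(2)[of x] n by auto
    have "of_real (s x) * u n w - of_real (s' x) * u n w' = v"
      using cross_product_solution[of "u n w'" "u n w" v] x(3) by (simp add: s_def s'_def k_def x_def)
    then have "w + of_real (s x) * u n w = w' + of_real (s' x) * u n w'" by (simp add: v_def algebra_simps)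
    \<comment> \<open>Disjointness forces equal directions, whose cross product \<open>k x\<close>
      is zero.\<close>
    then have "u n w = u n w'" by (rule cross[OF notE[OF w(1)] notE[OF w(2)] x(1,2)])
    then have "k x = Im (of_real ((norm (u n w))\<^sup>2))" unfolding k_def x_def complex_norm_square by (simp add: mult.commute)
    then show False using x(3) by simp
  qed
  have "open E" unfolding E_def using opn by blast
  moreover have "connected E"
  proof -
    have "connected (\<Union>n. D n)"
    proof (rule connected_Union)
      show "connected s" if "s \<in> range D" for s using that conn by auto
      obtain x where "x \<in> D 0" using ne by blast
      then have "x \<in> \<Inter> (range D)" using inc by (auto dest: incseqD[of D 0])
      then show "\<Inter> (range D) \<noteq> {}" by blast
    qed
    then show ?thesis by (simp add: E_def)
  qed
  moreover have "E \<noteq> {}" using ne by (auto simp: E_def)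
  ultimately have "close_to_convex_domain E"
    by (rule directions_close_to_convex[of E U]) (use U1 rayE crossE in auto)
  then show ?thesis by (simp add: E_def)
qed

section \<open>Biharmonicity\<close>

text \<open>Finite sums of products of a holomorphic and an antiholomorphic function are stable under
  all derivatives.\<close>

inductive sesqui_on :: "complex set \<Rightarrow> (complex \<Rightarrow> complex) \<Rightarrow> bool" for S where
  prod: "\<lbrakk>P holomorphic_on S; Q holomorphic_on S\<rbrakk> \<Longrightarrow> sesqui_on S (\<lambda>z. P z * cnj (Q z))"
| add: "\<lbrakk>sesqui_on S f; sesqui_on S g\<rbrakk> \<Longrightarrow> sesqui_on S (\<lambda>z. f z + g z)"
| cong: "\<lbrakk>sesqui_on S f; \<And>z. z \<in> S \<Longrightarrow> g z = f z\<rbrakk> \<Longrightarrow> sesqui_on S g"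

lemma has_derivative_holomorphic_antiholomorphic:
  assumes S: "open S" "z \<in> S" and P: "P holomorphic_on S" and Q: "Q holomorphic_on S"
  shows "((\<lambda>z. P z * cnj (Q z)) has_derivative
     (\<lambda>v. deriv P z * v * cnj (Q z) + P z * cnj (deriv Q z * v))) (at z)"
proof -
  have 1: "(P has_derivative (\<lambda>h. deriv P z * h)) (at z)"
    using holomorphic_derivI[OF P S] has_field_derivative_imp_has_derivative by blast
  have 2: "(Q has_derivative (\<lambda>h. deriv Q z * h)) (at z)"
    using holomorphic_derivI[OF Q S] has_field_derivative_imp_has_derivative by blast
  from has_derivative_mult[OF 1 has_derivative_cnj[OF 2]]
  show ?thesis by (simp add: add.commute mult_ac)
qed

lemma has_derivative_congruent:
  assumes "(f has_derivative f') (at z)" "open S" "z \<in> S" "\<And>x. x \<in> S \<Longrightarrow> g x = f x"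
  shows "(g has_derivative f') (at z)"
  by (rule has_derivative_transform_within_open[OF assms(1-3)]) (simp add: assms(4))

lemma sesqui_derivative:
  assumes "open S" "sesqui_on S f"
  shows "(\<forall>z\<in>S. f differentiable at z) \<and> sesqui_on S (\<lambda>z. frechet_derivative f (at z) v)"
  using assms(2)
proof induction
  case (prod P Q)
  have der: "((\<lambda>z. P z * cnj (Q z)) has_derivative
     (\<lambda>v. deriv P z * v * cnj (Q z) + P z * cnj (deriv Q z * v))) (at z)" if "z \<in> S" for z
    by (rule has_derivative_holomorphic_antiholomorphic[OF assms(1) that prod])
  have d: "(\<lambda>z. deriv P z * v) holomorphic_on S" "(\<lambda>z. deriv Q z * v) holomorphic_on S"
    using assms(1) prod by (auto intro!: holomorphic_intros holomorphic_deriv)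
  have "sesqui_on S (\<lambda>z. deriv P z * v * cnj (Q z) + P z * cnj (deriv Q z * v))"
    by (intro sesqui_on.add sesqui_on.prod d prod)
  moreover have "frechet_derivative (\<lambda>z. P z * cnj (Q z)) (at z) v = deriv P z * v * cnj (Q z) + P z * cnj (deriv Q z * v)"
    if "z \<in> S" for z using frechet_derivative_at[OF der[OF that]] by (metis (no_types, lifting))
  ultimately show ?case using der sesqui_on.cong by (auto simp: differentiable_def)
next
  case (add f g)
  have der: "((\<lambda>z. f z + g z) has_derivative (\<lambda>v. frechet_derivative f (at z) v + frechet_derivative g (at z) v)) (at z)"
    if "z \<in> S" for z
    using add.IH that by (intro has_derivative_add) (auto simp: frechet_derivative_works[symmetric])
  have "frechet_derivative (\<lambda>z. f z + g z) (at z) v = frechet_derivative f (at z) v + frechet_derivative g (at z) v"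
    if "z \<in> S" for z using frechet_derivative_at[OF der[OF that]] by (metis (no_types, lifting))
  moreover have "sesqui_on S (\<lambda>z. frechet_derivative f (at z) v + frechet_derivative g (at z) v)"
    using add.IH by (intro sesqui_on.add) auto
  ultimately have "sesqui_on S (\<lambda>z. frechet_derivative (\<lambda>z. f z + g z) (at z) v)"
    by (rule sesqui_on.cong[rotated])
  moreover have "\<forall>z\<in>S. (\<lambda>z. f z + g z) differentiable at z"
    using der unfolding differentiable_def by blast
  ultimately show ?case by blast
next
  case (cong f g)
  have der: "(g has_derivative frechet_derivative f (at z)) (at z)" if "z \<in> S" for z
    using cong that assms(1) by (intro has_derivative_congruent[of f _ z S g]) (auto simp: frechet_derivative_works[symmetric])
  then have "frechet_derivative g (at z) v = frechet_derivative f (at z) v" if "z \<in> S" for z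
    using frechet_derivative_at[OF der[OF that]] by metis
  then show ?case using cong der sesqui_on.cong by (auto simp: differentiable_def)
qed

lemma sesqui_continuously_differentiable:
  assumes "open S"
  shows "sesqui_on S f \<Longrightarrow> continuously_differentiable_on k f S"
proof (induction k arbitrary: f)
  case 0
  then have "\<forall>z\<in>S. f differentiable at z" using sesqui_derivative[OF assms] by blast
  then have "f differentiable_on S" by (simp add: differentiable_at_imp_differentiable_on)
  then show ?case by (simp add: differentiable_imp_continuous_on)
next
  case (Suc k)
  then show ?case using sesqui_derivative[OF assms Suc.prems]
    by (auto intro: differentiable_at_imp_differentiable_on)
qed

lemma wirtinger_of_has_derivative:
  assumes "(f has_derivative f') (at z)"
  shows "wirtinger_z f z = (f' 1 - \<i> * f' \<i>) / 2" "wirtinger_zbar f z = (f' 1 + \<i> * f' \<i>) / 2"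
  unfolding wirtinger_z_def wirtinger_zbar_def frechet_derivative_at[OF assms, symmetric] by simp_all

text \<open>The derivative in \<open>cnj z\<close> removes \<open>H\<close> and leaves
  \<open>P * cnj (deriv Q)\<close>, a product of the same kind. The form allows a second application
  with \<open>H = 0\<close> and \<open>P = 4\<close>.\<close>

lemma laplacian_holomorphic_antiholomorphic:
  assumes S: "open S" "z \<in> S" and hol: "H holomorphic_on S" "P holomorphic_on S" "Q holomorphic_on S"
    and f: "\<And>z. z \<in> S \<Longrightarrow> f z = H z + P z * cnj (Q z)"
  shows "laplacian f z = 4 * (deriv P z * cnj (deriv Q z))"
proof -
  have "wirtinger_zbar f w = P w * cnj (deriv Q w)" if w: "w \<in> S" for w
  proof -
    have "(H has_derivative (\<lambda>h. deriv H w * h)) (at w)"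
      using holomorphic_derivI[OF hol(1) S(1) w] has_field_derivative_imp_has_derivative by blast
    from has_derivative_add[OF this has_derivative_holomorphic_antiholomorphic[OF S(1) w hol(2,3)]]
    have "((\<lambda>z. H z + P z * cnj (Q z)) has_derivative
      (\<lambda>v. deriv H w * v + (deriv P w * v * cnj (Q w) + P w * cnj (deriv Q w * v)))) (at w)" .
    from wirtinger_of_has_derivative(2)[OF has_derivative_congruent[OF this S(1) w f]]
    show ?thesis by (simp add: algebra_simps)
  qed
  then have eq: "wirtinger_zbar f w = P w * cnj (deriv Q w)" if "w \<in> S" for w using that by blast
  have dQ: "deriv Q holomorphic_on S" by (rule holomorphic_deriv[OF hol(3) S(1)])
  note der = has_derivative_holomorphic_antiholomorphic[OF S hol(2) dQ]
  from wirtinger_of_has_derivative(1)[OF has_derivative_congruent[OF der S eq]]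
  show ?thesis unfolding laplacian_def by (simp add: algebra_simps)
qed

lemma biharmonic_on_H_plus:
  assumes S: "open S" and H: "H holomorphic_on S" and G: "G holomorphic_on S"
  shows "biharmonic_on (\<lambda>z. H z + of_real ((norm z)\<^sup>2) * cnj (G z)) S"
proof -
  define f where "f = (\<lambda>z. H z + of_real ((norm z)\<^sup>2) * cnj (G z))"
  \<comment> \<open>\<open>norm z ^ 2 * cnj (G z)\<close> is \<open>z * cnj (z * G z)\<close>, a
    product of a holomorphic and an antiholomorphic factor.\<close>
  define Q where "Q = (\<lambda>z. z * G z)"
  have Q: "Q holomorphic_on S" unfolding Q_def by (intro holomorphic_intros G)
  have f: "f z = H z + z * cnj (Q z)" for z
    unfolding f_def Q_def complex_norm_square by simp
  have one: "(\<lambda>z. 1) holomorphic_on S" "(\<lambda>z. z) holomorphic_on S" "(\<lambda>z. 0) holomorphic_on S" by (intro holomorphic_intros)+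
  have "sesqui_on S (\<lambda>z. H z * cnj 1 + z * cnj (Q z))" by (intro sesqui_on.add sesqui_on.prod H Q one)
  then have "sesqui_on S f" by (rule sesqui_on.cong) (simp add: f)
  then have "continuously_differentiable_on 4 f S" by (rule sesqui_continuously_differentiable[OF S])
  moreover have "laplacian (laplacian f) z = 0" if z: "z \<in> S" for z
  proof -
    have l1: "laplacian f w = 0 + 4 * cnj (deriv Q w)" if "w \<in> S" for w
      using laplacian_holomorphic_antiholomorphic[OF S that H one(2) Q f] by simp
    have dQ: "deriv Q holomorphic_on S" by (rule holomorphic_deriv[OF Q S])
    have four: "(\<lambda>z. 4) holomorphic_on S" by (intro holomorphic_intros)
    show ?thesis using laplacian_holomorphic_antiholomorphic[OF S z one(3) four dQ l1] by simp
  qed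
  ultimately show ?thesis unfolding biharmonic_on_def f_def using S by blast
qed

section \<open>Images of disks\<close>

text \<open>The domain is determined by the values on the circle, which is how results pass from a
  harmonic mapping to \<open>f\<close>. The image of the open disk is open, and closed in the
  complement of the Jordan curve, so it contains every component that it meets; being bounded, it
  misses the outer one.\<close>

lemma image_ball_eq_inside:
  fixes g :: "complex \<Rightarrow> complex"
  assumes r: "r > 0" and g: "continuous_on (cball 0 r) g" "inj_on g (cball 0 r)"
  shows "g ` ball 0 r = inside (g ` sphere 0 r)"
proof -
  define C where "C = g ` sphere 0 r"
  define B where "B = g ` ball 0 r"
  define c where "c = g \<circ> circlepath 0 r"
  have pc: "path_image (circlepath 0 r) = sphere 0 r" using r by (intro path_image_circlepath_nonneg) simp
  have sph: "continuous_on (sphere 0 r) g" "inj_on g (sphere 0 r)"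
    by (rule continuous_on_subset[OF g(1)], simp) (rule inj_on_subset[OF g(2)], simp)
  have "simple_path (circlepath 0 r)" using r by (simp add: simple_path_circlepath)
  then have "simple_path c" unfolding c_def
    using sph pc by (intro simple_path_continuous_image) simp_all
  moreover have "pathfinish c = pathstart c" by (simp add: c_def pathfinish_def pathstart_def circlepath)
  moreover have imc: "path_image c = C" unfolding c_def path_image_compose pc C_def ..
  ultimately have J: "open (inside C)" "connected (inside C)" "connected (outside C)" "open (outside C)" "\<not> bounded (outside C)"
      "inside C \<union> outside C = - C" "inside C \<inter> outside C = {}"
    using Jordan_inside_outside[of c] by auto
  have split: "cball 0 r = ball 0 r \<union> (sphere 0 r :: complex set)" by auto
  have disj: "B \<inter> C = {}"
  proof -
    have "g x \<noteq> g y" if "x \<in> ball 0 r" "y \<in> sphere 0 r" for x y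
      using inj_onD[OF g(2), of x y] that by force
    then show ?thesis unfolding B_def C_def by blast
  qed
  have "continuous_on (ball 0 r) g" "inj_on g (ball 0 r)"
    by (rule continuous_on_subset[OF g(1) ball_subset_cball], rule inj_on_subset[OF g(2) ball_subset_cball])
  then have B: "open B" "connected B" "B \<noteq> {}"
    unfolding B_def using r invariance_of_domain[of "ball 0 r" g] connected_continuous_image[of "ball 0 r" g] by simp_all
  have "compact (g ` cball 0 r)" using g(1) by (intro compact_continuous_image) auto
  moreover have "g ` cball 0 r = B \<union> C" unfolding B_def C_def split by (rule image_Un)
  ultimately have BC: "closed (B \<union> C)" "bounded B"
    using compact_imp_closed compact_imp_bounded bounded_Un by metis+
  have whole: "T \<subseteq> B" if T: "connected T" "open T" "T \<subseteq> - C" "B \<inter> T \<noteq> {}" for T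
  proof (rule ccontr)
    assume "\<not> T \<subseteq> B"
    then have "- (B \<union> C) \<inter> T \<noteq> {}" using T(3) by blast
    moreover have "T \<subseteq> B \<union> - (B \<union> C)" using T(3) by blast
    moreover have "B \<inter> - (B \<union> C) \<inter> T = {}" by blast
    moreover have "open (- (B \<union> C))" by (rule open_Compl[OF BC(1)])
    ultimately show False using connectedD[OF T(1) B(1), of "- (B \<union> C)"] T(4) by blast
  qed
  have "B \<inter> outside C = {}"
  proof (rule ccontr)
    assume "B \<inter> outside C \<noteq> {}"
    then have "outside C \<subseteq> B" using J(3,4,6) whole[of "outside C"] by blast
    then show False using BC(2) J(5) bounded_subset by blast
  qed
  then have "B \<subseteq> inside C" using disj J(6) by blast
  moreover have "inside C \<subseteq> B" using B(3) calculation J(1,2,6) whole[of "inside C"] by blast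
  ultimately show ?thesis by (auto simp: B_def C_def)
qed

text \<open>The angle of \<open>F z - F z0\<close> is that of \<open>z - z0\<close> up to a single-valued function, since
  \<open>H z - H z0\<close> dominates \<open>G z - G z0\<close> and \<open>H\<close> is univalent.\<close>

lemma winding_of_harmonic:
  assumes H: "H holomorphic_on ball 0 1" and G: "G holomorphic_on ball 0 1"
    and J: "\<And>z. z \<in> ball 0 1 \<Longrightarrow> deriv H z \<noteq> 0"
    and diff: "\<And>z1 z2. \<lbrakk>z1 \<in> ball 0 1; z2 \<in> ball 0 1; z1 \<noteq> z2\<rbrakk> \<Longrightarrow> norm (G z2 - G z1) < norm (H z2 - H z1)"
    and \<epsilon>: "0 \<le> \<epsilon>" "\<epsilon> \<le> 1" and r: "r < 1" and z0: "norm z0 < r"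
  defines "F \<equiv> \<lambda>z. H z + of_real \<epsilon> * cnj (G z)"
  obtains \<alpha> where "continuous_on UNIV \<alpha>"
    "\<And>t. F z0 - F (of_real r * cis t) = of_real (norm (F z0 - F (of_real r * cis t))) * cis (\<alpha> t)"
    "\<And>t. \<alpha> (t + 2 * pi) = \<alpha> t + 2 * pi"
proof -
  have z0b: "z0 \<in> ball 0 1" using z0 r by simp
  have r0: "r > 0" using z0 norm_ge_zero[of z0] by linarith
  \<comment> \<open>The difference quotient, continued over \<open>z0\<close>. It has no zeros, so
    \<open>H z - H z0\<close> is \<open>(z - z0) * exp (\<kappa> z)\<close>.\<close>
  define K where "K = (\<lambda>z. if z = z0 then deriv H z0 else (H z - H z0) / (z - z0))"
  have Khol: "K holomorphic_on ball 0 1" unfolding K_def by (rule pole_lemma_open[OF H open_ball])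
  have K0: "K z \<noteq> 0" if "z \<in> ball 0 1" for z
  proof (cases "z = z0")
    case True then show ?thesis using J[OF z0b] by (simp add: K_def)
  next
    case False
    then have "H z - H z0 \<noteq> 0" using diff[OF z0b that] by force
    then show ?thesis using False by (simp add: K_def)
  qed
  obtain \<kappa> where \<kappa>: "\<kappa> holomorphic_on ball 0 1" "\<And>z. z \<in> ball 0 1 \<Longrightarrow> K z = exp (\<kappa> z)"
    using holomorphic_log_ball[OF Khol K0] by blast
  define z where "z = (\<lambda>t. of_real r * cis t)"
  have nz: "norm (z t) = r" for t using r0 by (simp add: z_def norm_mult)
  have zb: "z t \<in> ball 0 1" for t using nz r by simp
  have z_ne: "z t \<noteq> z0" "z t \<noteq> 0" for t using nz[of t] z0 r0 by auto
  have np: "1 + x \<notin> \<real>\<^sub>\<le>\<^sub>0" "1 + x \<noteq> 0" if "norm x < 1" for x :: complex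
  proof -
    have "Re (1 + x) > 0" using abs_Re_le_cmod[of x] that by simp
    then show "1 + x \<notin> \<real>\<^sub>\<le>\<^sub>0" "1 + x \<noteq> 0" unfolding complex_nonpos_Reals_iff by force+
  qed
  \<comment> \<open>The factors \<open>1 + a t\<close> and \<open>1 + b t\<close> lie in the right
    half-plane and do not wind; of the factors of \<open>F z0 - F (z t)\<close> only
    \<open>z t\<close> contributes 2 pi.\<close>
  define a where "a = (\<lambda>t. - z0 / z t)"
  define b where "b = (\<lambda>t. of_real \<epsilon> * cnj (G (z t) - G z0) / (H (z t) - H z0))"
  have Hne: "H (z t) - H z0 \<noteq> 0" for t using diff[OF z0b zb, of t] z_ne(1)[of t] by force
  have na: "norm (a t) < 1" for t using z0 nz[of t] r0 by (simp add: a_def norm_divide)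
  have nb: "norm (b t) < 1" for t
  proof -
    have "\<epsilon> * norm (G (z t) - G z0) \<le> norm (G (z t) - G z0)" using \<epsilon> by (simp add: mult_left_le_one_le)
    also have "\<dots> < norm (H (z t) - H z0)" using diff[OF z0b zb, of t] z_ne(1)[of t] by blast
    moreover have "norm (b t) = \<epsilon> * norm (G (z t) - G z0) / norm (H (z t) - H z0)"
      unfolding b_def norm_divide norm_mult complex_mod_cnj using \<epsilon> by simp
    ultimately show ?thesis using Hne by simp
  qed
  have fact: "F z0 - F (z t) = - (z t * (1 + a t) * exp (\<kappa> (z t)) * (1 + b t))" for t
  proof -
    have 1: "z t * (1 + a t) = z t - z0" using z_ne by (simp add: a_def field_simps)
    have 2: "(z t - z0) * exp (\<kappa> (z t)) = H (z t) - H z0"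
      using \<kappa>(2)[OF zb[of t]] z_ne[of t] by (simp add: K_def flip: \<kappa>(2)[OF zb])
    have 3: "(H (z t) - H z0) * (1 + b t) = (H (z t) - H z0) + of_real \<epsilon> * cnj (G (z t) - G z0)"
      using Hne by (simp add: b_def field_simps)
    show ?thesis unfolding 1 2 3 by (simp add: F_def algebra_simps)
  qed
  \<comment> \<open>The summand pi accounts for the minus sign in \<open>fact\<close>.\<close>
  define \<alpha> where "\<alpha> = (\<lambda>t. pi + t + Im (Ln (1 + a t)) + Im (\<kappa> (z t)) + Im (Ln (1 + b t)))"
  have contz: "continuous_on UNIV z" unfolding z_def cis_conv_exp by (intro continuous_intros)
  have contc: "continuous_on UNIV (\<lambda>t. h (z t))" if "h holomorphic_on ball 0 1" for h
    using zb by (intro continuous_on_compose2[OF holomorphic_on_imp_continuous_on[OF that] contz]) auto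
  have "continuous_on UNIV a" "continuous_on UNIV b" unfolding a_def b_def
    using z_ne Hne by (auto intro!: continuous_intros contz contc[OF H] contc[OF G])
  then have "continuous_on UNIV \<alpha>" unfolding \<alpha>_def
    by (intro continuous_intros contc \<kappa>(1)) (use np(1)[OF na] np(1)[OF nb] in blast)+
  moreover have "F z0 - F (z t) = of_real (norm (F z0 - F (z t))) * cis (\<alpha> t)" for t
  proof -
    have L: "x = of_real (norm x) * cis (Im (Ln x))" if "x \<noteq> 0" for x
      using exp_eq_polar[of "Ln x"] exp_Ln[OF that] norm_exp_eq_Re[of "Ln x"] by simp
    define m where "m = r * norm (1 + a t) * exp (Re (\<kappa> (z t))) * norm (1 + b t)"
    have m0: "m \<ge> 0" unfolding m_def using r0 by (intro mult_nonneg_nonneg) auto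
    have "F z0 - F (z t) = (- 1) * ((of_real r * cis t) * (of_real (norm (1 + a t)) * cis (Im (Ln (1 + a t))))
        * (of_real (exp (Re (\<kappa> (z t)))) * cis (Im (\<kappa> (z t)))) * (of_real (norm (1 + b t)) * cis (Im (Ln (1 + b t)))))"
      unfolding fact L[OF np(2)[OF na], of t, symmetric] L[OF np(2)[OF nb], of t, symmetric]
      unfolding z_def exp_eq_polar[of "\<kappa> _"] by simp
    also have "\<dots> = of_real m * cis (\<alpha> t)"
      by (simp add: m_def \<alpha>_def cis_mult[symmetric] mult_ac)
    finally have eq: "F z0 - F (z t) = of_real m * cis (\<alpha> t)" .
    then have "norm (F z0 - F (z t)) = m" using m0 by (simp add: norm_mult)
    then show ?thesis using eq by simp
  qed
  moreover have "z (t + 2 * pi) = z t" for t by (simp add: z_def complex_eq_iff)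
  then have "\<alpha> (t + 2 * pi) = \<alpha> t + 2 * pi" for t by (simp add: \<alpha>_def a_def b_def)
  ultimately show ?thesis using that unfolding z_def by blast
qed

text \<open>The derivative of the curve is \<open>\<i> * (x t * (1 - Q (z t)))\<close> with
  \<open>x t = z t * deriv H (z t)\<close>, so \<open>\<nu>\<close> is the angle of its outer
  normal. The shears in \<open>key\<close> supply the rotation estimate, from which
  \<open>monotone_direction\<close> and \<open>ray_family\<close> produce the half-lines.\<close>

lemma close_to_convex_harmonic_image:
  assumes H: "H holomorphic_on ball 0 1" and G: "G holomorphic_on ball 0 1"
    and J: "\<And>z. z \<in> ball 0 1 \<Longrightarrow> norm (deriv G z) < norm (deriv H z)"
    and diff: "\<And>z1 z2. \<lbrakk>z1 \<in> ball 0 1; z2 \<in> ball 0 1; z1 \<noteq> z2\<rbrakk> \<Longrightarrow> norm (G z2 - G z1) < norm (H z2 - H z1)"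
    and key: "\<And>\<omega>. norm \<omega> = 1 \<Longrightarrow> \<exists>p q c. norm p = 1 \<and> norm q = 1 \<and> c \<noteq> 0 \<and>
        (\<forall>z\<in>ball 0 1. 0 \<le> Re (c * (deriv H z - \<omega> * deriv G z) * (1 - cnj p * z) * (1 - cnj q * z)))"
    and \<epsilon>: "0 \<le> \<epsilon>" "\<epsilon> \<le> 1" and r: "0 < r" "r < 1"
  shows "close_to_convex_domain ((\<lambda>z. H z + of_real \<epsilon> * cnj (G z)) ` ball 0 r)"
proof -
  define F where "F = (\<lambda>z. H z + of_real \<epsilon> * cnj (G z))"
  have H'0: "deriv H z \<noteq> 0" if "z \<in> ball 0 1" for z using J[OF that] by force
  have dH: "deriv H holomorphic_on ball 0 1" "deriv G holomorphic_on ball 0 1"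
    by (intro holomorphic_deriv H G open_ball)+
  obtain lg where lg: "lg holomorphic_on ball 0 1" "\<And>z. z \<in> ball 0 1 \<Longrightarrow> deriv H z = exp (lg z)"
    using holomorphic_log_ball[OF dH(1) H'0] by blast
  define q where "q = (\<lambda>z. deriv G z / deriv H z)"
  have qhol: "q holomorphic_on ball 0 1" unfolding q_def using H'0 by (intro holomorphic_intros dH) auto
  have q1: "norm (q z) < 1" if "z \<in> ball 0 1" for z using J[OF that] H'0[OF that] by (simp add: q_def norm_divide)
  have eq: "exp (lg z) * q z = deriv G z" if "z \<in> ball 0 1" for z
    using H'0[OF that] lg(2)[OF that] by (simp add: q_def)
  define z where "z = (\<lambda>t. of_real r * cis t)"
  have nz: "norm (z t) = r" for t using r by (simp add: z_def norm_mult)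
  have zb: "z t \<in> ball 0 1" "z t \<noteq> 0" for t using nz[of t] r by auto
  have rot: "(t1 + Im (lg (z t1)) + Arg (1 - \<omega> * q (z t1))) - pi < t2 + Im (lg (z t2)) + Arg (1 - \<omega> * q (z t2))"
    if \<omega>: "norm \<omega> = 1" and t: "t1 < t2" for \<omega> t1 t2
  proof -
    obtain p q' c where k: "norm p = 1" "norm q' = 1" "c \<noteq> 0"
      "\<And>z. z \<in> ball 0 1 \<Longrightarrow> 0 \<le> Re (c * (deriv H z - \<omega> * deriv G z) * (1 - cnj p * z) * (1 - cnj q' * z))"
      using key[OF \<omega>] by blast
    show ?thesis unfolding z_def
    proof (rule Arg_rotation_of_close_to_convex[OF lg(1) _ _ k(1-3) _ r t])
      show "(\<lambda>z. \<omega> * q z) holomorphic_on ball 0 1" by (intro holomorphic_intros qhol)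
      show "norm (\<omega> * q x) < 1" if "x \<in> ball 0 1" for x using q1[OF that] \<omega> by (simp add: norm_mult)
      show "0 \<le> Re (c * (exp (lg x) * (1 - \<omega> * q x)) * (1 - cnj p * x) * (1 - cnj q' * x))" if "x \<in> ball 0 1" for x
      proof -
        have "exp (lg x) * (1 - \<omega> * q x) = deriv H x - \<omega> * deriv G x"
          using eq[OF that] lg(2)[OF that] by (simp add: algebra_simps)
        then show ?thesis using k(4)[OF that] by simp
      qed
    qed
  qed
  define Q where "Q = (\<lambda>z. of_real \<epsilon> * cnj (z * exp (lg z) * q z) / (z * exp (lg z)))"
  define \<nu> where "\<nu> = (\<lambda>t. t + Im (lg (of_real r * cis t)) + Arg (1 - Q (of_real r * cis t)))"
  note rh = rotation_of_harmonic[OF holomorphic_on_imp_continuous_on[OF lg(1)] holomorphic_on_imp_continuous_on[OF qhol] q1 r \<epsilon>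
      rot[unfolded z_def], where Q = Q and \<nu> = \<nu>]
  have cont\<nu>: "continuous_on UNIV \<nu>" by (rule rh(1)) (simp_all add: Q_def \<nu>_def)
  have rot\<nu>: "\<nu> t1 - pi < \<nu> t2" if "t1 < t2" for t1 t2 by (rule rh(2)) (use that in \<open>simp_all add: Q_def \<nu>_def\<close>)
  have cis2: "cis (t + 2 * pi) = cis t" for t by (simp add: complex_eq_iff)
  have per\<nu>: "\<nu> (t + 2 * pi) = \<nu> t + 2 * pi" for t by (simp add: \<nu>_def cis2)
  obtain \<beta> where \<beta>: "continuous_on UNIV \<beta>" "\<And>\<theta>. \<beta> (\<theta> + 2 * pi) = \<beta> \<theta> + 2 * pi" "mono \<beta>"
    "\<And>\<theta>. \<bar>\<beta> \<theta> - \<nu> \<theta>\<bar> < pi / 2"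
    using monotone_direction[OF cont\<nu> per\<nu> rot\<nu>] by blast
  have contF: "continuous_on (ball 0 1) F" unfolding F_def
    by (intro continuous_intros holomorphic_on_imp_continuous_on H G)
  have Fne: "F z1 \<noteq> F z2" if z12: "z1 \<in> ball 0 1" "z2 \<in> ball 0 1" "z1 \<noteq> z2" for z1 z2
  proof
    assume "F z1 = F z2"
    then have "H z2 - H z1 = - (of_real \<epsilon> * cnj (G z2 - G z1))" by (simp add: F_def algebra_simps)
    then have "norm (H z2 - H z1) = \<epsilon> * norm (G z2 - G z1)"
      using \<epsilon> by (metis abs_of_nonneg complex_mod_cnj norm_minus_cancel norm_mult norm_of_real)
    also have "\<dots> \<le> norm (G z2 - G z1)" using \<epsilon> by (simp add: mult_left_le_one_le)
    finally show False using diff[OF z12] by simp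
  qed
  have sub: "ball 0 r \<subseteq> (ball 0 1 :: complex set)" "cball 0 r \<subseteq> (ball 0 1 :: complex set)" using r by auto
  define W where "W = F ` ball 0 r"
  define \<gamma> where "\<gamma> = (\<lambda>t. F (z t))"
  define x where "x = (\<lambda>t. z t * deriv H (z t))"
  have x0: "x t \<noteq> 0" for t using zb H'0 by (simp add: x_def)
  have Qx: "Q (z t) = of_real \<epsilon> * cnj (z t * deriv G (z t)) / x t" for t
    unfolding Q_def x_def lg(2)[OF zb(1)] using eq[OF zb(1)[of t]] by (simp add: mult.assoc)
  have Q1: "norm (Q (z t)) < 1" for t
  proof -
    have "norm (Q (z t)) = \<epsilon> * norm (q (z t))"
      using zb[of t] H'0[OF zb(1)[of t]] \<epsilon> by (simp add: Qx x_def q_def norm_mult norm_divide)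
    also have "\<dots> \<le> norm (q (z t))" using \<epsilon> by (simp add: mult_left_le_one_le)
    finally show ?thesis using q1[OF zb(1)[of t]] by simp
  qed
  have Q0: "1 - Q (z t) \<noteq> 0" for t using Q1[of t] by force
  interpret ray_family \<gamma> "\<lambda>t. norm (x t * (1 - Q (z t)))" \<nu> \<beta> W
  proof
    fix t :: real
    have dz: "(z has_vector_derivative \<i> * z t) (at t)" unfolding z_def by (rule has_vector_derivative_circle)
    have 1: "((\<lambda>t. H (z t)) has_vector_derivative \<i> * z t * deriv H (z t)) (at t)"
      using field_vector_diff_chain_at[OF dz holomorphic_derivI[OF H open_ball zb(1)]] by (simp add: o_def)
    have "((\<lambda>t. G (z t)) has_vector_derivative \<i> * z t * deriv G (z t)) (at t)"
      using field_vector_diff_chain_at[OF dz holomorphic_derivI[OF G open_ball zb(1)]] by (simp add: o_def)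
    then have 2: "((\<lambda>t. of_real \<epsilon> * cnj (G (z t))) has_vector_derivative of_real \<epsilon> * cnj (\<i> * z t * deriv G (z t))) (at t)"
      by (intro has_vector_derivative_mult_right has_vector_derivative_cnj)
    have "(\<gamma> has_vector_derivative \<i> * z t * deriv H (z t) + of_real \<epsilon> * cnj (\<i> * z t * deriv G (z t))) (at t)"
      unfolding \<gamma>_def F_def by (rule has_vector_derivative_add[OF 1 2])
    moreover have "\<i> * z t * deriv H (z t) + of_real \<epsilon> * cnj (\<i> * z t * deriv G (z t)) = \<i> * (x t * (1 - Q (z t)))"
      using x0[of t] by (simp add: Qx right_diff_distrib) (simp add: x_def)
    moreover have "x t * (1 - Q (z t)) = of_real (norm (x t * (1 - Q (z t)))) * cis (\<nu> t)"
    proof -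
      have "x t = of_real (r * exp (Re (lg (z t)))) * cis (t + Im (lg (z t)))"
        unfolding x_def lg(2)[OF zb(1)] exp_eq_polar[of "lg _"] by (simp add: z_def cis_mult[symmetric])
      moreover have "1 - Q (z t) = of_real (norm (1 - Q (z t))) * cis (Arg (1 - Q (z t)))"
        by (metis rcis_cmod_Arg rcis_def)
      ultimately have "x t * (1 - Q (z t)) = of_real (r * exp (Re (lg (z t))) * norm (1 - Q (z t))) * cis (\<nu> t)"
        by (simp only: \<nu>_def z_def cis_mult[symmetric] of_real_mult mult_ac)
      moreover from this have "norm (x t * (1 - Q (z t))) = r * exp (Re (lg (z t))) * norm (1 - Q (z t))"
        using r by (simp add: norm_mult)
      ultimately show ?thesis by simp
    qed
    ultimately show "(\<gamma> has_vector_derivative of_real (norm (x t * (1 - Q (z t)))) * (\<i> * cis (\<nu> t))) (at t)"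
      by (simp add: mult.left_commute)
    show "0 < norm (x t * (1 - Q (z t)))" using x0[of t] Q0[of t] by simp
    show "\<gamma> (t + 2 * pi) = \<gamma> t" by (simp add: \<gamma>_def z_def cis2)
    show "\<gamma> t \<notin> W"
    proof
      assume "\<gamma> t \<in> W"
      then obtain y where "y \<in> ball 0 r" "F (z t) = F y" by (auto simp: W_def \<gamma>_def)
      moreover from this have "z t \<noteq> y" "y \<in> ball 0 1" using nz[of t] sub by auto
      ultimately show False using Fne[OF zb(1)] by blast
    qed
    have "F ` closure (ball 0 r) \<subseteq> closure (F ` ball 0 r)"
      using r by (intro continuous_image_closure_subset[OF contF]) auto
    moreover have "z t \<in> closure (ball 0 r)" using nz[of t] r by simp
    ultimately show "\<gamma> t \<in> closure W" unfolding W_def \<gamma>_def by blast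
  next
    fix y assume y: "y \<notin> range \<gamma>"
    show "\<exists>\<alpha>. continuous_on UNIV \<alpha> \<and> (\<forall>\<theta>. y - \<gamma> \<theta> = of_real (norm (y - \<gamma> \<theta>)) * cis (\<alpha> \<theta>)) \<and>
        (\<forall>\<theta>. \<alpha> (\<theta> + 2 * pi) = \<alpha> \<theta> + (if y \<in> W then 2 * pi else 0))"
    proof (cases "y \<in> W")
      case True
      then obtain z0 where z0: "norm z0 < r" "y = F z0" by (auto simp: W_def)
      have \<gamma>e: "y - \<gamma> t = (H z0 + of_real \<epsilon> * cnj (G z0)) - (H (of_real r * cis t) + of_real \<epsilon> * cnj (G (of_real r * cis t)))" for t
        by (simp only: z0(2) \<gamma>_def F_def z_def)
      have "\<exists>\<alpha>. continuous_on UNIV \<alpha> \<and> (\<forall>\<theta>. y - \<gamma> \<theta> = of_real (norm (y - \<gamma> \<theta>)) * cis (\<alpha> \<theta>)) \<and>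
          (\<forall>\<theta>. \<alpha> (\<theta> + 2 * pi) = \<alpha> \<theta> + 2 * pi)"
        unfolding \<gamma>e by (rule winding_of_harmonic[OF H G _ _ \<epsilon> r(2) z0(1)]) (use H'0 diff in blast)+
      then show ?thesis using True by simp
    next
      case False
      \<comment> \<open>An outer point gives a zero-free function on the closed disk; its continuous
        logarithm makes the angle periodic.\<close>
      have ne: "y - F v \<noteq> 0" if v: "v \<in> cball 0 r" for v
      proof (cases "norm v < r")
        case True
        then have "F v \<in> W" unfolding W_def by (intro imageI) simp
        then show ?thesis using False by force
      next
        case nlt: False
        then have nv: "norm v = r" using v unfolding mem_cball_0 by linarith
        have "v = z (Arg v)" unfolding z_def nv[symmetric] by (metis rcis_cmod_Arg rcis_def)
        then have "F v \<in> range \<gamma>" unfolding \<gamma>_def by (metis rangeI)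
        then show ?thesis using y by auto
      qed
      have "continuous_on (cball 0 r) (\<lambda>v. y - F v)" by (intro continuous_intros continuous_on_subset[OF contF sub(2)])
      then obtain h where h: "continuous_on (cball 0 r) h" "\<And>v. v \<in> cball 0 r \<Longrightarrow> y - F v = exp (h v)"
        using continuous_logarithm_on_cball[of 0 r "\<lambda>v. y - F v"] ne by blast
      have zc: "z t \<in> cball 0 r" for t using nz[of t] by simp
      have contz: "continuous_on UNIV z" unfolding z_def cis_conv_exp by (intro continuous_intros)
      have "continuous_on UNIV (\<lambda>t. Im (h (z t)))"
        using zc by (intro continuous_intros continuous_on_compose2[OF h(1) contz]) auto
      moreover have "y - \<gamma> t = of_real (norm (y - \<gamma> t)) * cis (Im (h (z t)))" for t
        unfolding \<gamma>_def h(2)[OF zc] norm_exp_eq_Re by (rule exp_eq_polar)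
      moreover have "Im (h (z (t + 2 * pi))) = Im (h (z t))" for t by (simp add: z_def cis2)
      ultimately show ?thesis using False by (intro exI[of _ "\<lambda>t. Im (h (z t))"]) auto
    qed
  qed (use \<beta> in auto)
  have "inj_on F (ball 0 r)" using Fne sub by (meson inj_onI subsetD)
  then have "open W" "connected W" "W \<noteq> {}"
    unfolding W_def using continuous_on_subset[OF contF sub(1)] r
      invariance_of_domain[of "ball 0 r" F] connected_continuous_image[of "ball 0 r" F] by simp_all
  then show ?thesis using close_to_convex by (simp add: W_def F_def)
qed

text \<open>\<open>sense_preserving_harmonic\<close> speaks of some decomposition, while the claim
  fixes \<open>H\<close> and \<open>G\<close>. Comparing the real derivative in the directions 1 and
  \<open>\<i>\<close> separates the two parts.\<close>

lemma deriv_eq_of_harmonic_decompositions: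
  assumes hol: "H holomorphic_on S" "G holomorphic_on S" "H0 holomorphic_on S" "G0 holomorphic_on S"
    and S: "open S" "z \<in> S" and eq: "\<And>z. z \<in> S \<Longrightarrow> H z + cnj (G z) = H0 z + cnj (G0 z)"
  shows "deriv H z = deriv H0 z" "deriv G z = deriv G0 z"
proof -
  have d1: "((\<lambda>z. H z + 1 * cnj (G z)) has_derivative (\<lambda>h. deriv H z * h + 1 * cnj (deriv G z * h))) (at z)"
    by (rule has_derivative_harmonic[OF hol(1,2) S])
  have "((\<lambda>z. H0 z + 1 * cnj (G0 z)) has_derivative (\<lambda>h. deriv H0 z * h + 1 * cnj (deriv G0 z * h))) (at z)"
    by (rule has_derivative_harmonic[OF hol(3,4) S])
  then have d2: "((\<lambda>z. H z + 1 * cnj (G z)) has_derivative (\<lambda>h. deriv H0 z * h + 1 * cnj (deriv G0 z * h))) (at z)"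
    by (rule has_derivative_transform_within_open[OF _ S]) (simp add: eq)
  have "(\<lambda>h. deriv H z * h + 1 * cnj (deriv G z * h)) = (\<lambda>h. deriv H0 z * h + 1 * cnj (deriv G0 z * h))"
    by (rule has_derivative_unique[OF d1 d2])
  from fun_cong[OF this, of 1] fun_cong[OF this, of \<i>]
  have 1: "deriv H z + cnj (deriv G z) = deriv H0 z + cnj (deriv G0 z)"
    and 2: "\<i> * (deriv H z - cnj (deriv G z)) = \<i> * (deriv H0 z - cnj (deriv G0 z))"
    by (simp_all add: algebra_simps)
  from 2 have 3: "deriv H z - cnj (deriv G z) = deriv H0 z - cnj (deriv G0 z)" by simp
  have "(deriv H z + cnj (deriv G z)) + (deriv H z - cnj (deriv G z)) = (deriv H0 z + cnj (deriv G0 z)) + (deriv H0 z - cnj (deriv G0 z))"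
    by (simp only: 1 3)
  then show "deriv H z = deriv H0 z" by simp
  then show "deriv G z = deriv G0 z" using 1 by simp
qed

theorem theorem4:
  fixes H G :: "complex \<Rightarrow> complex" and f :: "complex \<Rightarrow> complex"
  defines "f \<equiv> \<lambda>z. H z + of_real ((norm z)\<^sup>2) * cnj (G z)"
  assumes "H holomorphic_on ball 0 1"
    and "G holomorphic_on ball 0 1"
    and "(\<lambda>z. H z + cnj (G z)) \<in> K_H"
    and "locally_univalent_on f (ball 0 1)"
  shows "biharmonic_on f (ball 0 1) \<and> inj_on f (ball 0 1) \<and> fully_close_to_convex_mapping f"
proof -
  note H = assms(2) and G = assms(3)
  have inj: "inj_on (\<lambda>z. H z + cnj (G z)) (ball 0 1)" and conv: "convex ((\<lambda>z. H z + cnj (G z)) ` ball 0 1)"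
    and "sense_preserving_harmonic (\<lambda>z. H z + cnj (G z))"
    using assms(4) by (auto simp: K_H_def S_H_def)
  then obtain H0 G0 where H0: "H0 holomorphic_on ball 0 1" "G0 holomorphic_on ball 0 1"
    "\<And>z. z \<in> ball 0 1 \<Longrightarrow> H z + cnj (G z) = H0 z + cnj (G0 z)"
    "\<And>z. z \<in> ball 0 1 \<Longrightarrow> (norm (deriv H0 z))\<^sup>2 - (norm (deriv G0 z))\<^sup>2 > 0"
    unfolding sense_preserving_harmonic_def by blast
  have J: "norm (deriv G z) < norm (deriv H z)" if z: "z \<in> ball 0 1" for z
  proof -
    have "(norm (deriv G z))\<^sup>2 < (norm (deriv H z))\<^sup>2"
      using H0(4)[OF z] deriv_eq_of_harmonic_decompositions[OF H G H0(1,2) open_ball z H0(3)] by simp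
    then show ?thesis by (rule power2_less_imp_less) simp
  qed
  have diff: "norm (G z2 - G z1) < norm (H z2 - H z1)"
    if "z1 \<in> ball 0 1" "z2 \<in> ball 0 1" "z1 \<noteq> z2" for z1 z2
    by (rule norm_diff_less_of_convex_harmonic[OF H G J inj conv that])
  have key: "\<exists>p q c. norm p = 1 \<and> norm q = 1 \<and> c \<noteq> 0 \<and>
      (\<forall>z\<in>ball 0 1. 0 \<le> Re (c * (deriv H z - \<omega> * deriv G z) * (1 - cnj p * z) * (1 - cnj q * z)))"
    if "norm \<omega> = 1" for \<omega>
    by (rule convex_harmonic_shear_direction[OF H G J inj conv that]) blast+
  have inj_\<epsilon>: "inj_on (\<lambda>z. H z + of_real \<epsilon> * cnj (G z)) (ball 0 1)" if \<epsilon>: "0 \<le> \<epsilon>" "\<epsilon> \<le> 1" for \<epsilon> :: real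
  proof (rule inj_onI, rule ccontr)
    fix x y assume xy: "x \<in> ball 0 1" "y \<in> ball 0 1" "H x + of_real \<epsilon> * cnj (G x) = H y + of_real \<epsilon> * cnj (G y)" "x \<noteq> y"
    then have "H y - H x = - (of_real \<epsilon> * cnj (G y - G x))" by (simp add: algebra_simps)
    then have "norm (H y - H x) = \<epsilon> * norm (G y - G x)"
      using \<epsilon> by (metis abs_of_nonneg complex_mod_cnj norm_minus_cancel norm_mult norm_of_real)
    also have "\<dots> \<le> norm (G y - G x)" using \<epsilon> by (simp add: mult_left_le_one_le)
    finally show False using diff[OF xy(1,2,4)] by simp
  qed
  have contf: "continuous_on (ball 0 1) f" unfolding f_def
    by (intro continuous_intros holomorphic_on_imp_continuous_on H G)
  have f_circle: "f z = H z + of_real (r\<^sup>2) * cnj (G z)" if "z \<in> sphere 0 r" for z r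
    using that by (auto simp: f_def)
  have r2: "0 \<le> r\<^sup>2" "r\<^sup>2 \<le> 1" if "0 < r" "r < 1" for r :: real
    using that by (auto simp: power_le_one)
  have injf: "inj_on f (ball 0 1)"
  proof (rule inj_on_ball_of_circles[OF contf])
    show "\<exists>U. open U \<and> z \<in> U \<and> U \<subseteq> ball 0 1 \<and> inj_on f U" if "z \<in> ball 0 1" for z
      using assms(5) that unfolding locally_univalent_on_def by blast
    show "inj_on f (sphere 0 r)" if r: "0 < r" "r < 1" for r
    proof -
      have "sphere 0 r \<subseteq> (ball 0 1 :: complex set)" using r by auto
      from inj_on_subset[OF inj_\<epsilon>[OF r2[OF r]] this] show ?thesis
        using f_circle by (simp add: inj_on_def)
    qed
  qed
  have ctc: "close_to_convex_domain (f ` ball 0 r)" if r: "0 < r" "r < 1" for r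
  proof -
    define F where "F = (\<lambda>z. H z + of_real (r\<^sup>2) * cnj (G z))"
    have sub: "cball 0 r \<subseteq> (ball 0 1 :: complex set)" using r by auto
    have "continuous_on (ball 0 1) F" unfolding F_def
      by (intro continuous_intros holomorphic_on_imp_continuous_on H G)
    then have F: "continuous_on (cball 0 r) F" "inj_on F (cball 0 r)"
      using sub inj_\<epsilon>[OF r2[OF r]] unfolding F_def[symmetric] by (auto intro: continuous_on_subset inj_on_subset)
    have f: "continuous_on (cball 0 r) f" "inj_on f (cball 0 r)"
      using sub contf injf by (auto intro: continuous_on_subset inj_on_subset)
    have "f ` sphere 0 r = F ` sphere 0 r" unfolding F_def by (rule image_cong) (use f_circle in auto)
    then have "f ` ball 0 r = F ` ball 0 r"
      using image_ball_eq_inside[OF r(1) F] image_ball_eq_inside[OF r(1) f] by simp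
    moreover have "close_to_convex_domain (F ` ball 0 r)"
      unfolding F_def by (rule close_to_convex_harmonic_image[OF H G J diff key r2[OF r] r])
    ultimately show ?thesis by simp
  qed
  have "close_to_convex_domain (f ` ball 0 1)"
  proof -
    \<comment> \<open>The shift by 2 keeps the radii positive from the first one on.\<close>
    define \<rho> where "\<rho> = (\<lambda>n::nat. 1 - 1 / real (n + 2))"
    have \<rho>: "0 < \<rho> n" "\<rho> n < 1" for n by (simp_all add: \<rho>_def field_simps)
    have mono: "\<rho> m \<le> \<rho> n" if "m \<le> n" for m n using that by (simp add: \<rho>_def frac_le)
    have "incseq (\<lambda>n. f ` ball 0 (\<rho> n))" unfolding incseq_def using mono by (intro allI impI image_mono subset_ball) simp
    then have "close_to_convex_domain (\<Union>n. f ` ball 0 (\<rho> n))"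
      by (rule close_to_convex_increasing_union[OF ctc[OF \<rho>]])
    moreover have "(\<Union>n. f ` ball 0 (\<rho> n)) = f ` ball 0 1"
    proof -
      have "\<exists>n. z \<in> ball 0 (\<rho> n)" if "z \<in> ball 0 1" for z :: complex
      proof -
        obtain n :: nat where n: "1 / (1 - norm z) < real n" using reals_Archimedean2 by blast
        have "1 - norm z > 0" using that by simp
        then have "1 / real (n + 2) < 1 - norm z" using n by (simp add: field_simps)
        then show ?thesis by (intro exI[of _ n]) (simp add: \<rho>_def)
      qed
      moreover have "ball 0 (\<rho> n) \<subseteq> (ball 0 1 :: complex set)" for n using \<rho>(2)[of n] by (intro subset_ball) simp
      ultimately have "(\<Union>n. ball 0 (\<rho> n)) = (ball 0 1 :: complex set)" by blast
      then show ?thesis by (metis image_UN)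
    qed
    ultimately show ?thesis by simp
  qed
  moreover have "biharmonic_on f (ball 0 1)" unfolding f_def by (rule biharmonic_on_H_plus[OF open_ball H G])
  ultimately show ?thesis
    using injf ctc by (simp add: fully_close_to_convex_mapping_def close_to_convex_mapping_def)
qed

end
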